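(* Let $(X_n)_{n\in\mathbb Z}$ be a (real, centered) Gaussian stationary process with spectral measure $\nu$. Let $g=\sum_{n\in\mathbb Z}a_ne^{int}\in L^2(\nu)$ and let $(Y_n)_{n\in\mathbb Z}$ be the stationary Gaussian process such that $Y_0=\sum_{n\in\mathbb Z}a_nX_n$ (so $Y_k=\sum_{n\in\mathbb Z}a_nX_{n+k}$). Then $$Se(Y_0,\sigma)=Se(X_0,\sigma)+\int_{\mathbb T}\log|g|\,d\lambda .$$
   Context: $\lambda$ is the Lebesgue probability measure on the unit circle $\mathbb T$, and $\log$ is the natural logarithm. The Gaussian processes considered are real, centered, stationary, with strictly positive definite covariance sequence $r(n)=E[X_nX_0]$, so that their finite-dimensional laws have densities with respect to Lebesgue measure; the coefficients $a_n$ are real. The spectral measure of $(X_n)$ is the positive measure $\nu$ on $\mathbb T$ with Fourier coefficients $\hat\nu(n)=r(n)$. The series for $g$ is understood in $L^2(\nu)$ and the series for $Y_0$ correspondingly in $L^2$ of the underlying probability space. $\sigma$ denotes the shift. For a stationary real process $(Z_n)$ with $Z_0\in L^2$ and with $(Z_0,\dots,Z_{n-1})$ having a density $\rho_n$ with respect to Lebesgue measure $l^n$ on $\mathbb R^n$ for every $n\ge1$, the Shannon entropy is $Se(Z_0,\sigma)=\lim_n\frac1n\left(-\int_{\mathbb R^n}\rho_n\log\rho_n\,dl^n\right)$, a limit which exists and may be $-\infty$.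
   Formalization: If Se(X_0) = −∞, the right side can be undefined (the integral of log|g| may not exist, or the sum may be −∞+∞); equality is claimed whenever it is defined, which is proved if Se(X_0) > −∞. Y too is assumed to have strictly positive definite covariance, so that its entropy is defined. *)

theory Defs
  imports "HOL-Probability.Probability"
begin

section \<open>The unit circle\<close>

abbreviation circle :: "complex measure" where
  "circle \<equiv> restrict_space borel (sphere 0 1)"

definition circle_lebesgue :: "complex measure" where
  "circle_lebesgue = distr (uniform_measure lborel {0..<2 * pi}) circle cis"

lemma cis_measurable_circle [measurable]: "cis \<in> borel \<rightarrow>\<^sub>M circle"
  by (rule measurable_restrict_space2)
     (auto intro!: borel_measurable_continuous_onI continuous_intros)

lemma prob_space_circle_lebesgue: "prob_space circle_lebesgue"
proof -
  interpret U: prob_space "uniform_measure lborel {0..<2 * pi}"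
    by (rule prob_space_uniform_measure) auto
  show ?thesis
    unfolding circle_lebesgue_def by (rule U.prob_space_distr) simp
qed

section \<open>Extended-valued integrals\<close>

text \<open>The Bochner integral is 0 for non-integrable functions, but entropies and
  \<open>\<integral> log |g|\<close> may be \<open>-\<infinity>\<close>. If both the positive and the
  negative part have infinite integral, the integral does not exist; the value of
  \<open>ext_integral\<close> is then meaningless.\<close>

definition has_ext_integral :: "'a measure \<Rightarrow> ('a \<Rightarrow> ereal) \<Rightarrow> bool" where
  "has_ext_integral \<mu> h \<longleftrightarrow>
     (\<integral>\<^sup>+ x. e2ennreal (h x) \<partial>\<mu>) < \<infinity> \<or> (\<integral>\<^sup>+ x. e2ennreal (- h x) \<partial>\<mu>) < \<infinity>"

definition ext_integral :: "'a measure \<Rightarrow> ('a \<Rightarrow> ereal) \<Rightarrow> ereal" where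
  "ext_integral \<mu> h =
     enn2ereal (\<integral>\<^sup>+ x. e2ennreal (h x) \<partial>\<mu>) - enn2ereal (\<integral>\<^sup>+ x. e2ennreal (- h x) \<partial>\<mu>)"

text \<open>For \<open>x \<ge> 0\<close>, with \<open>log 0 = -\<infinity>\<close> (whereas \<open>ln 0 = 0\<close> in the library).\<close>

definition ext_log :: "real \<Rightarrow> ereal" where
  "ext_log x = (if x = 0 then - \<infinity> else ereal (ln x))"

section \<open>Convergence in \<open>L\<^sup>2\<close>\<close>

definition L2_limit ::
  "'a measure \<Rightarrow> (nat \<Rightarrow> 'a \<Rightarrow> 'b::{banach, second_countable_topology}) \<Rightarrow> ('a \<Rightarrow> 'b) \<Rightarrow> bool" where
  "L2_limit \<mu> s f \<longleftrightarrow>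
     (\<forall>N. s N \<in> borel_measurable \<mu> \<and> integrable \<mu> (\<lambda>x. (norm (s N x))\<^sup>2)) \<and>
     f \<in> borel_measurable \<mu> \<and> integrable \<mu> (\<lambda>x. (norm (f x))\<^sup>2) \<and>
     (\<lambda>N. \<integral>x. (norm (s N x - f x))\<^sup>2 \<partial>\<mu>) \<longlonglongrightarrow> 0"

text \<open>A bilateral series is the limit of its symmetric partial sums. This is the least
  restrictive of the usual modes of summation: it is implied by convergence of the two
  one-sided series and by unconditional convergence.\<close>

definition L2_series ::
  "'a measure \<Rightarrow> (int \<Rightarrow> 'a \<Rightarrow> 'b::{banach, second_countable_topology}) \<Rightarrow> ('a \<Rightarrow> 'b) \<Rightarrow> bool" where
  "L2_series \<mu> u f \<longleftrightarrow> L2_limit \<mu> (\<lambda>N x. \<Sum>n\<in>{- int N..int N}. u n x) f"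

section \<open>Stationary Gaussian processes\<close>

definition gaussian_rv :: "'a measure \<Rightarrow> ('a \<Rightarrow> real) \<Rightarrow> bool" where
  "gaussian_rv M Z \<longleftrightarrow> Z \<in> borel_measurable M \<and>
     ((\<exists>m. AE \<omega> in M. Z \<omega> = m) \<or>
      (\<exists>m s. s > 0 \<and> distributed M lborel Z (\<lambda>x. ennreal (normal_density m s x))))"

definition gaussian_process :: "'a measure \<Rightarrow> (int \<Rightarrow> 'a \<Rightarrow> real) \<Rightarrow> bool" where
  "gaussian_process M X \<longleftrightarrow>
     (\<forall>J c. finite J \<longrightarrow> gaussian_rv M (\<lambda>\<omega>. \<Sum>j\<in>J. c j * X j \<omega>))"

definition centered :: "'a measure \<Rightarrow> (int \<Rightarrow> 'a \<Rightarrow> real) \<Rightarrow> bool" where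
  "centered M X \<longleftrightarrow> (\<forall>n. integrable M (X n) \<and> (\<integral>\<omega>. X n \<omega> \<partial>M) = 0)"

definition stationary :: "'a measure \<Rightarrow> (int \<Rightarrow> 'a \<Rightarrow> real) \<Rightarrow> bool" where
  "stationary M X \<longleftrightarrow>
     (\<forall>n. X n \<in> borel_measurable M) \<and>
     (\<forall>k. distr M (\<Pi>\<^sub>M n\<in>UNIV. borel) (\<lambda>\<omega> n. X (n + k) \<omega>) =
          distr M (\<Pi>\<^sub>M n\<in>UNIV. borel) (\<lambda>\<omega> n. X n \<omega>))"

definition covariance :: "'a measure \<Rightarrow> (int \<Rightarrow> 'a \<Rightarrow> real) \<Rightarrow> int \<Rightarrow> real" where
  "covariance M X n = (\<integral>\<omega>. X n \<omega> * X 0 \<omega> \<partial>M)"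

definition strictly_positive_definite :: "(int \<Rightarrow> real) \<Rightarrow> bool" where
  "strictly_positive_definite r \<longleftrightarrow>
     (\<forall>J c. finite J \<longrightarrow> (\<exists>j\<in>J. c j \<noteq> 0) \<longrightarrow>
        (\<Sum>i\<in>J. \<Sum>j\<in>J. c i * c j * r (i - j)) > 0)"

definition stationary_gaussian :: "'a measure \<Rightarrow> (int \<Rightarrow> 'a \<Rightarrow> real) \<Rightarrow> bool" where
  "stationary_gaussian M X \<longleftrightarrow>
     gaussian_process M X \<and> centered M X \<and> stationary M X \<and>
     strictly_positive_definite (covariance M X)"

definition spectral_measure ::
  "'a measure \<Rightarrow> (int \<Rightarrow> 'a \<Rightarrow> real) \<Rightarrow> complex measure \<Rightarrow> bool" where
  "spectral_measure M X \<nu> \<longleftrightarrow>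
     sets \<nu> = sets circle \<and> finite_measure \<nu> \<and>
     (\<forall>n. (\<integral>z. z powi (- n) \<partial>\<nu>) = of_real (covariance M X n))"

section \<open>Shannon entropy\<close>

text \<open>\<open>l\<^sup>n\<close> is Lebesgue measure on \<open>\<real>\<^sup>n\<close>, with vectors as functions on \<open>{..<n}\<close>.\<close>

abbreviation lebesgue_pow :: "nat \<Rightarrow> (nat \<Rightarrow> real) measure" where
  "lebesgue_pow n \<equiv> \<Pi>\<^sub>M i\<in>{..<n}. lborel"

definition joint_density ::
  "'a measure \<Rightarrow> (int \<Rightarrow> 'a \<Rightarrow> real) \<Rightarrow> nat \<Rightarrow> (nat \<Rightarrow> real) \<Rightarrow> real" where
  "joint_density M Z n x =
     enn2real (RN_deriv (lebesgue_pow n)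
       (distr M (lebesgue_pow n) (\<lambda>\<omega>. \<lambda>i\<in>{..<n}. Z (int i) \<omega>)) x)"

definition shannon_entropy :: "'a measure \<Rightarrow> (int \<Rightarrow> 'a \<Rightarrow> real) \<Rightarrow> ereal" where
  "shannon_entropy M Z =
     lim (\<lambda>n. ereal (1 / real n) *
       (- ext_integral (lebesgue_pow n)
            (\<lambda>x. ereal (joint_density M Z n x * ln (joint_density M Z n x)))))"

end

theory Submission
  imports Defs "HOL-Computational_Algebra.Fundamental_Theorem_Algebra"
begin

text \<open>
  Let \<open>s\<close> be the limiting one-step prediction error of a stationary Gaussian process. By the chain
  rule its entropy is \<open>ln (2\<pi>e s) / 2\<close>, and \<open>s\<close> is the infimum \<open>szego \<nu>\<close> of \<open>\<integral> |p|\<^sup>2 d\<nu>\<close> over the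
  polynomials with \<open>p(0) = 1\<close>. Since \<open>Y\<close> has spectral measure \<open>|g|\<^sup>2\<nu>\<close>, the claim is
  \<open>szego (|g|\<^sup>2\<nu>) = szego \<nu> \<cdot> exp (2 \<integral> ln |g| d\<lambda>)\<close>. A Szego-type argument that needs no Lebesgue
  decomposition of \<open>\<nu>\<close> shows that \<open>szego \<nu>\<close> is the infimum of \<open>exp (- \<integral> u d\<lambda>) \<integral> e\<^sup>u d\<nu>\<close> over
  bounded measurable \<open>u\<close>, and substituting \<open>u - 2 ln |g|\<close>, suitably truncated, for \<open>u\<close> gives the
  factor \<open>exp (2 \<integral> ln |g| d\<lambda>)\<close>.
\<close>

section \<open>Integrals over the circle\<close>

text \<open>Bounded u are easier to handle than polynomials because of a substitution: multiplying
  \<nu> by e^w is undone by replacing u with u - w, at the price of a factor exp (mean of w). A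
  singular part of \<nu> asks for no separate treatment, since u may be very negative on a
  \<lambda>-null set without changing its mean. Polynomials and bounded functions are linked by
  Jensen's inequality in one direction (u = 2 ln |p| has mean at least 0 if p(0) = 1) and by
  approximation in the other: bounded functions by continuous ones in L1 of a measure above both
  \<nu> and \<lambda>, continuous ones uniformly by trigonometric polynomials. The obstacle is that
  ln |g| is unbounded and its integral may be infinite or fail to exist. It is therefore cut off at
  -k and k, and a constant multiple of 1 + |g|^2 majorises every integrand, uniformly in k. Strict
  positive definiteness keeps each finite prediction error positive. Only the limit can be 0, and
  then the entropy is -\<infinity>.\<close>

lemma space_circle_lebesgue [simp]: "space circle_lebesgue = sphere 0 1"
  by (simp add: circle_lebesgue_def space_restrict_space)

lemma sets_circle_lebesgue [measurable_cong, simp]: "sets circle_lebesgue = sets circle"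
  by (simp add: circle_lebesgue_def)

lemma uniform_interval_eq:
  "uniform_measure lborel {0..<2 * pi} =
     density lborel (\<lambda>t. ennreal (1 / (2 * pi)) * indicator {0..<2 * pi} t)"
proof -
  have "1 / ennreal (2 * pi) = ennreal (1 / (2 * pi))"
    by (metis divide_ennreal ennreal_1 pi_gt_zero zero_le_one zero_less_mult_iff zero_less_numeral)
  then show ?thesis
    unfolding uniform_measure_def
    by (intro density_cong) (auto split: split_indicator)
qed

lemma integral_circle_lebesgue:
  fixes f :: "complex \<Rightarrow> 'b::{banach, second_countable_topology}"
  assumes "f \<in> borel_measurable circle"
  shows "(\<integral>z. f z \<partial>circle_lebesgue) = (1 / (2 * pi)) *\<^sub>R (LBINT t:{0..<2*pi}. f (cis t))"
proof -
  have m: "(\<lambda>t. f (cis t)) \<in> borel_measurable borel"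
    using measurable_compose[OF cis_measurable_circle assms] by simp
  have "(\<integral>z. f z \<partial>circle_lebesgue) = (\<integral>t. f (cis t) \<partial>uniform_measure lborel {0..<2 * pi})"
    unfolding circle_lebesgue_def using assms by (subst integral_distr) auto
  also have "\<dots> = (\<integral>t. (1 / (2 * pi) * indicator {0..<2*pi} t) *\<^sub>R f (cis t) \<partial>lborel)"
    unfolding uniform_interval_eq using m
    by (subst integral_density[symmetric])
       (auto intro!: arg_cong2[where f=lebesgue_integral] density_cong split: split_indicator)
  also have "\<dots> = (\<integral>t. (1 / (2 * pi)) *\<^sub>R (indicator {0..<2*pi} t *\<^sub>R f (cis t)) \<partial>lborel)"
    by simp
  also have "\<dots> = (1 / (2 * pi)) *\<^sub>R (LBINT t:{0..<2*pi}. f (cis t))"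
    unfolding set_lebesgue_integral_def by (rule integral_scaleR_right)
  finally show ?thesis .
qed

lemma continuous_measurable_circle:
  fixes f :: "complex \<Rightarrow> 'b::topological_space"
  assumes "continuous_on (sphere 0 1) f"
  shows "f \<in> borel_measurable circle"
  using borel_measurable_continuous_on_restrict[OF assms] by simp

lemma finite_measure_continuous_integrable:
  fixes f :: "complex \<Rightarrow> 'b::{banach, second_countable_topology}"
  assumes "finite_measure \<mu>" and sets: "sets \<mu> = sets circle" and "continuous_on (sphere 0 1) f"
  shows "integrable \<mu> f"
proof -
  interpret finite_measure \<mu> by fact
  have "compact (f ` sphere 0 1)"
    by (intro compact_continuous_image assms compact_sphere)
  then have "bounded (f ` sphere 0 1)"
    by (rule compact_imp_bounded)
  then obtain B where B: "\<And>z. z \<in> sphere 0 1 \<Longrightarrow> norm (f z) \<le> B"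
    unfolding bounded_iff by (metis imageI)
  have sp: "space \<mu> = sphere 0 1"
    using sets_eq_imp_space_eq[OF sets] by (simp add: space_restrict_space)
  show ?thesis
  proof (rule integrable_const_bound[where B = B])
    show "AE z in \<mu>. norm (f z) \<le> B" using B sp by (intro AE_I2) auto
    show "f \<in> borel_measurable \<mu>"
      using continuous_measurable_circle[OF assms(3)] by (simp add: measurable_cong_sets[OF sets refl])
  qed
qed

interpretation circle_lebesgue: prob_space circle_lebesgue
  by (rule prob_space_circle_lebesgue)

lemma integral_circle_power:
  "(\<integral>z. z ^ k \<partial>circle_lebesgue) = (if k = 0 then 1 else 0)"
proof (cases "k = 0")
  case True
  then show ?thesis using circle_lebesgue.prob_space by simp
next
  case False
  define c where "c = \<i> * complex_of_real (real k)"
  have c0: "c \<noteq> 0" using False by (simp add: c_def)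
  have cis: "cis t ^ k = exp (t *\<^sub>R c)" for t
  proof -
    have "\<i> * complex_of_real (real k * t) = t *\<^sub>R c"
      by (simp add: c_def scaleR_conv_of_real)
    then show ?thesis by (simp only: Complex.DeMoivre cis_conv_exp[of "real k * t"])
  qed
  have "(LBINT t:{0..<2*pi}. cis t ^ k) = (\<integral>t. indicator {0..2*pi} t *\<^sub>R exp (t *\<^sub>R c) \<partial>lborel)"
    unfolding set_lebesgue_integral_def
  proof (rule integral_cong_AE)
    show "AE t in lborel. indicator {0..<2 * pi} t *\<^sub>R cis t ^ k = indicator {0..2 * pi} t *\<^sub>R exp (t *\<^sub>R c)"
      using AE_lborel_singleton[of "2*pi"] by eventually_elim (auto simp: cis split: split_indicator)
    have [measurable]: "(\<lambda>t. exp (t *\<^sub>R c)) \<in> borel_measurable borel"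
      by (intro borel_measurable_continuous_onI continuous_intros)
    show "(\<lambda>t. indicator {0..2 * pi} t *\<^sub>R exp (t *\<^sub>R c)) \<in> borel_measurable lborel"
      "(\<lambda>t. indicator {0..<2 * pi} t *\<^sub>R cis t ^ k) \<in> borel_measurable lborel"
      unfolding cis by measurable
  qed
  also have "\<dots> = exp ((2*pi) *\<^sub>R c) / c - exp (0 *\<^sub>R c) / c"
  proof -
    have "((\<lambda>t. exp (t *\<^sub>R c) / c) has_vector_derivative exp (t *\<^sub>R c)) (at t within S)" for t S
      using has_vector_derivative_divide[OF exp_scaleR_has_vector_derivative_right[of c t S], of c] c0 by simp
    then have "has_bochner_integral lborel (\<lambda>t. indicator {0..2*pi} t *\<^sub>R exp (t *\<^sub>R c))
        (exp ((2*pi) *\<^sub>R c) / c - exp (0 *\<^sub>R c) / c)"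
      by (intro has_bochner_integral_FTC_Icc) (auto intro!: continuous_intros)
    then show ?thesis
      by (simp add: has_bochner_integral_iff)
  qed
  also have "exp ((2*pi) *\<^sub>R c) = 1"
    unfolding cis[symmetric] by simp
  finally have "(LBINT t:{0..<2*pi}. cis t ^ k) = 0" by simp
  moreover have "(\<lambda>z::complex. z ^ k) \<in> borel_measurable circle"
    by (intro continuous_measurable_circle continuous_intros)
  ultimately show ?thesis
    using False integral_circle_lebesgue[of "\<lambda>z. z ^ k"] by simp
qed

lemma circle_poly_integrable: 
  assumes "finite_measure \<mu>" "sets \<mu> = sets circle"
  shows "integrable \<mu> (\<lambda>z. poly p z)"
  by (rule finite_measure_continuous_integrable[OF assms]) (intro continuous_intros)

lemma integral_circle_poly: "(\<integral>z. poly p z \<partial>circle_lebesgue) = poly p 0"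
proof -
  have "(\<integral>z. poly p z \<partial>circle_lebesgue) = (\<Sum>i\<le>degree p. coeff p i * (\<integral>z. z ^ i \<partial>circle_lebesgue))"
    unfolding poly_altdef
  proof (subst Bochner_Integration.integral_sum)
    show "integrable circle_lebesgue (\<lambda>z. coeff p i * z ^ i)" for i
      by (intro finite_measure_continuous_integrable continuous_intros
          circle_lebesgue.finite_measure_axioms sets_circle_lebesgue)
  qed simp
  also have "\<dots> = (\<Sum>i\<le>degree p. if i = 0 then coeff p i else 0)"
    by (intro sum.cong refl) (simp add: integral_circle_power)
  finally show ?thesis
    by (simp add: poly_0_coeff_0)
qed


section \<open>Jensen's inequality for polynomials without zeros on the circle\<close>

lemma circle_lebesgue_continuous_integrable:
  fixes f :: "complex \<Rightarrow> 'b::{banach, second_countable_topology}"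
  assumes "continuous_on (sphere 0 1) f"
  shows "integrable circle_lebesgue f"
  by (rule finite_measure_continuous_integrable[OF circle_lebesgue.finite_measure_axioms
        sets_circle_lebesgue assms])

text \<open>The integrand is the real part of Ln (1 - bz), whose power series in z has no constant
  term. Each partial sum therefore has mean 0, and as |b| < 1 a geometric series dominates them on
  the circle.\<close>

lemma integral_ln_cmod_one_minus:
  assumes "cmod b < 1"
  shows "(\<integral>z. ln (cmod (1 - b * z)) \<partial>circle_lebesgue) = 0"
proof -
  \<comment> \<open>The term with i = 0 is a division by 0, hence 0, so this is a partial sum of the
    logarithm series without a special case.\<close>
  define S where "S n z = (\<Sum>i<n. - ((b * z) ^ i) / of_nat i)" for n and z :: complex
  have bz: "cmod (b * z) < 1" if "z \<in> sphere 0 1" for z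
    using that assms by (simp add: norm_mult)
  have nz: "1 - b * z \<noteq> 0" if "z \<in> sphere 0 1" for z
    using bz[OF that] by auto
  have contL: "continuous_on (sphere 0 1) (\<lambda>z. Ln (1 - b * z))"
  proof (intro continuous_intros)
    fix z :: complex assume "z \<in> sphere 0 1"
    then have "0 < Re (1 - b * z)"
      using bz complex_Re_le_cmod[of "b * z"] by fastforce
    then show "1 - b * z \<notin> \<real>\<^sub>\<le>\<^sub>0"
      by (auto simp: complex_nonpos_Reals_iff)
  qed
  have contS: "continuous_on (sphere 0 1) (S n)" for n
  proof -
    have "continuous_on (sphere 0 1) (\<lambda>z. - ((b * z) ^ i) / of_nat i)" for i :: nat
      by (cases "i = 0") (auto intro!: continuous_on_divide continuous_on_minus continuous_on_power
          continuous_on_mult continuous_on_const continuous_on_id)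
    then show ?thesis
      unfolding S_def by (intro continuous_on_sum) auto
  qed
  have int0: "(\<integral>z. S n z \<partial>circle_lebesgue) = 0" for n
  proof -
    have "S n z = (\<Sum>i<n. (- (b ^ i) / of_nat i) * z ^ i)" for z
      unfolding S_def by (intro sum.cong) (auto simp: power_mult_distrib)
    then have "(\<integral>z. S n z \<partial>circle_lebesgue) = (\<integral>z. (\<Sum>i<n. (- (b ^ i) / of_nat i) * z ^ i) \<partial>circle_lebesgue)"
      by simp
    also have "\<dots> = (\<Sum>i<n. (- (b ^ i) / of_nat i) * (\<integral>z. z ^ i \<partial>circle_lebesgue))"
    proof (subst Bochner_Integration.integral_sum)
      show "integrable circle_lebesgue (\<lambda>z. - (b ^ i) / of_nat i * z ^ i)" for i
        by (intro circle_lebesgue_continuous_integrable continuous_on_mult continuous_on_const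
            continuous_on_power continuous_on_id)
    qed simp
    also have "\<dots> = 0"
      by (intro sum.neutral) (auto simp: integral_circle_power)
    finally show ?thesis .
  qed
  have lim: "(\<lambda>n. S n z) \<longlonglongrightarrow> Ln (1 - b * z)" if "z \<in> sphere 0 1" for z
    using Ln_series'[of "- (b * z)"] bz[OF that] by (simp add: S_def sums_def)
  have bound: "cmod (S n z) \<le> 1 / (1 - cmod b)" if "z \<in> sphere 0 1" for n z
  proof -
    have "cmod (S n z) \<le> (\<Sum>i<n. cmod b ^ i)"
      unfolding S_def
    proof (rule sum_norm_le)
      fix i
      have "cmod (- ((b * z) ^ i) / of_nat i) = cmod b ^ i / real i"
        using that by (simp add: norm_divide norm_power norm_mult)
      also have "\<dots> \<le> cmod b ^ i"
        by (cases "i = 0") (auto simp: field_simps mult_le_cancel_right1 not_less)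
      finally show "cmod (- ((b * z) ^ i) / of_nat i) \<le> cmod b ^ i" .
    qed
    also have "\<dots> \<le> (\<Sum>i. cmod b ^ i)"
      using assms by (intro sum_le_suminf summable_geometric) auto
    also have "\<dots> = 1 / (1 - cmod b)"
      using assms by (intro suminf_geometric) auto
    finally show ?thesis .
  qed
  have "(\<lambda>n. \<integral>z. S n z \<partial>circle_lebesgue) \<longlonglongrightarrow> (\<integral>z. Ln (1 - b * z) \<partial>circle_lebesgue)"
  proof (rule integral_dominated_convergence[where w = "\<lambda>_. 1 / (1 - cmod b)"])
    show "(\<lambda>z. Ln (1 - b * z)) \<in> borel_measurable circle_lebesgue"
      using circle_lebesgue_continuous_integrable[OF contL] by auto
    show "S n \<in> borel_measurable circle_lebesgue" for n
      using circle_lebesgue_continuous_integrable[OF contS[of n]] by auto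
    show "AE z in circle_lebesgue. (\<lambda>n. S n z) \<longlonglongrightarrow> Ln (1 - b * z)"
      using lim by (intro AE_I2) auto
    show "AE z in circle_lebesgue. cmod (S n z) \<le> 1 / (1 - cmod b)" for n
      using bound by (intro AE_I2) auto
  qed simp
  then have "(\<integral>z. Ln (1 - b * z) \<partial>circle_lebesgue) = 0"
    unfolding int0 by (simp add: LIMSEQ_const_iff)
  moreover have "(\<integral>z. Re (Ln (1 - b * z)) \<partial>circle_lebesgue) = Re (\<integral>z. Ln (1 - b * z) \<partial>circle_lebesgue)"
    by (rule integral_Re[OF circle_lebesgue_continuous_integrable[OF contL]])
  moreover have "(\<integral>z. Re (Ln (1 - b * z)) \<partial>circle_lebesgue) = (\<integral>z. ln (cmod (1 - b * z)) \<partial>circle_lebesgue)"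
    using nz by (intro Bochner_Integration.integral_cong refl) auto
  ultimately show ?thesis by simp
qed

lemma integrable_ln_cmod_circle:
  assumes "continuous_on (sphere 0 1) f" "\<And>z. z \<in> sphere 0 1 \<Longrightarrow> f z \<noteq> 0"
  shows "integrable circle_lebesgue (\<lambda>z. ln (cmod (f z)))"
  by (rule circle_lebesgue_continuous_integrable)
     (use assms in \<open>auto intro!: continuous_on_ln continuous_on_norm\<close>)

text \<open>The integral is in fact ln (max 1 |a|). A root outside the disc is divided out as the
  constant a; a root inside is first reflected, since |z - a| = |1 - cnj a * z| on the circle.
  Either way the logarithm of the remaining factor has mean 0.\<close>

lemma ln_cmod_le_integral_linear:
  assumes "cmod a \<noteq> 1" "a \<noteq> 0"
  shows "ln (cmod a) \<le> (\<integral>z. ln (cmod (z - a)) \<partial>circle_lebesgue)"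
proof (cases "cmod a < 1")
  case True
  have "cmod (z - a) = cmod (1 - cnj a * z)" if "z \<in> sphere 0 1" for z
  proof -
    have zz: "cnj z * z = 1" using that by (simp add: mult.commute flip: complex_norm_square)
    have "cmod (z - a) = cmod (cnj (z - a)) * cmod z" using that by (simp del: complex_cnj_diff)
    also have "\<dots> = cmod (cnj z * z - cnj a * z)"
      by (simp add: algebra_simps flip: norm_mult)
    finally show ?thesis unfolding zz .
  qed
  then have "(\<integral>z. ln (cmod (z - a)) \<partial>circle_lebesgue) = (\<integral>z. ln (cmod (1 - cnj a * z)) \<partial>circle_lebesgue)"
    by (intro Bochner_Integration.integral_cong) auto
  also have "\<dots> = 0"
    using True by (intro integral_ln_cmod_one_minus) simp
  finally show ?thesis using True assms by simp
next
  case False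
  then have a: "cmod a > 1" using assms by simp
  have b: "cmod (1 / a) < 1" unfolding norm_divide using a by (subst divide_less_eq_1_pos) auto
  have nz: "1 - (1 / a) * z \<noteq> 0" if "z \<in> sphere 0 1" for z
    using that a by (auto simp: field_simps)
  have "ln (cmod (z - a)) = ln (cmod a) + ln (cmod (1 - (1 / a) * z))" if "z \<in> sphere 0 1" for z
  proof -
    have "cmod (z - a) = cmod (a * (1 - (1 / a) * z))"
      using assms by (simp add: right_diff_distrib norm_minus_commute)
    then show ?thesis using nz[OF that] assms by (simp add: norm_mult ln_mult_pos)
  qed
  then have "(\<integral>z. ln (cmod (z - a)) \<partial>circle_lebesgue) =
      (\<integral>z. ln (cmod a) + ln (cmod (1 - (1 / a) * z)) \<partial>circle_lebesgue)"
    by (intro Bochner_Integration.integral_cong) auto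
  also have "\<dots> = ln (cmod a) + (\<integral>z. ln (cmod (1 - (1 / a) * z)) \<partial>circle_lebesgue)"
  proof (subst Bochner_Integration.integral_add)
    show "integrable circle_lebesgue (\<lambda>z. ln (cmod (1 - (1 / a) * z)))"
      by (intro integrable_ln_cmod_circle nz continuous_intros)
  qed (use circle_lebesgue.prob_space in simp_all)
  also have "\<dots> = ln (cmod a)"
    using integral_ln_cmod_one_minus[OF b] by simp
  finally show ?thesis by simp
qed

text \<open>Jensen's inequality, by splitting off one root at a time. Excluding zeros on the circle
  keeps all logarithms continuous; a polynomial that has such zeros is dilated beforehand, see
  \<open>poly_dilation_nonzero\<close>.\<close>

lemma ln_cmod_poly_le_integral:
  assumes "\<And>z. z \<in> sphere 0 1 \<Longrightarrow> poly p z \<noteq> 0" "poly p 0 \<noteq> 0"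
  shows "ln (cmod (poly p 0)) \<le> (\<integral>z. ln (cmod (poly p z)) \<partial>circle_lebesgue)"
  using assms
proof (induction "degree p" arbitrary: p)
  case 0
  then obtain c where "p = [:c:]" by (metis degree_eq_zeroE)
  then show ?case using circle_lebesgue.prob_space by simp
next
  case (Suc n)
  have "\<not> constant (poly p)"
    using Suc.hyps(2) by (simp add: constant_degree)
  then obtain a where "poly p a = 0"
    using fundamental_theorem_of_algebra by blast
  then obtain q where p: "p = [:- a, 1:] * q"
    by (metis dvdE poly_eq_0_iff_dvd)
  have q0: "q \<noteq> 0" using p Suc.prems(2) by auto
  have a: "cmod a \<noteq> 1" "a \<noteq> 0" using \<open>poly p a = 0\<close> Suc.prems by auto
  have q: "poly q z \<noteq> 0" if "z \<in> sphere 0 1" for z using Suc.prems(1)[OF that] p by auto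
  have q00: "poly q 0 \<noteq> 0" using Suc.prems(2) p by auto
  have za: "z - a \<noteq> 0" if "z \<in> sphere 0 1" for z using a(1) that by auto
  have "degree p = Suc (degree q)" unfolding p using q0 by (subst degree_mult_eq) auto
  then have IH: "ln (cmod (poly q 0)) \<le> (\<integral>z. ln (cmod (poly q z)) \<partial>circle_lebesgue)"
    using Suc.hyps(1)[of q] Suc.hyps(2) q q00 by simp
  have "ln (cmod (poly p 0)) = ln (cmod a) + ln (cmod (poly q 0))"
    unfolding p using a q00 by (simp add: norm_mult ln_mult_pos)
  also have "\<dots> \<le> (\<integral>z. ln (cmod (z - a)) \<partial>circle_lebesgue) + (\<integral>z. ln (cmod (poly q z)) \<partial>circle_lebesgue)"
    by (intro add_mono IH ln_cmod_le_integral_linear a)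
  also have "\<dots> = (\<integral>z. ln (cmod (z - a)) + ln (cmod (poly q z)) \<partial>circle_lebesgue)"
    by (intro Bochner_Integration.integral_add[symmetric] integrable_ln_cmod_circle q za continuous_intros)
  also have "\<dots> = (\<integral>z. ln (cmod (poly p z)) \<partial>circle_lebesgue)"
  proof (intro Bochner_Integration.integral_cong refl)
    fix z assume "z \<in> space circle_lebesgue"
    then have "z - a \<noteq> 0" "poly q z \<noteq> 0" using q za by auto
    moreover have "poly p z = (z - a) * poly q z" by (simp add: p algebra_simps)
    ultimately show "ln (cmod (z - a)) + ln (cmod (poly q z)) = ln (cmod (poly p z))"
      by (simp add: norm_mult ln_mult_pos)
  qed
  finally show ?case .
qed

section \<open>Approximation by continuous functions and trigonometric polynomials\<close>

text \<open>The L1 closure of the continuous functions. The approximants are continuous on the whole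
  space, not only on the carrier of \<mu>, so that the induction over Borel sets can run in the
  ambient space.\<close>

definition L1_approximable :: "'a::topological_space measure \<Rightarrow> ('a \<Rightarrow> real) \<Rightarrow> bool" where
  "L1_approximable \<mu> u \<longleftrightarrow> integrable \<mu> u \<and>
     (\<forall>e>0. \<exists>\<phi>. continuous_on UNIV \<phi> \<and> integrable \<mu> \<phi> \<and> (\<integral>x. \<bar>\<phi> x - u x\<bar> \<partial>\<mu>) < e)"

lemma L1_approximableI:
  assumes "integrable \<mu> u"
    "\<And>e. e > 0 \<Longrightarrow> \<exists>\<phi>. continuous_on UNIV \<phi> \<and> integrable \<mu> \<phi> \<and> (\<integral>x. \<bar>\<phi> x - u x\<bar> \<partial>\<mu>) < e"
  shows "L1_approximable \<mu> u"
  using assms by (auto simp: L1_approximable_def)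

lemma L1_approximableE:
  assumes "L1_approximable \<mu> u" "e > 0"
  obtains \<phi> where "continuous_on UNIV \<phi>" "integrable \<mu> \<phi>" "(\<integral>x. \<bar>\<phi> x - u x\<bar> \<partial>\<mu>) < e"
  using assms by (auto simp: L1_approximable_def)

lemma L1_approximable_add:
  assumes u: "L1_approximable \<mu> u" and v: "L1_approximable \<mu> v"
  shows "L1_approximable \<mu> (\<lambda>x. u x + v x)"
proof (rule L1_approximableI)
  have [simp]: "integrable \<mu> u" "integrable \<mu> v" using u v by (auto simp: L1_approximable_def)
  then show "integrable \<mu> (\<lambda>x. u x + v x)" by simp
  fix e :: real assume "e > 0"
  obtain \<phi> where p[simp]: "continuous_on UNIV \<phi>" "integrable \<mu> \<phi>" "(\<integral>x. \<bar>\<phi> x - u x\<bar> \<partial>\<mu>) < e/2"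
    by (rule L1_approximableE[OF u half_gt_zero[OF \<open>e > 0\<close>]])
  obtain \<psi> where q[simp]: "continuous_on UNIV \<psi>" "integrable \<mu> \<psi>" "(\<integral>x. \<bar>\<psi> x - v x\<bar> \<partial>\<mu>) < e/2"
    by (rule L1_approximableE[OF v half_gt_zero[OF \<open>e > 0\<close>]])
  have "(\<integral>x. \<bar>\<phi> x + \<psi> x - (u x + v x)\<bar> \<partial>\<mu>) \<le> (\<integral>x. \<bar>\<phi> x - u x\<bar> + \<bar>\<psi> x - v x\<bar> \<partial>\<mu>)"
    by (intro integral_mono) auto
  also have "\<dots> = (\<integral>x. \<bar>\<phi> x - u x\<bar> \<partial>\<mu>) + (\<integral>x. \<bar>\<psi> x - v x\<bar> \<partial>\<mu>)"
    by (intro Bochner_Integration.integral_add) auto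
  also have "\<dots> < e" using p(3) q(3) by linarith
  finally show "\<exists>\<phi>. continuous_on UNIV \<phi> \<and> integrable \<mu> \<phi> \<and> (\<integral>x. \<bar>\<phi> x - (u x + v x)\<bar> \<partial>\<mu>) < e"
    by (intro exI[of _ "\<lambda>x. \<phi> x + \<psi> x"]) (auto intro!: continuous_on_add)
qed

lemma L1_approximable_scale:
  assumes u: "L1_approximable \<mu> u"
  shows "L1_approximable \<mu> (\<lambda>x. u x * c)"
proof (rule L1_approximableI)
  have [simp]: "integrable \<mu> u" using u by (auto simp: L1_approximable_def)
  then show "integrable \<mu> (\<lambda>x. u x * c)" by simp
  fix e :: real assume "e > 0"
  define d where "d = e / (\<bar>c\<bar> + 1)"
  have "d > 0" using \<open>e > 0\<close> by (simp add: d_def)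
  obtain \<phi> where p[simp]: "continuous_on UNIV \<phi>" "integrable \<mu> \<phi>" and le: "(\<integral>x. \<bar>\<phi> x - u x\<bar> \<partial>\<mu>) < d"
    by (rule L1_approximableE[OF u \<open>d > 0\<close>])
  have "(\<integral>x. \<bar>\<phi> x * c - u x * c\<bar> \<partial>\<mu>) = \<bar>c\<bar> * (\<integral>x. \<bar>\<phi> x - u x\<bar> \<partial>\<mu>)"
    by (simp add: abs_mult mult.commute flip: left_diff_distrib right_diff_distrib)
  also have "\<dots> \<le> \<bar>c\<bar> * d" using le by (intro mult_left_mono) auto
  also have "\<dots> < (\<bar>c\<bar> + 1) * d" using \<open>d > 0\<close> by simp
  also have "\<dots> = e" by (simp add: d_def)
  finally show "\<exists>\<phi>. continuous_on UNIV \<phi> \<and> integrable \<mu> \<phi> \<and> (\<integral>x. \<bar>\<phi> x - u x * c\<bar> \<partial>\<mu>) < e"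
    by (intro exI[of _ "\<lambda>x. \<phi> x * c"]) (auto intro!: continuous_on_mult)
qed

lemma L1_approximable_lim:
  assumes u: "\<And>i::nat. L1_approximable \<mu> (s i)" and f: "integrable \<mu> f"
    and lim: "(\<lambda>i. \<integral>x. \<bar>s i x - f x\<bar> \<partial>\<mu>) \<longlonglongrightarrow> 0"
  shows "L1_approximable \<mu> f"
proof (rule L1_approximableI[OF f])
  fix e :: real assume "e > 0"
  then have "eventually (\<lambda>i. (\<integral>x. \<bar>s i x - f x\<bar> \<partial>\<mu>) < e/2) sequentially"
    using order_tendstoD(2)[OF lim, of "e/2"] by simp
  from eventually_happens'[OF sequentially_bot this]
  obtain i where i: "(\<integral>x. \<bar>s i x - f x\<bar> \<partial>\<mu>) < e/2" ..
  have [simp]: "integrable \<mu> (s i)" using u by (auto simp: L1_approximable_def)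
  note f[simp]
  obtain \<phi> where p[simp]: "continuous_on UNIV \<phi>" "integrable \<mu> \<phi>" and le: "(\<integral>x. \<bar>\<phi> x - s i x\<bar> \<partial>\<mu>) < e/2"
    by (rule L1_approximableE[OF u half_gt_zero[OF \<open>e > 0\<close>]])
  have "(\<integral>x. \<bar>\<phi> x - f x\<bar> \<partial>\<mu>) \<le> (\<integral>x. \<bar>\<phi> x - s i x\<bar> + \<bar>s i x - f x\<bar> \<partial>\<mu>)"
    by (intro integral_mono) auto
  also have "\<dots> = (\<integral>x. \<bar>\<phi> x - s i x\<bar> \<partial>\<mu>) + (\<integral>x. \<bar>s i x - f x\<bar> \<partial>\<mu>)"
    by (intro Bochner_Integration.integral_add) auto
  also have "\<dots> < e" using i le by linarith
  finally show "\<exists>\<phi>. continuous_on UNIV \<phi> \<and> integrable \<mu> \<phi> \<and> (\<integral>x. \<bar>\<phi> x - f x\<bar> \<partial>\<mu>) < e"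
    by (intro exI[of _ \<phi>]) simp
qed

text \<open>The tents max 0 (1 - k * dist (x, C)) are continuous, equal 1 on C and vanish eventually
  at each point off C, because C is closed. They converge boundedly to the indicator.\<close>

lemma L1_approximable_closed_indicator:
  fixes C S :: "'a::metric_space set"
  assumes fin: "finite_measure \<mu>" and sets: "sets \<mu> = sets (restrict_space borel S)" and C: "closed C"
  shows "L1_approximable \<mu> (indicator C)"
proof (cases "C = {}")
  \<comment> \<open>\<open>infdist\<close> to the empty set is 0 by convention, so the tents would
    be constantly 1 here.\<close>
  case True
  then show ?thesis
    by (intro L1_approximableI) (auto intro!: exI[of _ "\<lambda>_. 0"])
next
  case False
  interpret finite_measure \<mu> by fact
  have meas: "f \<in> borel_measurable \<mu>" if "f \<in> borel_measurable borel" for f :: "'a \<Rightarrow> real"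
    using measurable_restrict_space1[OF that, of S] by (simp add: measurable_cong_sets[OF sets refl])
  have indm: "(indicator C :: 'a \<Rightarrow> real) \<in> borel_measurable \<mu>"
    using C by (intro meas borel_measurable_indicator) auto
  have ind: "integrable \<mu> (indicator C :: 'a \<Rightarrow> real)"
    by (rule integrable_const_bound[where B = 1]) (auto simp: indm split: split_indicator)
  define s where "s k x = max 0 (1 - real k * infdist x C)" for k x
  have cont: "continuous_on UNIV (s k)" for k
    unfolding s_def by (intro continuous_on_max continuous_intros)
  have sm: "s k \<in> borel_measurable \<mu>" for k
    by (intro meas borel_measurable_continuous_onI cont)
  have sb: "\<bar>s k x\<bar> \<le> 1" for k x
    unfolding s_def using infdist_nonneg[of x C] by (auto simp: max_def)
  have si: "integrable \<mu> (s k)" for k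
    by (rule integrable_const_bound[where B = 1]) (auto simp: sm sb)
  have "(\<lambda>k. \<integral>x. \<bar>s k x - indicator C x\<bar> \<partial>\<mu>) \<longlonglongrightarrow> (\<integral>x. 0 \<partial>\<mu>)"
  proof (rule integral_dominated_convergence[where w = "\<lambda>_. 2"])
    show "AE x in \<mu>. (\<lambda>k. \<bar>s k x - indicator C x\<bar>) \<longlonglongrightarrow> 0"
    proof (intro AE_I2)
      fix x
      show "(\<lambda>k. \<bar>s k x - indicator C x\<bar>) \<longlonglongrightarrow> 0"
      proof (cases "x \<in> C")
        case True
        then show ?thesis by (simp add: s_def)
      next
        case x: False
        have pos: "infdist x C > 0"
          using x C False infdist_pos_not_in_closed by blast
        obtain n :: nat where "1 / infdist x C < real n" using reals_Archimedean2 by blast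
        then have "s k x = 0" if "k \<ge> n" for k
        proof -
          have "1 < real n * infdist x C" using \<open>1 / infdist x C < real n\<close> pos by (simp add: field_simps)
          also have "\<dots> \<le> real k * infdist x C" using that pos by (intro mult_right_mono) auto
          finally show ?thesis by (simp add: s_def)
        qed
        then have "eventually (\<lambda>k. \<bar>s k x - indicator C x\<bar> = 0) sequentially"
          using x by (auto simp: eventually_sequentially)
        then show ?thesis by (rule tendsto_eventually)
      qed
    qed
    show "AE x in \<mu>. norm \<bar>s k x - indicator C x\<bar> \<le> 2" for k
    proof (intro AE_I2)
      fix x show "norm \<bar>s k x - indicator C x\<bar> \<le> 2"
        using sb[of k x] by (auto split: split_indicator)
    qed
  qed (use sm indm in auto)
  then have lim: "(\<lambda>k. \<integral>x. \<bar>s k x - indicator C x\<bar> \<partial>\<mu>) \<longlonglongrightarrow> 0" by simp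
  have "L1_approximable \<mu> (s k)" for k
    using si cont by (intro L1_approximableI) (auto intro!: exI[of _ "s k"])
  then show ?thesis
    by (rule L1_approximable_lim[where s = s, OF _ ind lim])
qed

text \<open>Dynkin's argument: closed sets are stable under intersection and generate the Borel
  sets, and the sets with approximable indicator are closed under complements and countable disjoint
  unions.\<close>

lemma L1_approximable_indicator:
  fixes S :: "'a::metric_space set"
  assumes fin: "finite_measure \<mu>" and sets: "sets \<mu> = sets (restrict_space borel S)"
    and "A \<in> sets borel"
  shows "L1_approximable \<mu> (indicator A)"
proof -
  interpret finite_measure \<mu> by fact
  have meas: "f \<in> borel_measurable \<mu>" if "f \<in> borel_measurable borel" for f :: "'a \<Rightarrow> real"
    using measurable_restrict_space1[OF that, of S] by (simp add: measurable_cong_sets[OF sets refl])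
  have indi: "integrable \<mu> (indicator A :: 'a \<Rightarrow> real)" if "A \<in> sets borel" for A
    by (rule integrable_const_bound[where B = 1])
       (use that in \<open>auto intro!: meas split: split_indicator\<close>)
  have gen: "A \<in> sigma_sets UNIV {C. closed C}"
    using assms(3) by (simp add: borel_eq_closed)
  have "Int_stable {C :: 'a set. closed C}" "{C :: 'a set. closed C} \<subseteq> Pow UNIV"
    by (auto simp: Int_stable_def)
  from this gen show ?thesis
  proof (induction rule: sigma_sets_induct_disjoint)
    fix C :: "'a set" assume "C \<in> {C. closed C}"
    then show "L1_approximable \<mu> (indicator C)"
      using L1_approximable_closed_indicator[OF fin sets] by simp
  next
    show "L1_approximable \<mu> (indicator {})"
      by (rule L1_approximable_closed_indicator[OF fin sets]) simp
  next
    fix A :: "'a set" assume A: "A \<in> sigma_sets UNIV {C. closed C}" "L1_approximable \<mu> (indicator A)"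
    have "L1_approximable \<mu> (\<lambda>x. indicator UNIV x + indicator A x * (-1))"
      by (intro L1_approximable_add L1_approximable_scale A L1_approximable_closed_indicator[OF fin sets]) simp
    moreover have "(\<lambda>x. indicator UNIV x + indicator A x * (-1)) = (indicator (UNIV - A) :: 'a \<Rightarrow> real)"
      by (auto split: split_indicator)
    ultimately show "L1_approximable \<mu> (indicator (UNIV - A))" by simp
  next
    fix A :: "nat \<Rightarrow> 'a set"
    assume A: "disjoint_family A" "range A \<subseteq> sigma_sets UNIV {C. closed C}"
      "\<And>i. L1_approximable \<mu> (indicator (A i))"
    have Am: "A i \<in> sets borel" for i
    proof -
      have "A i \<in> sigma_sets UNIV {C. closed C}" using A(2) by blast
      then show ?thesis by (simp add: borel_eq_closed)
    qed
    define s where "s n x = (\<Sum>i<n. indicator (A i) x :: real)" for n x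
    have s_eq: "s n x = indicator (\<Union>i<n. A i) x" for n x
      unfolding s_def
      by (rule indicator_UN_disjoint[symmetric]) (use disjoint_family_on_mono[OF subset_UNIV A(1)] in auto)
    have sa: "L1_approximable \<mu> (s n)" for n
    proof (induction n)
      case 0
      have s0: "s 0 = indicator {}" by (auto simp: s_def)
      show ?case unfolding s0 by (rule L1_approximable_closed_indicator[OF fin sets closed_empty])
    next
      case (Suc n)
      have "s (Suc n) = (\<lambda>x. s n x + indicator (A n) x)" by (auto simp: s_def)
      then show ?case using L1_approximable_add[OF Suc A(3)[of n]] by simp
    qed
    have U: "(\<Union>i. A i) \<in> sets borel" using Am by (intro sets.countable_UN) blast
    have "(\<lambda>n. \<integral>x. \<bar>s n x - indicator (\<Union>i. A i) x\<bar> \<partial>\<mu>) \<longlonglongrightarrow> (\<integral>x. 0 \<partial>\<mu>)"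
    proof (rule integral_dominated_convergence[where w = "\<lambda>_. 2"])
      show "AE x in \<mu>. (\<lambda>n. \<bar>s n x - indicator (\<Union>i. A i) x\<bar>) \<longlonglongrightarrow> 0"
        unfolding s_eq by (intro AE_I2 tendsto_rabs_zero LIM_zero LIMSEQ_indicator_UN)
      show "AE x in \<mu>. norm \<bar>s n x - indicator (\<Union>i. A i) x\<bar> \<le> 2" for n
        unfolding s_eq by (intro AE_I2) (auto split: split_indicator)
      show "(\<lambda>x. \<bar>s n x - indicator (\<Union>i. A i) x\<bar>) \<in> borel_measurable \<mu>" for n
        using sa[of n] indi[OF U] by (auto simp: L1_approximable_def)
    qed auto
    then have lim: "(\<lambda>n. \<integral>x. \<bar>s n x - indicator (\<Union>i. A i) x\<bar> \<partial>\<mu>) \<longlonglongrightarrow> 0" by simp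
    show "L1_approximable \<mu> (indicator (\<Union>i. A i))"
      by (rule L1_approximable_lim[where s = s, OF sa indi[OF U] lim])
  qed
qed

lemma integrable_L1_approximable:
  fixes S :: "'a::metric_space set"
  assumes fin: "finite_measure \<mu>" and sets: "sets \<mu> = sets (restrict_space borel S)"
    and "integrable \<mu> u"
  shows "L1_approximable \<mu> u"
  using assms(3)
proof (induction rule: integrable_induct)
  case (base A c)
  from base(1) obtain B where B: "A = S \<inter> B" "B \<in> sets borel"
    unfolding sets by (auto simp: sets_restrict_space)
  have sp: "space \<mu> = S" using sets_eq_imp_space_eq[OF sets] by (simp add: space_restrict_space)
  have eq: "(\<integral>x. \<bar>\<phi> x - indicator A x * c\<bar> \<partial>\<mu>) = (\<integral>x. \<bar>\<phi> x - indicator B x * c\<bar> \<partial>\<mu>)" for \<phi> :: "'a \<Rightarrow> real"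
    by (intro Bochner_Integration.integral_cong refl) (auto simp: sp B split: split_indicator)
  have "L1_approximable \<mu> (\<lambda>x. indicator B x * c)"
    by (intro L1_approximable_scale L1_approximable_indicator[OF fin sets B(2)])
  moreover have "integrable \<mu> (\<lambda>x. indicator A x *\<^sub>R c)"
    using base by (intro integrable_scaleR_left) (auto intro!: integrable_real_indicator)
  ultimately show ?case
    by (simp add: L1_approximable_def eq)
next
  case (add f g)
  then show ?case by (intro L1_approximable_add)
next
  case (lim f s)
  note [measurable] = borel_measurable_integrable[OF lim.hyps(1)] borel_measurable_integrable[OF lim.hyps(4)]
  have "(\<lambda>i. \<integral>x. \<bar>s i x - f x\<bar> \<partial>\<mu>) \<longlonglongrightarrow> (\<integral>x. 0 \<partial>\<mu>)"
  \<comment> \<open>The factor 3 comes from the bound |s i| \<le> 2 |f| that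
    \<open>integrable_induct\<close> supplies.\<close>
  proof (rule integral_dominated_convergence[where w = "\<lambda>x. 3 * \<bar>f x\<bar>"])
    show "AE x in \<mu>. (\<lambda>i. \<bar>s i x - f x\<bar>) \<longlonglongrightarrow> 0"
      using lim.hyps(2) by (intro AE_I2 tendsto_rabs_zero LIM_zero)
    show "integrable \<mu> (\<lambda>x. 3 * \<bar>f x\<bar>)" using lim.hyps(4) by simp
    show "AE x in \<mu>. norm \<bar>s i x - f x\<bar> \<le> 3 * \<bar>f x\<bar>" for i
    proof (intro AE_I2)
      fix x assume "x \<in> space \<mu>"
      then show "norm \<bar>s i x - f x\<bar> \<le> 3 * \<bar>f x\<bar>" using lim.hyps(3)[of x i] by simp
    qed
  qed measurable
  then have "(\<lambda>i. \<integral>x. \<bar>s i x - f x\<bar> \<partial>\<mu>) \<longlonglongrightarrow> 0"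
    by simp
  then show ?case
    by (rule L1_approximable_lim[OF lim.IH lim.hyps(4)])
qed

lemma bounded_continuous_L1_approx:
  fixes S :: "'a::metric_space set" and u :: "'a \<Rightarrow> real"
  assumes fin: "finite_measure \<mu>" and sets: "sets \<mu> = sets (restrict_space borel S)"
    and u: "u \<in> borel_measurable \<mu>" and K: "\<And>x. x \<in> space \<mu> \<Longrightarrow> \<bar>u x\<bar> \<le> K" and "K \<ge> 0" and "e > 0"
  obtains \<phi> where "continuous_on UNIV \<phi>" "\<And>x. \<bar>\<phi> x\<bar> \<le> K" "(\<integral>x. \<bar>\<phi> x - u x\<bar> \<partial>\<mu>) < e"
proof -
  interpret finite_measure \<mu> by fact
  have ui[simp]: "integrable \<mu> u"
    by (rule integrable_const_bound[where B = K]) (use u K in auto)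
  obtain \<psi> where psi[simp]: "continuous_on UNIV \<psi>" "integrable \<mu> \<psi>" and le: "(\<integral>x. \<bar>\<psi> x - u x\<bar> \<partial>\<mu>) < e"
    by (rule L1_approximableE[OF integrable_L1_approximable[OF fin sets ui] \<open>e > 0\<close>])
  \<comment> \<open>Clipping to [-K, K] brings \<psi> no further from u, whose values already lie
    there. The bound later makes exp Lipschitz on the range involved.\<close>
  define \<phi> where "\<phi> x = max (- K) (min K (\<psi> x))" for x
  have "(\<integral>x. \<bar>\<phi> x - u x\<bar> \<partial>\<mu>) \<le> (\<integral>x. \<bar>\<psi> x - u x\<bar> \<partial>\<mu>)"
  proof (rule integral_mono')
    fix x assume "x \<in> space \<mu>"
    then show "\<bar>\<phi> x - u x\<bar> \<le> \<bar>\<psi> x - u x\<bar>" using K[of x] by (auto simp: \<phi>_def)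
  qed (auto)
  then have 1: "(\<integral>x. \<bar>\<phi> x - u x\<bar> \<partial>\<mu>) < e" using le by linarith
  have 2: "continuous_on UNIV \<phi>"
    unfolding \<phi>_def by (intro continuous_on_max continuous_on_min continuous_on_const psi)
  have 3: "\<bar>\<phi> x\<bar> \<le> K" for x
    using \<open>K \<ge> 0\<close> unfolding \<phi>_def by auto
  show ?thesis by (rule that[OF 2 3 1])
qed

text \<open>On the circle z^(-n) is the conjugate of z^n and has the same real part, so real parts
  of polynomials are exactly the real trigonometric polynomials.\<close>

definition trig_real :: "(complex \<Rightarrow> real) \<Rightarrow> bool" where
  "trig_real f \<longleftrightarrow> (\<exists>q. \<forall>z\<in>sphere 0 1. f z = Re (poly q z))"

lemma trig_real_add:
  assumes "trig_real f" "trig_real g" shows "trig_real (\<lambda>z. f z + g z)"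
proof -
  obtain p q where "\<forall>z\<in>sphere 0 1. f z = Re (poly p z)" "\<forall>z\<in>sphere 0 1. g z = Re (poly q z)"
    using assms unfolding trig_real_def by blast
  then show ?thesis unfolding trig_real_def by (intro exI[of _ "p + q"]) auto
qed

lemma trig_real_sum:
  assumes "\<And>i. i \<in> I \<Longrightarrow> trig_real (f i)" shows "trig_real (\<lambda>z. \<Sum>i\<in>I. f i z)"
  using assms
proof (induction I rule: infinite_finite_induct)
  case (insert x F)
  then show ?case by (simp add: trig_real_add)
qed (auto simp: trig_real_def intro!: exI[of _ 0])

lemma trig_real_cong:
  assumes "\<And>z. z \<in> sphere 0 1 \<Longrightarrow> f z = g z" "trig_real g" shows "trig_real f"
  using assms unfolding trig_real_def by auto

text \<open>On the circle cnj z = 1/z, so the product is c times a power of z with exponent i - j. A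
  negative exponent is made positive by conjugation, which leaves the real part alone.\<close>

lemma trig_real_Re_mult_cnj: "trig_real (\<lambda>z. Re (c * z ^ i * cnj (z ^ j)))"
proof (cases "j \<le> i")
  case True
  have "z ^ i * cnj (z ^ j) = z ^ (i - j)" if "z \<in> sphere 0 1" for z :: complex
  proof -
    have "z ^ j * cnj (z ^ j) = 1" using that unfolding complex_norm_square[symmetric] by (simp add: norm_power)
    moreover have "z ^ i = z ^ (i - j) * z ^ j" using True by (simp flip: power_add)
    ultimately show ?thesis by (simp add: mult.assoc)
  qed
  then show ?thesis unfolding trig_real_def
    by (intro exI[of _ "monom c (i - j)"]) (auto simp: poly_monom mult.assoc)
next
  case False
  have "cnj (c * z ^ i * cnj (z ^ j)) = cnj c * z ^ (j - i)" if "z \<in> sphere 0 1" for z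
  proof -
    have "z ^ i * cnj (z ^ i) = 1" using that unfolding complex_norm_square[symmetric] by (simp add: norm_power)
    moreover have "z ^ j = z ^ (j - i) * z ^ i" using False by (simp flip: power_add)
    ultimately show ?thesis by (simp add: mult_ac)
  qed
  then have "Re (c * z ^ i * cnj (z ^ j)) = Re (cnj c * z ^ (j - i))" if "z \<in> sphere 0 1" for z
    using that by (metis cnj.sel(1))
  then show ?thesis unfolding trig_real_def
    by (intro exI[of _ "monom (cnj c) (j - i)"]) (auto simp: poly_monom)
qed

lemma trig_real_mult:
  assumes "trig_real f" "trig_real g" shows "trig_real (\<lambda>z. f z * g z)"
proof -
  obtain p q where pq: "\<forall>z\<in>sphere 0 1. f z = Re (poly p z)" "\<forall>z\<in>sphere 0 1. g z = Re (poly q z)"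
    using assms unfolding trig_real_def by blast
  \<comment> \<open>This trades a product of real parts for real parts of products: the first is a
    polynomial again, the second a sum of terms covered by
    \<open>trig_real_Re_mult_cnj\<close>.\<close>
  have eq: "Re x * Re y = Re (x * y / 2) + Re (x * cnj y / 2)" for x y
    by (simp add: field_simps)
  have 1: "trig_real (\<lambda>z. Re (poly p z * poly q z / 2))"
    unfolding trig_real_def by (intro exI[of _ "smult (1/2) (p * q)"]) auto
  have 2: "poly p z * cnj (poly q z) / 2 =
      (\<Sum>i\<le>degree p. \<Sum>j\<le>degree q. (coeff p i * cnj (coeff q j) / 2) * z ^ i * cnj (z ^ j))" for z
    unfolding poly_altdef cnj_sum sum_product sum_divide_distrib by (intro sum.cong refl) simp
  have 3: "trig_real (\<lambda>z. Re (poly p z * cnj (poly q z) / 2))"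
    unfolding 2 Re_sum by (intro trig_real_sum trig_real_Re_mult_cnj)
  show ?thesis
    by (rule trig_real_cong[OF _ trig_real_add[OF 1 3]]) (use pq eq in auto)
qed

lemma trig_real_dense:
  assumes "continuous_on (sphere 0 1) f" "e > 0"
  obtains q where "\<And>z. z \<in> sphere 0 1 \<Longrightarrow> \<bar>f z - Re (poly q z)\<bar> < e"
proof -
  have "\<exists>g. trig_real g \<and> (\<forall>z\<in>sphere 0 1. \<bar>f z - g z\<bar> < e)"
  proof (rule Stone_Weierstrass_HOL)
    show "trig_real (\<lambda>x. c)" for c
      unfolding trig_real_def by (intro exI[of _ "[:of_real c:]"]) auto
    show "continuous_on (sphere 0 1) h" if h: "trig_real h" for h
    proof -
      obtain q where q: "\<And>z. z \<in> sphere 0 1 \<Longrightarrow> h z = Re (poly q z)"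
        using h unfolding trig_real_def by blast
      have "continuous_on (sphere 0 1) (\<lambda>z. Re (poly q z))" by (intro continuous_intros)
      then show ?thesis by (subst continuous_on_cong[OF refl q])
    qed
    show "\<exists>h. trig_real h \<and> h x \<noteq> h y" if "x \<in> sphere 0 1 \<and> y \<in> sphere 0 1 \<and> x \<noteq> y" for x y
    proof (cases "Re x = Re y")
      case True
      then have "Re (- \<i> * x) \<noteq> Re (- \<i> * y)" using that by (auto simp: complex_eq_iff)
      moreover have "trig_real (\<lambda>z. Re (- \<i> * z))"
        unfolding trig_real_def by (intro exI[of _ "[:0, - \<i>:]"]) auto
      ultimately show ?thesis by blast
    next
      case False
      moreover have "trig_real Re"
        unfolding trig_real_def by (intro exI[of _ "[:0, 1:]"]) auto
      ultimately show ?thesis by blast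
    qed
  qed (use assms in \<open>auto intro: trig_real_add trig_real_mult\<close>)
  then obtain g q where "\<forall>z\<in>sphere 0 1. \<bar>f z - g z\<bar> < e" "\<forall>z\<in>sphere 0 1. g z = Re (poly q z)"
    unfolding trig_real_def by blast
  then have "\<bar>f z - Re (poly q z)\<bar> < e" if "z \<in> sphere 0 1" for z
    using that by auto
  then show ?thesis by (rule that)
qed

lemma sets_circle_measurable:
  assumes "sets \<nu> = sets circle"
  shows "borel_measurable \<nu> = borel_measurable circle"
  by (rule measurable_cong_sets[OF assms refl])

text \<open>A trigonometric polynomial \<open>Re q\<close> with mean zero is \<open>ln |e\<^bsup>q/2\<^esup>|\<^sup>2\<close>, and the
  partial sums of the exponential series of \<open>(q - q(0))/2\<close> are polynomials with value 1 at 0.\<close>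

lemma szego_upper_poly:
  assumes fin: "finite_measure \<nu>" and sets: "sets \<nu> = sets circle" and "e > 0"
  obtains p where "poly p 0 = 1"
    "(\<integral>z. (cmod (poly p z))\<^sup>2 \<partial>\<nu>) < (\<integral>z. exp (Re (poly q z)) \<partial>\<nu>) * exp (- Re (poly q 0)) + e"
proof -
  interpret finite_measure \<nu> by fact
  have space: "space \<nu> = sphere 0 1"
    using sets_eq_imp_space_eq[OF sets] by (simp add: space_restrict_space)
  define w where "w = smult (1/2) (q - [:poly q 0:])"
  have w: "poly w z = (poly q z - poly q 0) / 2" for z by (simp add: w_def)
  define p where "p n = (\<Sum>k<n. smult (1 / fact k) (w ^ k))" for n
  have p: "poly (p n) z = (\<Sum>k<n. poly w z ^ k / fact k)" for n z
    by (simp add: p_def poly_sum)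
  \<comment> \<open>\<open>p 0\<close> is the empty sum. From index 1 on only the term k = 0 counts
    at the origin, because w vanishes there.\<close>
  have p0: "poly (p (Suc n)) 0 = 1" for n
    unfolding p by (induction n) (auto simp: w)
  have "bounded (poly w ` sphere 0 1)"
    by (intro compact_imp_bounded compact_continuous_image continuous_intros compact_sphere)
  then obtain B where B: "\<And>z. z \<in> sphere 0 1 \<Longrightarrow> cmod (poly w z) \<le> B"
    unfolding bounded_iff by (metis imageI)
  have B0: "B \<ge> 0" using order_trans[OF norm_ge_zero B[of 1]] by simp
  have bound: "cmod (poly (p n) z) \<le> exp B" if "z \<in> sphere 0 1" for n z
  proof -
    have "cmod (poly (p n) z) \<le> (\<Sum>k<n. B ^ k / fact k)"
      unfolding p using B[OF that]
      by (intro sum_norm_le) (auto simp: norm_divide norm_power intro!: divide_right_mono power_mono)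
    also have "\<dots> \<le> (\<Sum>k. B ^ k / fact k)"
      using summable_exp[of B] B0 by (intro sum_le_suminf) (auto simp: field_simps)
    also have "\<dots> = exp B"
      by (simp add: exp_def field_simps scaleR_conv_of_real)
    finally show ?thesis .
  qed
  have lim: "(\<lambda>n. poly (p n) z) \<longlonglongrightarrow> exp (poly w z)" for z
    using exp_converges[of "poly w z"] by (simp add: p sums_def scaleR_conv_of_real field_simps)
  have "(\<lambda>n. \<integral>z. (cmod (poly (p n) z))\<^sup>2 \<partial>\<nu>) \<longlonglongrightarrow> (\<integral>z. (cmod (exp (poly w z)))\<^sup>2 \<partial>\<nu>)"
  proof (rule integral_dominated_convergence[where w = "\<lambda>_. (exp B)\<^sup>2"])
    show "(\<lambda>z. (cmod (exp (poly w z)))\<^sup>2) \<in> borel_measurable \<nu>"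
      unfolding sets_circle_measurable[OF sets]
      by (intro continuous_measurable_circle continuous_intros)
    show "(\<lambda>z. (cmod (poly (p n) z))\<^sup>2) \<in> borel_measurable \<nu>" for n
      unfolding sets_circle_measurable[OF sets]
      by (intro continuous_measurable_circle continuous_intros)
    show "AE z in \<nu>. (\<lambda>n. (cmod (poly (p n) z))\<^sup>2) \<longlonglongrightarrow> (cmod (exp (poly w z)))\<^sup>2"
      by (intro AE_I2 tendsto_intros lim)
    show "AE z in \<nu>. norm ((cmod (poly (p n) z))\<^sup>2) \<le> (exp B)\<^sup>2" for n
      using bound space by (intro AE_I2) (auto intro!: power_mono)
  qed simp
  also have "(\<integral>z. (cmod (exp (poly w z)))\<^sup>2 \<partial>\<nu>) = (\<integral>z. exp (Re (poly q z)) * exp (- Re (poly q 0)) \<partial>\<nu>)"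
    by (intro Bochner_Integration.integral_cong refl)
       (simp add: w norm_exp_eq_Re flip: exp_of_nat_mult exp_add)
  also have "\<dots> = (\<integral>z. exp (Re (poly q z)) \<partial>\<nu>) * exp (- Re (poly q 0))"
    by simp
  finally have "eventually (\<lambda>n. (\<integral>z. (cmod (poly (p n) z))\<^sup>2 \<partial>\<nu>) <
      (\<integral>z. exp (Re (poly q z)) \<partial>\<nu>) * exp (- Re (poly q 0)) + e) sequentially"
    using \<open>e > 0\<close> by (intro order_tendstoD(2)) auto
  then obtain n where "\<And>m. m \<ge> n \<Longrightarrow> (\<integral>z. (cmod (poly (p m) z))\<^sup>2 \<partial>\<nu>) <
      (\<integral>z. exp (Re (poly q z)) \<partial>\<nu>) * exp (- Re (poly q 0)) + e"
    by (auto simp: eventually_sequentially)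
  from p0[of n] this[of "Suc n", OF le_SucI[OF order_refl]] show ?thesis by (rule that)
qed

section \<open>The Szego infimum\<close>

text \<open>\<nu> and Lebesgue measure may be mutually singular, so one approximation that serves
  both has to be made in L1 of a measure above both. Their sum is such a measure.\<close>

lemma finite_measure_dominating_pair:
  assumes "finite_measure \<mu>" "finite_measure \<nu>" and sets: "sets \<nu> = sets \<mu>"
  obtains \<sigma> where "finite_measure \<sigma>" "sets \<sigma> = sets \<mu>" "\<mu> \<le> \<sigma>" "\<nu> \<le> \<sigma>"
proof -
  interpret \<mu>: finite_measure \<mu> by fact
  interpret \<nu>: finite_measure \<nu> by fact
  define \<sigma> where "\<sigma> = measure_of (space \<mu>) (sets \<mu>) (\<lambda>A. emeasure \<mu> A + emeasure \<nu> A)"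
  have s: "sets \<sigma> = sets \<mu>" "space \<sigma> = space \<mu>"
    by (simp_all add: \<sigma>_def)
  have em: "emeasure \<sigma> A = emeasure \<mu> A + emeasure \<nu> A" if "A \<in> sets \<mu>" for A
  proof (rule emeasure_measure_of[OF \<sigma>_def])
    show "countably_additive (sets \<sigma>) (\<lambda>A. emeasure \<mu> A + emeasure \<nu> A)"
      unfolding s
    proof (rule countably_additiveI)
      fix A :: "nat \<Rightarrow> 'a set"
      assume "range A \<subseteq> sets \<mu>" "disjoint_family A" "\<Union> (range A) \<in> sets \<mu>"
      then show "(\<Sum>i. emeasure \<mu> (A i) + emeasure \<nu> (A i)) = emeasure \<mu> (\<Union> (range A)) + emeasure \<nu> (\<Union> (range A))"
        by (subst suminf_add[symmetric]) (auto simp: suminf_emeasure sets)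
    qed
  qed (use that s in \<open>auto simp: positive_def sets.space_closed\<close>)
  show ?thesis
  proof (rule that)
    show "finite_measure \<sigma>"
      by (rule finite_measureI) (use \<nu>.emeasure_finite[of "space \<mu>"] sets_eq_imp_space_eq[OF sets] in \<open>simp add: s em ennreal_add_eq_top\<close>)
    show "\<mu> \<le> \<sigma>" "\<nu> \<le> \<sigma>"
      by (simp_all add: le_measure s sets em)
  qed fact
qed

lemma integral_mono_dominating:
  fixes f :: "'a \<Rightarrow> real"
  assumes le: "\<mu> \<le> \<sigma>" and sets: "sets \<sigma> = sets \<mu>" and int: "integrable \<sigma> f" and nonneg: "\<And>x. 0 \<le> f x"
  shows "integrable \<mu> f" "(\<integral>x. f x \<partial>\<mu>) \<le> (\<integral>x. f x \<partial>\<sigma>)"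
proof -
  have m: "f \<in> borel_measurable \<mu>"
    using borel_measurable_integrable[OF int] by (simp add: measurable_cong_sets[OF sets refl])
  have nn: "(\<integral>\<^sup>+x. ennreal (f x) \<partial>\<mu>) \<le> (\<integral>\<^sup>+x. ennreal (f x) \<partial>\<sigma>)"
    by (rule nn_integral_mono_measure) (use sets le in auto)
  also have "\<dots> = ennreal (\<integral>x. f x \<partial>\<sigma>)"
    using int nonneg by (intro nn_integral_eq_integral) auto
  finally have *: "(\<integral>\<^sup>+x. ennreal (f x) \<partial>\<mu>) \<le> ennreal (\<integral>x. f x \<partial>\<sigma>)" .
  show i: "integrable \<mu> f"
    using m nonneg order_le_less_trans[OF *] by (intro integrableI_nonneg) auto
  show "(\<integral>x. f x \<partial>\<mu>) \<le> (\<integral>x. f x \<partial>\<sigma>)"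
    using * nonneg nn_integral_eq_integral[OF i] by (simp add: integral_nonneg_AE)
qed

text \<open>The squared distance in \<open>L\<^sup>2(\<nu>)\<close> from the constant 1 to the polynomials vanishing at 0, that is,
  the variance of the one-step prediction error.\<close>

definition szego :: "complex measure \<Rightarrow> real" where
  "szego \<nu> = (INF p\<in>{p. poly p 0 = 1}. \<integral>z. (cmod (poly p z))\<^sup>2 \<partial>\<nu>)"

lemma szego_bdd_below: "bdd_below ((\<lambda>p. \<integral>z. (cmod (poly p z))\<^sup>2 \<partial>\<nu>) ` {p. poly p 0 = 1})"
  by (rule bdd_belowI[of _ 0]) auto

lemma szego_le: "poly p 0 = 1 \<Longrightarrow> szego \<nu> \<le> (\<integral>z. (cmod (poly p z))\<^sup>2 \<partial>\<nu>)"
  unfolding szego_def by (intro cINF_lower szego_bdd_below) simp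

lemma szego_nonempty: "{p :: complex poly. poly p 0 = 1} \<noteq> {}"
proof -
  have "[:1:] \<in> {p :: complex poly. poly p 0 = 1}" by simp
  then show ?thesis by blast
qed

lemma szego_greatest:
  assumes "\<And>p. poly p 0 = 1 \<Longrightarrow> c \<le> (\<integral>z. (cmod (poly p z))\<^sup>2 \<partial>\<nu>)"
  shows "c \<le> szego \<nu>"
  unfolding szego_def by (rule cINF_greatest[OF szego_nonempty]) (use assms in auto)

lemma szego_nonneg: "0 \<le> szego \<nu>"
  by (rule szego_greatest) simp

lemma szego_less_obtain:
  assumes "szego \<nu> < c"
  obtains p where "poly p 0 = 1" "(\<integral>z. (cmod (poly p z))\<^sup>2 \<partial>\<nu>) < c"
  using assms szego_greatest[of c \<nu>] by (meson not_le)

text \<open>Turns L1 closeness of functions bounded by K into L1 closeness of their exponentials. It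
  follows from 1 + x \<le> e^x.\<close>

lemma abs_exp_diff_le:
  fixes x y K :: real
  assumes "\<bar>x\<bar> \<le> K" "\<bar>y\<bar> \<le> K"
  shows "\<bar>exp x - exp y\<bar> \<le> exp K * \<bar>x - y\<bar>"
proof -
  have *: "exp b - exp a \<le> exp K * (b - a)" if "a \<le> b" "b \<le> K" for a b :: real
  proof -
    have "exp b - exp a = exp b * (1 - exp (a - b))" by (simp add: exp_diff field_simps)
    also have "\<dots> \<le> exp b * (b - a)"
    proof (rule mult_left_mono)
      show "1 - exp (a - b) \<le> b - a" using exp_ge_add_one_self[of "a - b"] by linarith
    qed simp
    also have "\<dots> \<le> exp K * (b - a)" using that by (intro mult_right_mono) auto
    finally show ?thesis .
  qed
  show ?thesis
    using *[of x y] *[of y x] assms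
    by (cases "x \<le> y") (simp_all add: abs_of_nonneg abs_of_nonpos abs_minus_commute[of x y] abs_minus_commute[of "exp x"])
qed

section \<open>The Szego infimum as an infimum over bounded functions\<close>

context
  fixes \<nu> :: "complex measure"
  assumes fin: "finite_measure \<nu>" and sets: "sets \<nu> = sets circle"
begin

interpretation \<nu>: finite_measure \<nu> by (rule fin)

lemma space_circle_measure: "space \<nu> = sphere 0 1"
  using sets_eq_imp_space_eq[OF sets] by (simp add: space_restrict_space)

lemma szego_le_trig: "szego \<nu> \<le> (\<integral>z. exp (Re (poly q z)) \<partial>\<nu>) * exp (- Re (poly q 0))"
proof (rule field_le_epsilon)
  fix e :: real assume "e > 0"
  show "szego \<nu> \<le> (\<integral>z. exp (Re (poly q z)) \<partial>\<nu>) * exp (- Re (poly q 0)) + e"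
    by (rule szego_upper_poly[OF fin sets \<open>e > 0\<close>, of q])
       (blast intro: order_trans[OF szego_le less_imp_le])
qed

text \<open>Uniform approximation within \<epsilon> by a real trigonometric polynomial costs one
  factor exp \<epsilon> in the integral against \<nu> and another in the mean; both disappear as
  \<epsilon> tends to 0.\<close>

lemma szego_le_continuous:
  assumes "continuous_on (sphere 0 1) \<phi>"
  shows "szego \<nu> \<le> (\<integral>z. exp (\<phi> z) \<partial>\<nu>) * exp (- (\<integral>z. \<phi> z \<partial>circle_lebesgue))"
proof (rule tendsto_le[OF trivial_limit_at_right_real])
  let ?J = "\<integral>z. exp (\<phi> z) \<partial>\<nu>" and ?I = "\<integral>z. \<phi> z \<partial>circle_lebesgue"
  have i1: "integrable \<nu> (\<lambda>z. exp (\<phi> z))"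
    by (intro finite_measure_continuous_integrable fin sets continuous_intros assms)
  have i2: "integrable circle_lebesgue \<phi>"
    by (rule circle_lebesgue_continuous_integrable[OF assms])
  have "szego \<nu> \<le> exp (2 * e) * (?J * exp (- ?I))" if "e > 0" for e :: real
  proof -
    obtain q where q: "\<And>z. z \<in> sphere 0 1 \<Longrightarrow> \<bar>\<phi> z - Re (poly q z)\<bar> < e"
      using trig_real_dense[OF assms \<open>e > 0\<close>] by blast
    have i3: "integrable \<nu> (\<lambda>z. exp (Re (poly q z)))"
      by (intro finite_measure_continuous_integrable fin sets continuous_intros)
    have i4: "integrable circle_lebesgue (\<lambda>z. Re (poly q z))"
      by (intro circle_lebesgue_continuous_integrable continuous_intros)
    have "(\<integral>z. exp (Re (poly q z)) \<partial>\<nu>) \<le> (\<integral>z. exp e * exp (\<phi> z) \<partial>\<nu>)"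
    proof (rule integral_mono)
      fix z assume "z \<in> space \<nu>"
      then have "Re (poly q z) \<le> e + \<phi> z" using q[of z] by (simp add: space_circle_measure)
      then show "exp (Re (poly q z)) \<le> exp e * exp (\<phi> z)" by (simp flip: exp_add)
    qed (use i1 i3 in auto)
    then have 1: "(\<integral>z. exp (Re (poly q z)) \<partial>\<nu>) \<le> exp e * ?J" by simp
    have "?I \<le> (\<integral>z. Re (poly q z) + e \<partial>circle_lebesgue)"
    proof (rule integral_mono)
      fix z assume "z \<in> space circle_lebesgue"
      then show "\<phi> z \<le> Re (poly q z) + e" using q[of z] by simp
    qed (use i2 i4 in auto)
    also have "\<dots> = (\<integral>z. Re (poly q z) \<partial>circle_lebesgue) + e"
      using i4 circle_lebesgue.prob_space by simp
    also have "(\<integral>z. Re (poly q z) \<partial>circle_lebesgue) = Re (\<integral>z. poly q z \<partial>circle_lebesgue)"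
      by (rule integral_Re[OF circle_poly_integrable[OF circle_lebesgue.finite_measure_axioms sets_circle_lebesgue]])
    finally have 2: "exp (- Re (poly q 0)) \<le> exp (e - ?I)"
      by (simp add: integral_circle_poly)
    have "szego \<nu> \<le> (exp e * ?J) * exp (e - ?I)"
      by (rule order_trans[OF szego_le_trig[of q]]) (intro mult_mono 1 2; simp)
    also have "\<dots> = exp (2 * e) * (?J * exp (- ?I))"
      using exp_double[of e] by (simp add: exp_diff exp_minus field_simps power2_eq_square)
    finally show ?thesis .
  qed
  then show "\<forall>\<^sub>F e in at_right 0. szego \<nu> \<le> exp (2 * e) * (?J * exp (- ?I))"
    by (auto simp: eventually_at_filter)
  have "((\<lambda>e. exp (2 * e) * (?J * exp (- ?I))) \<longlongrightarrow> exp (2 * 0) * (?J * exp (- ?I))) (at_right 0)"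
    by (intro tendsto_intros)
  then show "((\<lambda>e. exp (2 * e) * (?J * exp (- ?I))) \<longlongrightarrow> ?J * exp (- ?I)) (at_right 0)"
    by simp
qed simp

text \<open>Uniform approximation is out of reach for measurable u. L1 approximation for one measure
  above both \<nu> and Lebesgue measure controls the two factors at once, because the approximants
  keep the bound K, on whose range exp is Lipschitz. The values of u on Lebesgue null sets are
  respected too, which accounts for a singular part of \<nu>.\<close>

lemma szego_le_bounded:
  assumes u: "u \<in> borel_measurable circle" and K: "\<And>z. z \<in> sphere 0 1 \<Longrightarrow> \<bar>u z\<bar> \<le> K"
  shows "szego \<nu> \<le> (\<integral>z. exp (u z) \<partial>\<nu>) * exp (- (\<integral>z. u z \<partial>circle_lebesgue))"
proof (rule tendsto_le[OF trivial_limit_at_right_real])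
  let ?J = "\<integral>z. exp (u z) \<partial>\<nu>" and ?I = "\<integral>z. u z \<partial>circle_lebesgue"
  have K0: "0 \<le> K" using K[of 1] by simp
  obtain \<sigma> where \<sigma>: "finite_measure \<sigma>" "sets \<sigma> = sets \<nu>" "\<nu> \<le> \<sigma>" "circle_lebesgue \<le> \<sigma>"
    by (rule finite_measure_dominating_pair[OF fin circle_lebesgue.finite_measure_axioms])
       (simp add: sets)
  interpret \<sigma>: finite_measure \<sigma> by fact
  have space\<sigma>: "space \<sigma> = sphere 0 1"
    using sets_eq_imp_space_eq[OF \<sigma>(2)] space_circle_measure by simp
  have sets\<sigma>: "sets \<sigma> = sets circle" using \<sigma>(2) sets by simp
  have um: "u \<in> borel_measurable \<nu>" "u \<in> borel_measurable circle_lebesgue" "u \<in> borel_measurable \<sigma>"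
    using u by (simp_all add: sets_circle_measurable[OF sets] sets_circle_measurable[OF sets\<sigma>]
        sets_circle_measurable[OF sets_circle_lebesgue])
  have i0: "integrable \<sigma> u" using um K space\<sigma> by (intro \<sigma>.integrable_const_bound[of _ K]) auto
  have i1: "integrable \<nu> (\<lambda>z. exp (u z))"
  proof (rule \<nu>.integrable_const_bound[of _ "exp K"])
    show "AE z in \<nu>. norm (exp (u z)) \<le> exp K"
      using K space_circle_measure by (intro AE_I2) (auto dest!: abs_le_D1)
  qed (use um in auto)
  have i2: "integrable circle_lebesgue u"
    using um K by (intro circle_lebesgue.integrable_const_bound[of _ K]) auto
  have "szego \<nu> \<le> (?J + exp K * e) * exp (e - ?I)" if "e > 0" for e :: real
  proof -
    obtain \<phi> where \<phi>: "continuous_on UNIV \<phi>" "\<And>x. \<bar>\<phi> x\<bar> \<le> K" "(\<integral>x. \<bar>\<phi> x - u x\<bar> \<partial>\<sigma>) < e"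
      using bounded_continuous_L1_approx[OF \<sigma>(1) sets\<sigma> um(3) K[folded space\<sigma>] K0 \<open>e > 0\<close>] by blast
    have c: "continuous_on (sphere 0 1) \<phi>" using \<phi>(1) by (rule continuous_on_subset) simp
    have "integrable \<sigma> \<phi>" by (rule finite_measure_continuous_integrable[OF \<sigma>(1) sets\<sigma> c])
    with i0 have "integrable \<sigma> (\<lambda>x. \<bar>\<phi> x - u x\<bar>)" by simp
    note dom = integral_mono_dominating[OF _ _ this]
    have d1: "integrable \<nu> (\<lambda>x. \<bar>\<phi> x - u x\<bar>)" "(\<integral>x. \<bar>\<phi> x - u x\<bar> \<partial>\<nu>) \<le> e"
      using dom[OF \<sigma>(3)] \<sigma>(2) \<phi>(3) by auto
    have d2: "integrable circle_lebesgue (\<lambda>x. \<bar>\<phi> x - u x\<bar>)" "(\<integral>x. \<bar>\<phi> x - u x\<bar> \<partial>circle_lebesgue) \<le> e"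
      using dom[OF \<sigma>(4)] sets\<sigma> \<phi>(3) by auto
    have i3: "integrable \<nu> (\<lambda>z. exp (\<phi> z))"
      by (intro finite_measure_continuous_integrable fin sets continuous_intros c)
    have i4: "integrable circle_lebesgue \<phi>"
      by (intro circle_lebesgue_continuous_integrable c)
    have "(\<integral>z. exp (\<phi> z) \<partial>\<nu>) \<le> (\<integral>z. exp (u z) + exp K * \<bar>\<phi> z - u z\<bar> \<partial>\<nu>)"
    proof (rule integral_mono)
      fix z assume "z \<in> space \<nu>"
      then have "\<bar>exp (\<phi> z) - exp (u z)\<bar> \<le> exp K * \<bar>\<phi> z - u z\<bar>"
        using K[of z] \<phi>(2)[of z] by (intro abs_exp_diff_le) (auto simp: space_circle_measure)
      then show "exp (\<phi> z) \<le> exp (u z) + exp K * \<bar>\<phi> z - u z\<bar>" by linarith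
    qed (use i1 i3 d1 in auto)
    also have "\<dots> = ?J + exp K * (\<integral>z. \<bar>\<phi> z - u z\<bar> \<partial>\<nu>)"
      using i1 d1 by simp
    also have "\<dots> \<le> ?J + exp K * e" using d1(2) by simp
    finally have 1: "(\<integral>z. exp (\<phi> z) \<partial>\<nu>) \<le> ?J + exp K * e" .
    have "?I \<le> (\<integral>z. \<phi> z + \<bar>\<phi> z - u z\<bar> \<partial>circle_lebesgue)"
      by (rule integral_mono) (use i2 i4 d2 in auto)
    also have "\<dots> \<le> (\<integral>z. \<phi> z \<partial>circle_lebesgue) + e"
      using i4 d2 by simp
    finally have 2: "exp (- (\<integral>z. \<phi> z \<partial>circle_lebesgue)) \<le> exp (e - ?I)" by simp
    have J0: "?J \<ge> 0" by simp
    show ?thesis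
      by (rule order_trans[OF szego_le_continuous[OF c]])
         (intro mult_mono 1 2; use J0 \<open>e > 0\<close> in simp)
  qed
  then show "\<forall>\<^sub>F e in at_right 0. szego \<nu> \<le> (?J + exp K * e) * exp (e - ?I)"
    by (auto simp: eventually_at_filter)
  have "((\<lambda>e. (?J + exp K * e) * exp (e - ?I)) \<longlongrightarrow> (?J + exp K * 0) * exp (0 - ?I)) (at_right 0)"
    by (intro tendsto_intros)
  then show "((\<lambda>e. (?J + exp K * e) * exp (e - ?I)) \<longlongrightarrow> ?J * exp (- ?I)) (at_right 0)"
    by simp
qed simp

text \<open>Dilation keeps the value at 0 and lets the zeros of p be moved off the circle at
  arbitrarily small cost in L2(\<nu>).\<close>

lemma poly_integral_dilation:
  "((\<lambda>r. \<integral>z. (cmod (poly p (of_real r * z)))\<^sup>2 \<partial>\<nu>) \<longlongrightarrow> (\<integral>z. (cmod (poly p z))\<^sup>2 \<partial>\<nu>)) (at_left 1)"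
proof -
  have "bounded (poly p ` cball 0 1)"
    by (intro compact_imp_bounded compact_continuous_image continuous_intros compact_cball)
  then obtain B where B: "\<And>z. z \<in> cball 0 1 \<Longrightarrow> cmod (poly p z) \<le> B"
    unfolding bounded_iff by (metis imageI)
  show ?thesis
  proof (rule tendsto_at_left_sequentially[of 0])
    fix S :: "nat \<Rightarrow> real" assume S: "\<And>n. S n < 1" "\<And>n. 0 < S n" "S \<longlonglongrightarrow> 1"
    show "(\<lambda>n. \<integral>z. (cmod (poly p (of_real (S n) * z)))\<^sup>2 \<partial>\<nu>) \<longlonglongrightarrow> (\<integral>z. (cmod (poly p z))\<^sup>2 \<partial>\<nu>)"
    proof (rule integral_dominated_convergence[where w = "\<lambda>_. B\<^sup>2"])
      show "(\<lambda>z. (cmod (poly p z))\<^sup>2) \<in> borel_measurable \<nu>"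
        unfolding sets_circle_measurable[OF sets] by (intro continuous_measurable_circle continuous_intros)
      show "(\<lambda>z. (cmod (poly p (of_real (S n) * z)))\<^sup>2) \<in> borel_measurable \<nu>" for n
        unfolding sets_circle_measurable[OF sets] by (intro continuous_measurable_circle continuous_intros)
      have "(\<lambda>n. (cmod (poly p (of_real (S n) * z)))\<^sup>2) \<longlonglongrightarrow> (cmod (poly p (of_real 1 * z)))\<^sup>2" for z
        by (intro tendsto_intros S)
      then show "AE z in \<nu>. (\<lambda>n. (cmod (poly p (of_real (S n) * z)))\<^sup>2) \<longlonglongrightarrow> (cmod (poly p z))\<^sup>2"
        by simp
      show "AE z in \<nu>. norm ((cmod (poly p (of_real (S n) * z)))\<^sup>2) \<le> B\<^sup>2" for n
      proof (intro AE_I2)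
        fix z assume "z \<in> space \<nu>"
        then have "of_real (S n) * z \<in> cball 0 1"
          using S(1,2)[of n] by (simp add: space_circle_measure norm_mult)
        from B[OF this] show "norm ((cmod (poly p (of_real (S n) * z)))\<^sup>2) \<le> B\<^sup>2"
          by (simp add: power_mono)
      qed
    qed simp
  qed simp
qed

text \<open>A zero of p (r z) with |z| = 1 yields a zero of p of modulus r, and p has finitely many
  zeros.\<close>

lemma poly_dilation_nonzero:
  assumes "p \<noteq> (0 :: complex poly)"
  shows "\<forall>\<^sub>F r in at_left (1::real). \<forall>z\<in>sphere 0 1. poly p (of_real r * z) \<noteq> 0"
proof -
  \<comment> \<open>The modulus 1 is taken out because 1 itself must lie in the open complement; r <
    1 avoids it anyway.\<close>
  have "finite (cmod ` {z. poly p z = 0} - {1})"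
    using poly_roots_finite[OF assms] by simp
  then have "open (- (cmod ` {z. poly p z = 0} - {1}))"
    by (intro open_Compl finite_imp_closed)
  then have "\<forall>\<^sub>F r in nhds 1. r \<in> - (cmod ` {z. poly p z = 0} - {1})"
    by (intro eventually_nhds_in_open) auto
  then have 1: "\<forall>\<^sub>F r in at_left 1. r \<in> - (cmod ` {z. poly p z = 0} - {1})"
    by (rule filter_leD[rotated]) (simp add: at_within_def)
  have 2: "\<forall>\<^sub>F r in at_left (1::real). 0 < r \<and> r < 1"
    unfolding eventually_at_left_field by (intro exI[of _ 0]) auto
  from 1 2 show ?thesis
  proof eventually_elim
    case (elim r)
    show ?case
    proof (intro ballI notI)
      fix z :: complex assume z: "z \<in> sphere 0 1" "poly p (of_real r * z) = 0"
      then have "cmod (of_real r * z) \<in> cmod ` {z. poly p z = 0}" by blast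
      then show False using elim z by (simp add: norm_mult)
    qed
  qed
qed

text \<open>The converse of \<open>szego_le_bounded\<close>. A nearly optimal polynomial, dilated to
  q without zeros on the circle, gives u = 2 ln |q|. Then e^u = |q|^2, and by Jensen's inequality
  with q(0) = 1 the mean of u is at least 0, so the normalising factor is at most 1.\<close>

lemma szego_bounded_obtain:
  assumes "szego \<nu> < c"
  obtains u K where "u \<in> borel_measurable circle" "\<And>z. z \<in> sphere 0 1 \<Longrightarrow> \<bar>u z\<bar> \<le> (K :: real)"
    "(\<integral>z. exp (u z) \<partial>\<nu>) * exp (- (\<integral>z. u z \<partial>circle_lebesgue)) < c"
proof -
  obtain p where p: "poly p 0 = 1" "(\<integral>z. (cmod (poly p z))\<^sup>2 \<partial>\<nu>) < c"
    by (rule szego_less_obtain[OF assms])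
  have "p \<noteq> 0" using p(1) by auto
  have "\<forall>\<^sub>F r in at_left 1. (\<integral>z. (cmod (poly p (of_real r * z)))\<^sup>2 \<partial>\<nu>) < c"
    by (rule order_tendstoD(2)[OF poly_integral_dilation p(2)])
  with poly_dilation_nonzero[OF \<open>p \<noteq> 0\<close>]
  have "\<forall>\<^sub>F r in at_left (1::real). (\<forall>z\<in>sphere 0 1. poly p (of_real r * z) \<noteq> 0) \<and>
      (\<integral>z. (cmod (poly p (of_real r * z)))\<^sup>2 \<partial>\<nu>) < c"
    by eventually_elim auto
  from eventually_happens'[OF trivial_limit_at_left_real this]
  obtain r :: real where r: "\<And>z. z \<in> sphere 0 1 \<Longrightarrow> poly p (of_real r * z) \<noteq> 0"
    "(\<integral>z. (cmod (poly p (of_real r * z)))\<^sup>2 \<partial>\<nu>) < c"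
    by blast
  define q where "q = pcompose p [:0, of_real r:]"
  have q: "poly q z = poly p (of_real r * z)" for z
    by (simp add: q_def poly_pcompose mult.commute)
  have nz: "poly q z \<noteq> 0" if "z \<in> sphere 0 1" for z using r(1)[OF that] by (simp add: q)
  define u where "u z = 2 * ln (cmod (poly q z))" for z
  have cont: "continuous_on (sphere 0 1) u"
    unfolding u_def using nz by (intro continuous_intros) auto
  have "bounded (u ` sphere 0 1)"
    by (intro compact_imp_bounded compact_continuous_image cont compact_sphere)
  then obtain K where K: "\<And>z. z \<in> sphere 0 1 \<Longrightarrow> \<bar>u z\<bar> \<le> K"
    unfolding bounded_iff by (metis imageI real_norm_def)
  have "ln (cmod (poly q 0)) \<le> (\<integral>z. ln (cmod (poly q z)) \<partial>circle_lebesgue)"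
    by (rule ln_cmod_poly_le_integral[OF nz]) (use p(1) in \<open>auto simp: q\<close>)
  then have I: "exp (- (\<integral>z. u z \<partial>circle_lebesgue)) \<le> 1"
    using p(1) by (simp add: u_def q)
  have "exp (u z) = (cmod (poly q z))\<^sup>2" if "z \<in> sphere 0 1" for z
    using nz[OF that] by (simp add: u_def exp_double)
  then have J: "(\<integral>z. exp (u z) \<partial>\<nu>) = (\<integral>z. (cmod (poly q z))\<^sup>2 \<partial>\<nu>)"
    by (intro Bochner_Integration.integral_cong refl) (auto simp: space_circle_measure)
  have "(\<integral>z. exp (u z) \<partial>\<nu>) * exp (- (\<integral>z. u z \<partial>circle_lebesgue)) \<le> (\<integral>z. exp (u z) \<partial>\<nu>) * 1"
    by (intro mult_left_mono I) simp
  also have "\<dots> < c" using r(2) by (simp add: J q)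
  finally show ?thesis
    by (intro that[of u K] continuous_measurable_circle cont K)
qed

end

section \<open>Multiplying the measure by a density\<close>

definition clipped_ln :: "nat \<Rightarrow> real \<Rightarrow> real" where
  "clipped_ln k x = (if x = 0 then - real k else max (- real k) (min (real k) (ln x)))"

lemma clipped_ln_measurable [measurable]: "clipped_ln k \<in> borel_measurable borel"
  unfolding clipped_ln_def by measurable

lemma ext_log_measurable [measurable]: "ext_log \<in> borel_measurable borel"
  unfolding ext_log_def by measurable

lemma abs_clipped_ln_le: "\<bar>clipped_ln k x\<bar> \<le> real k"
  by (auto simp: clipped_ln_def)

lemma clipped_ln_eventually_eq:
  assumes "x \<noteq> 0"
  shows "\<forall>\<^sub>F k in sequentially. clipped_ln k x = ln x"
proof -
  obtain n :: nat where "\<bar>ln x\<bar> \<le> real n" using real_arch_simple by blast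
  then have "clipped_ln k x = ln x" if "k \<ge> n" for k
    using assms that by (auto simp: clipped_ln_def)
  then show ?thesis by (auto simp: eventually_sequentially)
qed

text \<open>Below 1 the clipped logarithm is at most 0, and above 1 clipping can only lower ln x.
  The bound is free of k and integrable at x = |g|, as dominated convergence requires.\<close>

lemma exp_clipped_ln_le:
  assumes "x \<ge> 0" shows "exp (2 * clipped_ln k x) \<le> 1 + x\<^sup>2"
proof (cases "x \<le> 1")
  case True
  then have "ln x \<le> 0" using assms by (cases "x = 0") auto
  then have "clipped_ln k x \<le> 0" by (auto simp: clipped_ln_def)
  then have "exp (2 * clipped_ln k x) \<le> 1" by simp
  then show ?thesis using zero_le_power2[of x] by linarith
next
  case False
  then have "clipped_ln k x \<le> ln x" by (auto simp: clipped_ln_def intro: order_trans[of _ 0])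
  then have "exp (2 * clipped_ln k x) \<le> exp (2 * ln x)" by simp
  also have "exp (2 * ln x) = x\<^sup>2" using False by (simp add: exp_double)
  finally show ?thesis by simp
qed

text \<open>For 0 < x \<le> 1 clipping can only raise ln x, so the product is at most 1; for x > 1
  the clipped logarithm is nonnegative, so the product is at most x^2.\<close>

lemma exp_minus_clipped_ln_le:
  assumes "x \<ge> 0" shows "x\<^sup>2 * exp (- 2 * clipped_ln k x) \<le> 1 + x\<^sup>2"
proof (cases "x = 0")
  case False
  then have x: "x > 0" using assms by simp
  show ?thesis
  proof (cases "x \<le> 1")
    case True
    then have "ln x \<le> 0" using x by simp
    then have "ln x \<le> clipped_ln k x" using x unfolding clipped_ln_def
      by (simp add: le_max_iff_disj del: ln_le_zero_iff)
    then have "exp (- 2 * clipped_ln k x) \<le> exp (- (2 * ln x))" by simp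
    also have "exp (- (2 * ln x)) = inverse (x\<^sup>2)" using x by (simp add: exp_double exp_minus)
    finally have "x\<^sup>2 * exp (- 2 * clipped_ln k x) \<le> x\<^sup>2 * inverse (x\<^sup>2)" by (intro mult_left_mono) auto
    then show ?thesis using x by (simp add: le_add_same_cancel1 order_trans[of _ 1])
  next
    case False
    then have "0 \<le> ln x" by simp
    then have "0 \<le> clipped_ln k x" using x unfolding clipped_ln_def
      by (simp add: le_max_iff_disj del: ln_ge_zero_iff)
    then have "x\<^sup>2 * exp (- 2 * clipped_ln k x) \<le> x\<^sup>2 * 1" by (intro mult_left_mono) auto
    then show ?thesis by simp
  qed
qed simp

lemma exp_clipped_ln_tendsto:
  assumes "x \<ge> 0" shows "(\<lambda>k. exp (2 * clipped_ln k x)) \<longlonglongrightarrow> x\<^sup>2"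
proof (cases "x = 0")
  case True
  have "((\<lambda>k. exp (- (2 * real k))) \<longlongrightarrow> 0) sequentially"
    by (intro filterlim_compose[OF exp_at_bot] filterlim_uminus_at_bot_at_top[THEN filterlim_compose]
        filterlim_tendsto_pos_mult_at_top[OF tendsto_const] filterlim_real_sequentially) simp
  then show ?thesis using True by (simp add: clipped_ln_def)
next
  case False
  have "exp (2 * ln x) = x\<^sup>2" using False assms by (simp add: exp_double)
  then show ?thesis
    using clipped_ln_eventually_eq[OF False]
    by (intro tendsto_eventually) (auto elim: eventually_mono)
qed

lemma exp_minus_clipped_ln_tendsto:
  assumes "x \<ge> 0"
  shows "(\<lambda>k. x\<^sup>2 * exp (- 2 * clipped_ln k x)) \<longlonglongrightarrow> (if x = 0 then 0 else 1)"
proof (cases "x = 0")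
  case False
  have "x\<^sup>2 * exp (- (2 * ln x)) = 1" using False assms by (simp add: exp_double exp_minus)
  then show ?thesis
    using clipped_ln_eventually_eq[OF False] False
    by (intro tendsto_eventually) (auto elim: eventually_mono)
qed simp

text \<open>The clipped logarithm is not monotone in k, but its positive and negative parts are, and
  \<open>ennreal\<close> extracts them by truncating at 0. Monotone convergence then applies to each
  part, whether or not its integral is finite.\<close>

lemma ennreal_clipped_ln_mono:
  assumes "k \<le> l"
  shows "ennreal (clipped_ln k x) \<le> ennreal (clipped_ln l x)"
    "ennreal (- clipped_ln k x) \<le> ennreal (- clipped_ln l x)"
proof -
  have "clipped_ln k x \<le> max 0 (clipped_ln l x)" "- clipped_ln k x \<le> max 0 (- clipped_ln l x)"
    using assms by (auto simp: clipped_ln_def)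
  then have "ennreal (clipped_ln k x) \<le> ennreal (max 0 (clipped_ln l x))"
    "ennreal (- clipped_ln k x) \<le> ennreal (max 0 (- clipped_ln l x))"
    by (simp_all only: ennreal_leI)
  then show "ennreal (clipped_ln k x) \<le> ennreal (clipped_ln l x)"
    "ennreal (- clipped_ln k x) \<le> ennreal (- clipped_ln l x)"
    by (simp_all only: max_def ennreal_neg) (auto simp: ennreal_neg split: if_splits)
qed

lemma ennreal_clipped_ln_tendsto:
  "(\<lambda>k. ennreal (clipped_ln k x)) \<longlonglongrightarrow> e2ennreal (ext_log x)"
  "(\<lambda>k. ennreal (- clipped_ln k x)) \<longlonglongrightarrow> e2ennreal (- ext_log x)"
proof -
  have "(\<lambda>k. ennreal (clipped_ln k x)) \<longlonglongrightarrow> e2ennreal (ext_log x) \<and>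
    (\<lambda>k. ennreal (- clipped_ln k x)) \<longlonglongrightarrow> e2ennreal (- ext_log x)"
  proof (cases "x = 0")
    case True
    have "(\<lambda>k. ennreal (real k)) \<longlonglongrightarrow> \<top>"
      by (simp add: ennreal_of_nat_eq_real_of_nat[symmetric] of_nat_tendsto_top_ennreal)
    moreover have "e2ennreal (- \<infinity>) = 0"
      by (simp add: e2ennreal_neg)
    moreover have "e2ennreal \<infinity> = \<top>" by simp
    ultimately show ?thesis using True by (simp add: clipped_ln_def ext_log_def ennreal_neg)
  next
    case False
    have "\<forall>\<^sub>F k in sequentially. ennreal (clipped_ln k x) = ennreal (ln x) \<and>
        ennreal (- clipped_ln k x) = ennreal (- ln x)"
      using clipped_ln_eventually_eq[OF False] by eventually_elim simp
    with False show ?thesis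
      by (auto simp: ext_log_def e2ennreal_ereal eventually_conj_iff intro: tendsto_eventually)
  qed
  then show "(\<lambda>k. ennreal (clipped_ln k x)) \<longlonglongrightarrow> e2ennreal (ext_log x)"
    "(\<lambda>k. ennreal (- clipped_ln k x)) \<longlonglongrightarrow> e2ennreal (- ext_log x)" by auto
qed

context
  fixes \<nu> :: "complex measure" and g :: "complex \<Rightarrow> complex"
  assumes fin: "finite_measure \<nu>" and sets: "sets \<nu> = sets circle"
    and gm: "g \<in> borel_measurable \<nu>" and gi: "integrable \<nu> (\<lambda>z. (cmod (g z))\<^sup>2)"
begin

interpretation \<nu>: finite_measure \<nu> by (rule fin)

private lemma gmc: "g \<in> borel_measurable circle_lebesgue" "g \<in> borel_measurable circle"
  using gm by (simp_all add: sets_circle_measurable[OF sets] sets_circle_measurable[OF sets_circle_lebesgue])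

private abbreviation (input) "\<nu>g \<equiv> density \<nu> (\<lambda>z. ennreal ((cmod (g z))\<^sup>2))"

lemma finite_measure_density_norm2: "finite_measure \<nu>g"
proof (rule finite_measureI)
  have "emeasure \<nu>g (space \<nu>) = (\<integral>\<^sup>+z. ennreal ((cmod (g z))\<^sup>2) \<partial>\<nu>)"
    using gm by (subst emeasure_density) (auto intro!: nn_integral_cong)
  also have "\<dots> = ennreal (\<integral>z. (cmod (g z))\<^sup>2 \<partial>\<nu>)"
    by (intro nn_integral_eq_integral gi) auto
  finally show "emeasure \<nu>g (space \<nu>g) \<noteq> \<infinity>" by simp
qed

lemma integral_density_norm2:
  fixes h :: "complex \<Rightarrow> real"
  assumes "h \<in> borel_measurable circle"
  shows "(\<integral>z. h z \<partial>\<nu>g) = (\<integral>z. (cmod (g z))\<^sup>2 * h z \<partial>\<nu>)"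
  using assms gm by (subst integral_density) (auto simp: sets_circle_measurable[OF sets])

private definition "W k = (\<integral>z. clipped_ln k (cmod (g z)) \<partial>circle_lebesgue)"
private definition "Pk k = (\<integral>\<^sup>+z. ennreal (clipped_ln k (cmod (g z))) \<partial>circle_lebesgue)"
private definition "Nk k = (\<integral>\<^sup>+z. ennreal (- clipped_ln k (cmod (g z))) \<partial>circle_lebesgue)"
private definition "P = (\<integral>\<^sup>+z. e2ennreal (ext_log (cmod (g z))) \<partial>circle_lebesgue)"
private definition "N = (\<integral>\<^sup>+z. e2ennreal (- ext_log (cmod (g z))) \<partial>circle_lebesgue)"

private lemma clip_int: "integrable circle_lebesgue (\<lambda>z. clipped_ln k (cmod (g z)))"
proof (rule circle_lebesgue.integrable_const_bound[of _ "real k"])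
  show "(\<lambda>z. clipped_ln k (cmod (g z))) \<in> borel_measurable circle_lebesgue"
    using gmc(1) by measurable
qed (simp add: abs_clipped_ln_le)

private lemma W_eq: "W k = enn2real (Pk k) - enn2real (Nk k)"
  unfolding W_def Pk_def Nk_def by (rule real_lebesgue_integral_def[OF clip_int])

private lemma Pk_lim: "Pk \<longlonglongrightarrow> P"
  unfolding Pk_def P_def
proof (rule nn_integral_LIMSEQ)
  show "(\<lambda>z. ennreal (clipped_ln i (cmod (g z)))) \<in> borel_measurable circle_lebesgue" for i
    using gmc(1) by measurable
qed (auto intro!: incseq_SucI le_funI ennreal_clipped_ln_mono ennreal_clipped_ln_tendsto)

private lemma Nk_lim: "Nk \<longlonglongrightarrow> N"
  unfolding Nk_def N_def
proof (rule nn_integral_LIMSEQ)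
  show "(\<lambda>z. ennreal (- clipped_ln i (cmod (g z)))) \<in> borel_measurable circle_lebesgue" for i
    using gmc(1) by measurable
qed (auto intro!: incseq_SucI le_funI ennreal_clipped_ln_mono ennreal_clipped_ln_tendsto)

private lemma Nk_fin: "Nk k < \<top>"
  using integrableD(3)[OF clip_int[of k]] by (simp add: Nk_def less_top)

private lemma Pk_le: "Pk k \<le> P"
  unfolding Pk_def P_def
  by (rule nn_integral_mono) (rule incseq_le[OF _ ennreal_clipped_ln_tendsto(1)], intro incseq_SucI ennreal_clipped_ln_mono, simp)

private lemma bound_int: "integrable \<nu> (\<lambda>z. c * (1 + (cmod (g z))\<^sup>2))"
  using gi by simp

text \<open>The infimum is tested with u, twice the positive part of the clipped logarithm. Since
  e^u stays below 1 + |g|^2, the mean of u is at most ln (C / szego \<nu>), uniformly in k.\<close>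

lemma nn_integral_log_finite:
  assumes "szego \<nu> > 0"
  shows "(\<integral>\<^sup>+z. e2ennreal (ext_log (cmod (g z))) \<partial>circle_lebesgue) < \<infinity>"
proof -
  let ?m = "\<lambda>u. \<integral>z. u z \<partial>circle_lebesgue"
  define C where "C = (\<integral>z. 1 + (cmod (g z))\<^sup>2 \<partial>\<nu>)"
  have "Pk k \<le> ennreal (ln (C / szego \<nu>) / 2)" for k
  proof -
    define u where "u z = 2 * max 0 (clipped_ln k (cmod (g z)))" for z
    have um: "u \<in> borel_measurable circle"
      unfolding u_def using gmc(2) by measurable
    have "\<bar>u z\<bar> \<le> 2 * real k" for z
      using abs_clipped_ln_le[of k "cmod (g z)"] by (auto simp: u_def)
    from szego_le_bounded[OF fin sets um this]
    have 1: "szego \<nu> \<le> (\<integral>z. exp (u z) \<partial>\<nu>) * exp (- ?m u)" .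
    have "exp (u z) \<le> 1 + (cmod (g z))\<^sup>2" for z
      using exp_clipped_ln_le[of "cmod (g z)" k] by (auto simp: u_def max_def)
    then have "(\<integral>z. exp (u z) \<partial>\<nu>) \<le> C"
      unfolding C_def using gi by (intro integral_mono') auto
    then have "(\<integral>z. exp (u z) \<partial>\<nu>) * exp (- ?m u) \<le> C * exp (- ?m u)"
      by (intro mult_right_mono) auto
    with 1 have "szego \<nu> \<le> C * exp (- ?m u)" by linarith
    then have 2: "exp (?m u) \<le> C / szego \<nu>"
      using assms by (simp add: exp_minus field_simps)
    have "?m u \<le> ln (C / szego \<nu>)"
      using 2 by (subst ln_ge_iff) (auto intro: less_le_trans[OF exp_gt_zero])
    moreover have "?m u = 2 * (\<integral>z. max 0 (clipped_ln k (cmod (g z))) \<partial>circle_lebesgue)"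
      by (simp add: u_def)
    moreover have "Pk k = ennreal (\<integral>z. max 0 (clipped_ln k (cmod (g z))) \<partial>circle_lebesgue)"
      unfolding Pk_def using clip_int[of k]
      by (subst nn_integral_eq_integral[symmetric]) (auto intro!: integrable_max simp: ennreal_max_0)
    ultimately show ?thesis by (auto intro!: ennreal_leI)
  qed
  then have "P \<le> ennreal (ln (C / szego \<nu>) / 2)"
    by (intro LIMSEQ_le_const2[OF Pk_lim]) auto
  then show ?thesis unfolding P_def by (rule order_le_less_trans) simp
qed

text \<open>The infimum for |g|^2 \<nu> is tested with u minus twice the clipped logarithm: the
  exponential nearly cancels the density, and the mean drops by 2 \<open>W k\<close>.\<close>

private lemma szego_density_le:
  assumes u: "u \<in> borel_measurable circle" and K: "\<And>z. z \<in> sphere 0 1 \<Longrightarrow> \<bar>u z\<bar> \<le> K"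
  shows "szego \<nu>g \<le> (\<integral>z. exp (u z) * ((cmod (g z))\<^sup>2 * exp (- 2 * clipped_ln k (cmod (g z)))) \<partial>\<nu>) *
      exp (2 * W k - (\<integral>z. u z \<partial>circle_lebesgue))"
proof -
  define v where "v z = u z - 2 * clipped_ln k (cmod (g z))" for z
  have vm: "v \<in> borel_measurable circle"
    unfolding v_def using gmc(2) u by measurable
  have vK: "\<bar>v z\<bar> \<le> K + 2 * real k" if "z \<in> sphere 0 1" for z
    using abs_clipped_ln_le[of k "cmod (g z)"] K[OF that] by (auto simp: v_def)
  have "szego \<nu>g \<le> (\<integral>z. exp (v z) \<partial>\<nu>g) * exp (- (\<integral>z. v z \<partial>circle_lebesgue))"
    by (rule szego_le_bounded[OF finite_measure_density_norm2 _ vm vK]) (simp add: sets)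
  also have "(\<integral>z. exp (v z) \<partial>\<nu>g) = (\<integral>z. (cmod (g z))\<^sup>2 * exp (v z) \<partial>\<nu>)"
    using vm by (intro integral_density_norm2) measurable
  also have "\<dots> = (\<integral>z. exp (u z) * ((cmod (g z))\<^sup>2 * exp (- 2 * clipped_ln k (cmod (g z)))) \<partial>\<nu>)"
    by (intro Bochner_Integration.integral_cong refl) (simp add: v_def exp_diff exp_minus field_simps)
  also have "(\<integral>z. v z \<partial>circle_lebesgue) = (\<integral>z. u z \<partial>circle_lebesgue) - 2 * W k"
  proof -
    have "integrable circle_lebesgue u"
      using u K by (intro circle_lebesgue.integrable_const_bound[of _ K])
        (auto simp: sets_circle_measurable[OF sets_circle_lebesgue])
    then show ?thesis unfolding v_def W_def using clip_int[of k] by simp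
  qed
  finally show ?thesis by simp
qed

text \<open>For u = 0 the preceding estimate gives the bound C * exp (2 W k). The positive parts
  stay below P and the negative parts tend to \<infinity>, so \<open>W k\<close> tends to
  -\<infinity>.\<close>

lemma szego_density_eq_0:
  assumes "(\<integral>\<^sup>+z. e2ennreal (ext_log (cmod (g z))) \<partial>circle_lebesgue) < \<infinity>"
    and "(\<integral>\<^sup>+z. e2ennreal (- ext_log (cmod (g z))) \<partial>circle_lebesgue) = \<infinity>"
  shows "szego \<nu>g = 0"
proof -
  define C where "C = (\<integral>z. 1 + (cmod (g z))\<^sup>2 \<partial>\<nu>)"
  have C0: "0 \<le> C" unfolding C_def by (intro integral_nonneg_AE) auto
  have Pf: "P < \<top>" and Ni: "N = \<top>" using assms by (simp_all add: P_def N_def)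
  have le: "szego \<nu>g \<le> C * exp (2 * W k)" for k
  proof -
    have m0: "(\<lambda>z. 0::real) \<in> borel_measurable circle" by simp
    have "szego \<nu>g \<le> (\<integral>z. (cmod (g z))\<^sup>2 * exp (- 2 * clipped_ln k (cmod (g z))) \<partial>\<nu>) * exp (2 * W k)"
      using szego_density_le[OF m0, of 0 k] by simp
    also have "\<dots> \<le> C * exp (2 * W k)"
      unfolding C_def using gi by (intro mult_right_mono integral_mono' exp_minus_clipped_ln_le) auto
    finally show ?thesis .
  qed
  have Nt: "filterlim (\<lambda>k. enn2real (Nk k)) at_top sequentially"
    unfolding filterlim_at_top
  proof
    fix c :: real
    have "\<forall>\<^sub>F k in sequentially. ennreal c < Nk k"
      using Nk_lim unfolding Ni by (rule order_tendstoD(1)) simp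
    then show "\<forall>\<^sub>F k in sequentially. c \<le> enn2real (Nk k)"
    proof eventually_elim
      case (elim k)
      then have "ennreal c \<le> ennreal (enn2real (Nk k))" using Nk_fin[of k] by simp
      then show ?case by (cases "0 \<le> c") (auto simp: ennreal_le_iff intro: order_trans[of _ 0])
    qed
  qed
  have "W k \<le> enn2real P - enn2real (Nk k)" for k
    unfolding W_eq using enn2real_mono[OF Pk_le Pf, of k] by simp
  then have le2: "szego \<nu>g \<le> C * exp (2 * (enn2real P - enn2real (Nk k)))" for k
    by (intro order_trans[OF le[of k]] mult_left_mono C0) (simp del: right_diff_distrib_numeral)
  have "((\<lambda>k. C * exp (2 * (enn2real P - enn2real (Nk k)))) \<longlongrightarrow> C * 0) sequentially"
  proof (intro tendsto_mult tendsto_const filterlim_compose[OF exp_at_bot])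
    have "filterlim (\<lambda>k. - (2 * (- enn2real P + enn2real (Nk k)))) at_bot sequentially"
      by (intro filterlim_uminus_at_bot_at_top[THEN filterlim_compose]
          filterlim_tendsto_pos_mult_at_top[OF tendsto_const] filterlim_tendsto_add_at_top[OF tendsto_const] Nt) simp
    then show "filterlim (\<lambda>k. 2 * (enn2real P - enn2real (Nk k))) at_bot sequentially"
      by (simp add: algebra_simps)
  qed
  then have "szego \<nu>g \<le> C * 0"
    by (rule LIMSEQ_le_const) (use le2 in auto)
  then show ?thesis using szego_nonneg[of \<nu>g] by simp
qed

text \<open>Serves both inequalities of \<open>szego_density\<close>: there
  \<open>\<phi> k x\<close> is x^2 exp (-2 clip), with limit the indicator of x \<noteq> 0, or exp
  (2 clip), with limit x^2.\<close>

private lemma exp_mult_tendsto: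
  assumes u: "u \<in> borel_measurable circle" and K: "\<And>z. z \<in> sphere 0 1 \<Longrightarrow> \<bar>u z\<bar> \<le> K"
    and meas [measurable]: "\<And>k. \<phi> k \<in> borel_measurable borel" "l \<in> borel_measurable borel"
    and bound: "\<And>k x. 0 \<le> x \<Longrightarrow> \<bar>\<phi> k x\<bar> \<le> 1 + x\<^sup>2"
    and lim: "\<And>x. 0 \<le> x \<Longrightarrow> (\<lambda>k. \<phi> k x) \<longlonglongrightarrow> l x"
  shows "(\<lambda>k. \<integral>z. exp (u z) * \<phi> k (cmod (g z)) \<partial>\<nu>) \<longlonglongrightarrow> (\<integral>z. exp (u z) * l (cmod (g z)) \<partial>\<nu>)"
proof (rule integral_dominated_convergence[OF _ _ bound_int])
  have um [measurable]: "u \<in> borel_measurable \<nu>" using u by (simp add: sets_circle_measurable[OF sets])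
  show "(\<lambda>z. exp (u z) * l (cmod (g z))) \<in> borel_measurable \<nu>"
    "(\<lambda>z. exp (u z) * \<phi> k (cmod (g z))) \<in> borel_measurable \<nu>" for k
    using gm by measurable
  show "AE z in \<nu>. (\<lambda>k. exp (u z) * \<phi> k (cmod (g z))) \<longlonglongrightarrow> exp (u z) * l (cmod (g z))"
    by (intro AE_I2 tendsto_mult tendsto_const lim) simp
  show "AE z in \<nu>. norm (exp (u z) * \<phi> k (cmod (g z))) \<le> exp K * (1 + (cmod (g z))\<^sup>2)" for k
  proof (intro AE_I2)
    fix z assume "z \<in> space \<nu>"
    then have "exp (u z) \<le> exp K" using K[of z] by (simp add: space_circle_measure[OF fin sets])
    then show "norm (exp (u z) * \<phi> k (cmod (g z))) \<le> exp K * (1 + (cmod (g z))\<^sup>2)"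
      using mult_mono[OF _ bound[of "cmod (g z)" k], of "exp (u z)" "exp K"] by (simp add: abs_mult)
  qed
qed

text \<open>A nearly optimal u for one measure, shifted by twice the clipped logarithm, is a test
  function for the other, and as k tends to \<infinity> the shift of the mean becomes 2 I. The shift
  is negative on the way from \<nu> to |g|^2 \<nu> and positive on the way back.\<close>

lemma szego_density:
  assumes "(\<integral>\<^sup>+z. e2ennreal (ext_log (cmod (g z))) \<partial>circle_lebesgue) < \<infinity>"
    and "(\<integral>\<^sup>+z. e2ennreal (- ext_log (cmod (g z))) \<partial>circle_lebesgue) < \<infinity>"
  shows "szego \<nu>g = szego \<nu> *
    exp (2 * (enn2real (\<integral>\<^sup>+z. e2ennreal (ext_log (cmod (g z))) \<partial>circle_lebesgue) -
              enn2real (\<integral>\<^sup>+z. e2ennreal (- ext_log (cmod (g z))) \<partial>circle_lebesgue)))"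
proof -
  let ?m = "\<lambda>u. \<integral>z. u z \<partial>circle_lebesgue"
  have Pf: "P < \<top>" and Nf: "N < \<top>" using assms by (simp_all add: P_def N_def)
  define I where "I = enn2real P - enn2real N"
  have W: "W \<longlonglongrightarrow> I"
    unfolding W_eq[abs_def] I_def using Pf Nf
    by (intro tendsto_diff tendsto_enn2real; use Pk_lim Nk_lim in simp)
  have "szego \<nu>g = szego \<nu> * exp (2 * I)"
  proof (rule antisym)
    show "szego \<nu>g \<le> szego \<nu> * exp (2 * I)"
    proof (rule ccontr)
      assume "\<not> ?thesis"
      then have "szego \<nu> < szego \<nu>g * exp (- 2 * I)"
        by (simp add: exp_minus field_simps)
      then obtain u K where u: "u \<in> borel_measurable circle" and K: "\<And>z. z \<in> sphere 0 1 \<Longrightarrow> \<bar>u z\<bar> \<le> K"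
        and lt: "(\<integral>z. exp (u z) \<partial>\<nu>) * exp (- ?m u) < szego \<nu>g * exp (- 2 * I)"
        using szego_bounded_obtain[OF fin sets] by metis
      have eK: "exp (u z) \<le> exp K" if "z \<in> space \<nu>" for z
        using K[of z] that by (simp add: space_circle_measure[OF fin sets])
      have um: "u \<in> borel_measurable \<nu>" using u by (simp add: sets_circle_measurable[OF sets])
      let ?F = "\<lambda>k z. exp (u z) * ((cmod (g z))\<^sup>2 * exp (- 2 * clipped_ln k (cmod (g z))))"
      have lim: "(\<lambda>k. \<integral>z. ?F k z \<partial>\<nu>) \<longlonglongrightarrow> (\<integral>z. exp (u z) * (if cmod (g z) = 0 then 0 else 1) \<partial>\<nu>)"
        by (rule exp_mult_tendsto[OF u K]) (use exp_minus_clipped_ln_le exp_minus_clipped_ln_tendsto in \<open>simp_all add: abs_mult\<close>)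
      have "(\<lambda>k. (\<integral>z. ?F k z \<partial>\<nu>) * exp (2 * W k - ?m u)) \<longlonglongrightarrow>
        (\<integral>z. exp (u z) * (if cmod (g z) = 0 then 0 else 1) \<partial>\<nu>) * exp (2 * I - ?m u)"
        by (intro tendsto_intros W lim)
      then have "szego \<nu>g \<le> (\<integral>z. exp (u z) * (if cmod (g z) = 0 then 0 else 1) \<partial>\<nu>) * exp (2 * I - ?m u)"
        by (rule LIMSEQ_le_const) (use szego_density_le[OF u K] in auto)
      \<comment> \<open>On the zero set of g the integrand has limit 0 instead of e^u. Restoring e^u
        there only increases the bound.\<close>
      also have "\<dots> \<le> (\<integral>z. exp (u z) \<partial>\<nu>) * exp (2 * I - ?m u)"
      proof (intro mult_right_mono integral_mono')
        show "integrable \<nu> (\<lambda>z. exp (u z))"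
          by (rule \<nu>.integrable_const_bound[of _ "exp K"]) (use eK um in auto)
      qed auto
      also have "\<dots> = exp (2 * I) * ((\<integral>z. exp (u z) \<partial>\<nu>) * exp (- ?m u))"
        by (simp add: exp_diff exp_minus field_simps)
      also have "\<dots> < exp (2 * I) * (szego \<nu>g * exp (- 2 * I))"
        using lt by (intro mult_strict_left_mono) auto
      finally show False by (simp add: exp_minus field_simps)
    qed
  next
    show "szego \<nu> * exp (2 * I) \<le> szego \<nu>g"
    proof (rule ccontr)
      assume "\<not> ?thesis"
      then have "szego \<nu>g < szego \<nu> * exp (2 * I)" by simp
      moreover have "sets \<nu>g = sets circle" by (simp add: sets)
      ultimately obtain u K where u: "u \<in> borel_measurable circle" and K: "\<And>z. z \<in> sphere 0 1 \<Longrightarrow> \<bar>u z\<bar> \<le> K"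
        and lt: "(\<integral>z. exp (u z) \<partial>\<nu>g) * exp (- ?m u) < szego \<nu> * exp (2 * I)"
        using szego_bounded_obtain[OF finite_measure_density_norm2] by metis
      let ?F = "\<lambda>k z. exp (u z) * exp (2 * clipped_ln k (cmod (g z)))"
      have lim: "(\<lambda>k. \<integral>z. ?F k z \<partial>\<nu>) \<longlonglongrightarrow> (\<integral>z. exp (u z) * (cmod (g z))\<^sup>2 \<partial>\<nu>)"
        by (rule exp_mult_tendsto[OF u K]) (use exp_clipped_ln_le exp_clipped_ln_tendsto in simp_all)
      have ui: "integrable circle_lebesgue u"
        using u K by (intro circle_lebesgue.integrable_const_bound[of _ K])
          (auto simp: sets_circle_measurable[OF sets_circle_lebesgue])
      have le: "szego \<nu> \<le> (\<integral>z. ?F k z \<partial>\<nu>) * exp (- (2 * W k) - ?m u)" for k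
      proof -
        define v where "v z = u z + 2 * clipped_ln k (cmod (g z))" for z
        have vm: "v \<in> borel_measurable circle"
          unfolding v_def using gmc(2) u by measurable
        have vK: "\<bar>v z\<bar> \<le> K + 2 * real k" if "z \<in> sphere 0 1" for z
          using abs_clipped_ln_le[of k "cmod (g z)"] K[OF that] by (auto simp: v_def)
        have "?m v = ?m u + 2 * W k"
          unfolding v_def W_def using clip_int[of k] ui by simp
        then have "- ?m v = - (2 * W k) - ?m u" by simp
        moreover have "(\<integral>z. exp (v z) \<partial>\<nu>) = (\<integral>z. ?F k z \<partial>\<nu>)"
          by (simp add: v_def exp_add)
        ultimately show ?thesis using szego_le_bounded[OF fin sets vm vK] by simp
      qed
      have "(\<lambda>k. (\<integral>z. ?F k z \<partial>\<nu>) * exp (- (2 * W k) - ?m u)) \<longlonglongrightarrow>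
        (\<integral>z. exp (u z) * (cmod (g z))\<^sup>2 \<partial>\<nu>) * exp (- (2 * I) - ?m u)"
        by (intro tendsto_intros W lim)
      then have "szego \<nu> \<le> (\<integral>z. exp (u z) * (cmod (g z))\<^sup>2 \<partial>\<nu>) * exp (- (2 * I) - ?m u)"
        by (rule LIMSEQ_le_const) (use le in auto)
      also have "(\<integral>z. exp (u z) * (cmod (g z))\<^sup>2 \<partial>\<nu>) = (\<integral>z. exp (u z) \<partial>\<nu>g)"
        using u by (subst integral_density_norm2) (auto simp: mult.commute)
      also have "\<dots> * exp (- (2 * I) - ?m u) =
          (\<dots> * exp (- ?m u)) * exp (- (2 * I))"
        by (simp add: exp_diff exp_minus field_simps)
      also have "\<dots> < (szego \<nu> * exp (2 * I)) * exp (- (2 * I))"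
        using lt by (intro mult_strict_right_mono) auto
      finally show False by (simp add: exp_minus field_simps)
    qed
  qed
  then show ?thesis by (simp add: I_def P_def N_def)
qed

end

section \<open>Characteristic functions in several variables\<close>

text \<open>The lower bound 1 makes \<open>w\<close> normalizable, so that Levy's one-dimensional uniqueness theorem applies.\<close>

lemma weighted_char_unique_real:
  fixes w V :: "'a \<Rightarrow> real"
  assumes P: "prob_space M1" "prob_space M2"
    and meas [measurable]: "V \<in> borel_measurable M1" "V \<in> borel_measurable M2"
      "w \<in> borel_measurable M1" "w \<in> borel_measurable M2"
    and w: "\<And>x. 1 \<le> w x" "\<And>x. w x \<le> 3"
    and eq: "\<And>t. (\<integral>x. of_real (w x) * iexp (t * V x) \<partial>M1) = (\<integral>x. of_real (w x) * iexp (t * V x) \<partial>M2)"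
    and A: "A \<in> sets borel"
  shows "(\<integral>x. w x * indicator A (V x) \<partial>M1) = (\<integral>x. w x * indicator A (V x) \<partial>M2)"
proof -
  have wi: "integrable M w" "1 \<le> (\<integral>x. w x \<partial>M)" if "prob_space M" "w \<in> borel_measurable M" for M
  proof -
    interpret prob_space M by fact
    show i: "integrable M w"
      by (rule integrable_const_bound[of _ 3]) (use w that in \<open>auto simp: abs_of_nonneg order_trans[OF zero_le_one]\<close>)
    have "(\<integral>x. 1 \<partial>M) \<le> (\<integral>x. w x \<partial>M)" by (rule integral_mono) (use i w in auto)
    then show "1 \<le> (\<integral>x. w x \<partial>M)" by (simp add: prob_space)
  qed
  define c where "c = (\<integral>x. w x \<partial>M1)"
  \<comment> \<open>The mass of the weighted measure is its transform at 0, hence common to both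
    measures; dividing by it gives probability measures.\<close>
  have c2: "c = (\<integral>x. w x \<partial>M2)"
    using eq[of 0] unfolding c_def by (simp add: of_real_eq_iff)
  have c1: "1 \<le> c" unfolding c_def by (rule wi) (use P in auto)
  define D where "D M = distr (density M (\<lambda>x. ennreal (w x / c))) borel V" for M
  have D: "real_distribution (D M)" "char (D M) t = (\<integral>x. of_real (w x) * iexp (t * V x) \<partial>M) / of_real c"
    "c * measure (D M) A = (\<integral>x. w x * indicator A (V x) \<partial>M)"
    if M: "prob_space M" "(\<integral>x. w x \<partial>M) = c" and [measurable]: "w \<in> borel_measurable M" "V \<in> borel_measurable M" for M t
  proof -
    interpret prob_space M by fact
    have w0: "0 \<le> w x / c" for x using w(1)[of x] c1 by simp
    have p: "prob_space (density M (\<lambda>x. ennreal (w x / c)))"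
    proof (rule prob_spaceI)
      have "emeasure (density M (\<lambda>x. ennreal (w x / c))) (space M) = (\<integral>\<^sup>+x. ennreal (w x / c) \<partial>M)"
        by (subst emeasure_density) (auto intro!: nn_integral_cong)
      also have "\<dots> = ennreal (\<integral>x. w x / c \<partial>M)"
        using w0 wi[OF M(1)] by (intro nn_integral_eq_integral) auto
      also have "(\<integral>x. w x / c \<partial>M) = 1" using M(2) c1 by simp
      finally show "emeasure (density M (\<lambda>x. ennreal (w x / c))) (space (density M (\<lambda>x. ennreal (w x / c)))) = 1" by simp
    qed
    show "real_distribution (D M)"
      unfolding D_def by (intro real_distribution.intro real_distribution_axioms.intro prob_space.prob_space_distr p) auto
    have "char (D M) t = (\<integral>x. iexp (t * V x) \<partial>density M (\<lambda>x. ennreal (w x / c)))"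
      unfolding char_def D_def by (subst integral_distr) auto
    also have "\<dots> = (\<integral>x. (w x / c) *\<^sub>R iexp (t * V x) \<partial>M)"
      using w0 by (subst integral_density) auto
    also have "\<dots> = (\<integral>x. of_real (w x) * iexp (t * V x) / of_real c \<partial>M)"
      by (simp add: scaleR_conv_of_real)
    finally show "char (D M) t = (\<integral>x. of_real (w x) * iexp (t * V x) \<partial>M) / of_real c" by simp
    have "measure (D M) A = (\<integral>x. indicator A x \<partial>D M)"
      using A by (simp add: D_def)
    also have "\<dots> = (\<integral>x. indicator A (V x) \<partial>density M (\<lambda>x. ennreal (w x / c)))"
      unfolding D_def using A by (subst integral_distr) auto
    also have "\<dots> = (\<integral>x. (w x / c) * indicator A (V x) \<partial>M)"
      using w0 A by (subst integral_density) auto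
    finally show "c * measure (D M) A = (\<integral>x. w x * indicator A (V x) \<partial>M)"
      using c1 by simp
  qed
  have "D M1 = D M2"
    by (intro Levy_uniqueness D ext) (use P c_def c2 eq meas D(2)[OF P(1)] D(2)[OF P(2)] in auto)
  then show ?thesis
    using D(3)[of M1] D(3)[of M2] P c_def c2 meas by metis
qed

lemma integrable_bounded_complex:
  fixes Q :: "'a \<Rightarrow> complex"
  assumes "prob_space M" "Q \<in> borel_measurable M" "\<And>x. cmod (Q x) \<le> B"
  shows "integrable M Q"
proof -
  interpret prob_space M by fact
  show ?thesis by (rule integrable_const_bound[of _ B]) (use assms in auto)
qed

text \<open>2 + Re Q lies between 1 and 3, so it is an admissible weight. Its transform is a
  combination of those of 1, Q and the conjugate of Q, and subtracting twice the unweighted identity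
  leaves Re Q.\<close>

lemma weighted_char_unique_Re:
  fixes V :: "'a \<Rightarrow> real" and Q :: "'a \<Rightarrow> complex"
  assumes P: "prob_space M1" "prob_space M2"
    and meas [measurable]: "V \<in> borel_measurable M1" "V \<in> borel_measurable M2"
      "Q \<in> borel_measurable M1" "Q \<in> borel_measurable M2"
    and Q: "\<And>x. cmod (Q x) \<le> 1"
    and eq0: "\<And>t. (\<integral>x. iexp (t * V x) \<partial>M1) = (\<integral>x. iexp (t * V x) \<partial>M2)"
    and eq: "\<And>t. (\<integral>x. Q x * iexp (t * V x) \<partial>M1) = (\<integral>x. Q x * iexp (t * V x) \<partial>M2)"
    and A: "A \<in> sets borel"
  shows "(\<integral>x. Re (Q x) * indicator A (V x) \<partial>M1) = (\<integral>x. Re (Q x) * indicator A (V x) \<partial>M2)"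
proof -
  interpret M1: prob_space M1 by fact
  interpret M2: prob_space M2 by fact
  have R: "\<bar>Re (Q x)\<bar> \<le> 1" for x using abs_Re_le_cmod[of "Q x"] Q[of x] by linarith
  have Aind [measurable]: "indicator A \<in> borel_measurable borel" using A by simp
  have split: "(\<integral>x. of_real (2 + Re (Q x)) * iexp (t * V x) \<partial>M) =
      2 * (\<integral>x. iexp (t * V x) \<partial>M) + ((\<integral>x. Q x * iexp (t * V x) \<partial>M) + cnj (\<integral>x. Q x * iexp (- t * V x) \<partial>M)) / 2"
    if M: "prob_space M" and [measurable]: "V \<in> borel_measurable M" "Q \<in> borel_measurable M" for M t
  proof -
    have i1: "integrable M (\<lambda>x. iexp (t * V x))"
      by (rule integrable_bounded_complex[OF M, of _ 1]) auto
    have i2: "integrable M (\<lambda>x. Q x * iexp (s * V x))" for s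
      by (rule integrable_bounded_complex[OF M, of _ 1]) (auto simp: norm_mult Q)
    have [measurable]: "(\<lambda>x. cnj (Q x)) \<in> borel_measurable M"
      by (rule measurable_compose[OF that(3) borel_measurable_continuous_onI]) (intro continuous_intros)
    have i3: "integrable M (\<lambda>x. cnj (Q x) * iexp (t * V x))"
      by (rule integrable_bounded_complex[OF M, of _ 1]) (auto simp: norm_mult Q)
    have "(\<integral>x. of_real (2 + Re (Q x)) * iexp (t * V x) \<partial>M) =
      (\<integral>x. 2 * iexp (t * V x) + (Q x * iexp (t * V x) + cnj (Q x) * iexp (t * V x)) / 2 \<partial>M)"
    proof (intro Bochner_Integration.integral_cong refl)
      fix x
      have "complex_of_real (2 + Re (Q x)) = 2 + (Q x + cnj (Q x)) / 2"
        by (simp add: complex_add_cnj)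
      then show "of_real (2 + Re (Q x)) * iexp (t * V x) =
          2 * iexp (t * V x) + (Q x * iexp (t * V x) + cnj (Q x) * iexp (t * V x)) / 2"
        by (simp only: ring_distribs add_divide_distrib times_divide_eq_left)
    qed
    also have "\<dots> = 2 * (\<integral>x. iexp (t * V x) \<partial>M) + ((\<integral>x. Q x * iexp (t * V x) \<partial>M) + (\<integral>x. cnj (Q x) * iexp (t * V x) \<partial>M)) / 2"
      using i1 i2[of t] i3 by simp
    \<comment> \<open>The transform of the conjugate of Q at t is the conjugate of the transform of
      Q at -t, so the hypothesis on Q covers it.\<close>
    also have "(\<integral>x. cnj (Q x) * iexp (t * V x) \<partial>M) = (\<integral>x. cnj (Q x * iexp (- t * V x)) \<partial>M)"
      by (simp add: exp_cnj)
    also have "\<dots> = cnj (\<integral>x. Q x * iexp (- t * V x) \<partial>M)"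
      using integral_bounded_linear[OF bounded_linear_cnj i2[of "- t"]] by simp
    finally show ?thesis .
  qed
  have "(\<integral>x. (2 + Re (Q x)) * indicator A (V x) \<partial>M1) = (\<integral>x. (2 + Re (Q x)) * indicator A (V x) \<partial>M2)"
  proof (rule weighted_char_unique_real[OF P meas(1,2) _ _ _ _ _ A])
    show "1 \<le> 2 + Re (Q x)" "2 + Re (Q x) \<le> 3" for x using R[of x] by (auto simp: abs_le_iff)
    show "(\<integral>x. of_real (2 + Re (Q x)) * iexp (t * V x) \<partial>M1) = (\<integral>x. of_real (2 + Re (Q x)) * iexp (t * V x) \<partial>M2)" for t
      unfolding split[OF P(1) meas(1,3)] split[OF P(2) meas(2,4)] eq eq0 ..
  qed measurable
  moreover have "(\<integral>x. (1::real) * indicator A (V x) \<partial>M1) = (\<integral>x. (1::real) * indicator A (V x) \<partial>M2)"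
    using eq0
    by (intro weighted_char_unique_real[where w = "\<lambda>_. 1", OF P meas(1,2) _ _ _ _ _ A]) (simp_all only: of_real_1 mult_1 borel_measurable_const order_refl one_le_numeral)
  moreover have "(\<integral>x. (2 + Re (Q x)) * indicator A (V x) \<partial>M) =
      2 * (\<integral>x. (1::real) * indicator A (V x) \<partial>M) + (\<integral>x. Re (Q x) * indicator A (V x) \<partial>M)"
    if M: "prob_space M" and [measurable]: "V \<in> borel_measurable M" "Q \<in> borel_measurable M" for M
  proof -
    interpret prob_space M by fact
    have i1: "integrable M (\<lambda>x. indicator A (V x) :: real)"
      by (rule integrable_const_bound[of _ 1]) (auto split: split_indicator)
    have i2: "integrable M (\<lambda>x. Re (Q x) * indicator A (V x))"
      by (rule integrable_const_bound[of _ 1]) (use R in \<open>auto split: split_indicator\<close>)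
    show ?thesis using i1 i2 by (simp add: algebra_simps)
  qed
  ultimately show ?thesis using P meas by simp
qed

lemma weighted_char_unique:
  fixes V :: "'a \<Rightarrow> real" and Q :: "'a \<Rightarrow> complex"
  assumes P: "prob_space M1" "prob_space M2"
    and meas [measurable]: "V \<in> borel_measurable M1" "V \<in> borel_measurable M2"
      "Q \<in> borel_measurable M1" "Q \<in> borel_measurable M2"
    and Q: "\<And>x. cmod (Q x) \<le> 1"
    and eq0: "\<And>t. (\<integral>x. iexp (t * V x) \<partial>M1) = (\<integral>x. iexp (t * V x) \<partial>M2)"
    and eq: "\<And>t. (\<integral>x. Q x * iexp (t * V x) \<partial>M1) = (\<integral>x. Q x * iexp (t * V x) \<partial>M2)"
    and A: "A \<in> sets borel"
  shows "(\<integral>x. Q x * indicator A (V x) \<partial>M1) = (\<integral>x. Q x * indicator A (V x) \<partial>M2)"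
proof -
  have Aind [measurable]: "indicator A \<in> borel_measurable borel" using A by simp
  have 1: "(\<integral>x. Re (Q x) * indicator A (V x) \<partial>M1) = (\<integral>x. Re (Q x) * indicator A (V x) \<partial>M2)"
    by (rule weighted_char_unique_Re[OF P meas Q eq0 eq A])
  \<comment> \<open>The imaginary part of Q is the real part of -i Q.\<close>
  have 2: "(\<integral>x. Re (- \<i> * Q x) * indicator A (V x) \<partial>M1) = (\<integral>x. Re (- \<i> * Q x) * indicator A (V x) \<partial>M2)"
  proof (rule weighted_char_unique_Re[OF P meas(1,2) _ _ _ eq0 _ A])
    show "(\<integral>x. - \<i> * Q x * iexp (t * V x) \<partial>M1) = (\<integral>x. - \<i> * Q x * iexp (t * V x) \<partial>M2)" for t
      using eq[of t] by (simp add: mult.assoc)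
  qed (use Q in \<open>auto simp: norm_mult\<close>)
  have *: "Re (\<integral>x. Q x * indicator A (V x) \<partial>M) = (\<integral>x. Re (Q x) * indicator A (V x) \<partial>M) \<and>
       Im (\<integral>x. Q x * indicator A (V x) \<partial>M) = (\<integral>x. Re (- \<i> * Q x) * indicator A (V x) \<partial>M)"
    if M: "prob_space M" and [measurable]: "V \<in> borel_measurable M" "Q \<in> borel_measurable M" for M
  proof -
    have i: "integrable M (\<lambda>x. Q x * indicator A (V x))"
      by (rule integrable_bounded_complex[OF M, of _ 1]) (auto simp: norm_mult Q split: split_indicator)
    have "Re (\<integral>x. Q x * indicator A (V x) \<partial>M) = (\<integral>x. Re (Q x * indicator A (V x)) \<partial>M)"
      "Im (\<integral>x. Q x * indicator A (V x) \<partial>M) = (\<integral>x. Im (Q x * indicator A (V x)) \<partial>M)"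
      using integral_Re[OF i] integral_Im[OF i] by simp_all
    moreover have "Re (Q x * indicator A (V x)) = Re (Q x) * indicator A (V x)"
      "Im (Q x * indicator A (V x)) = Re (- \<i> * Q x) * indicator A (V x)" for x
      by (auto split: split_indicator)
    ultimately show ?thesis by simp
  qed
  show ?thesis
    using *[OF P(1) meas(1,3)] *[OF P(2) meas(2,4)] 1 2 by (simp add: complex_eq_iff)
qed

text \<open>Characters are exchanged for indicators one coordinate at a time. At each exchange all
  other factors are frozen in a bounded weight Q, and one-dimensional uniqueness with weight Q is
  applied to coordinate j. After the last exchange the measures agree on boxes.\<close>

lemma PiM_char_unique:
  fixes M1 M2 :: "('i \<Rightarrow> real) measure"
  assumes I: "finite I" and P: "prob_space M1" "prob_space M2"
    and sets: "sets M1 = sets (\<Pi>\<^sub>M i\<in>I. lborel)" "sets M2 = sets (\<Pi>\<^sub>M i\<in>I. lborel)"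
    and eq: "\<And>t. (\<integral>x. iexp (\<Sum>i\<in>I. t i * x i) \<partial>M1) = (\<integral>x. iexp (\<Sum>i\<in>I. t i * x i) \<partial>M2)"
  shows "M1 = M2"
proof -
  interpret M1: prob_space M1 by fact
  interpret M2: prob_space M2 by fact
  have comp: "(\<lambda>x. x i) \<in> borel_measurable (\<Pi>\<^sub>M i\<in>I. lborel :: real measure)" if "i \<in> I" for i
    using measurable_component_singleton[OF that, of "\<lambda>_. lborel :: real measure"] by simp
  have space: "space M1 = (\<Pi>\<^sub>E i\<in>I. UNIV)" "space M2 = (\<Pi>\<^sub>E i\<in>I. UNIV)"
    using sets[THEN sets_eq_imp_space_eq] by (simp_all add: space_PiM)
  \<comment> \<open>interpolates between characters (\<open>J = {}\<close>) and indicators of boxes (\<open>J = I\<close>)\<close>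
  define F where "F J A t x = (\<Prod>i\<in>J. indicator (A i) (x i)) * iexp (\<Sum>i\<in>I-J. t i * x i)"
    for J :: "'i set" and A :: "'i \<Rightarrow> real set" and t x :: "'i \<Rightarrow> real"
  have main: "(\<integral>x. F J A t x \<partial>M1) = (\<integral>x. F J A t x \<partial>M2)"
    if "finite J" "J \<subseteq> I" "\<And>i. A i \<in> sets borel" for J A t
    using that
  proof (induction J arbitrary: t rule: finite_induct)
    case empty
    then show ?case unfolding F_def using eq[of t] by (simp only: prod.empty mult_1 Diff_empty)
  next
    case (insert j J)
    have j: "j \<in> I" "J \<subseteq> I" using insert.prems by auto
    define Q where "Q x = (\<Prod>i\<in>J. indicator (A i) (x i)) * iexp (\<Sum>i\<in>I - insert j J. t i * x i)" for x :: "'i \<Rightarrow> real"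
    have F1: "F (insert j J) A t x = Q x * indicator (A j) (x j)" for x
      unfolding F_def Q_def using insert.hyps by (simp add: mult_ac)
    \<comment> \<open>A free frequency s at j brings back the integrand for J, which is why the
      induction keeps t arbitrary.\<close>
    have F2: "F J A (t(j := s)) x = Q x * iexp (s * x j)" for x s
    proof -
      have IJ: "I - J = insert j (I - insert j J)" using j insert.hyps by auto
      have "(\<Sum>i\<in>I - J. (t(j := s)) i * x i) = s * x j + (\<Sum>i\<in>I - insert j J. (t(j := s)) i * x i)"
        by (subst IJ, subst sum.insert) (use I in auto)
      also have "(\<Sum>i\<in>I - insert j J. (t(j := s)) i * x i) = (\<Sum>i\<in>I - insert j J. t i * x i)"
        by (intro sum.cong) auto
      finally show ?thesis
        unfolding F_def Q_def by (simp add: exp_add ring_distribs mult_ac)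
    qed
    have Qm: "Q \<in> borel_measurable (\<Pi>\<^sub>M i\<in>I. lborel)"
      unfolding Q_def
    proof (intro borel_measurable_times borel_measurable_prod)
      fix i assume "i \<in> J"
      then have "i \<in> I" using j by auto
      show "(\<lambda>x. indicator (A i) (x i) :: complex) \<in> borel_measurable (\<Pi>\<^sub>M i\<in>I. lborel)"
        using measurable_compose[OF comp[OF \<open>i \<in> I\<close>] borel_measurable_indicator[OF insert.prems(2)]] .
    next
      have [measurable]: "(\<lambda>x. \<Sum>i\<in>I - insert j J. t i * x i) \<in> borel_measurable (\<Pi>\<^sub>M i\<in>I. lborel)"
        by (intro borel_measurable_sum borel_measurable_times borel_measurable_const comp) auto
      show "(\<lambda>x. iexp (\<Sum>i\<in>I - insert j J. t i * x i)) \<in> borel_measurable (\<Pi>\<^sub>M i\<in>I. lborel)"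
        by measurable
    qed
    have Qb: "cmod (Q x) \<le> 1" for x
    proof -
      have "cmod (\<Prod>i\<in>J. indicator (A i) (x i)) \<le> 1"
        unfolding prod_norm[symmetric] by (intro prod_le_1) (auto split: split_indicator)
      then show ?thesis by (simp add: Q_def norm_mult)
    qed
    show ?case
      unfolding F1
    proof (rule weighted_char_unique[OF P _ _ _ _ Qb])
      show "(\<integral>x. iexp (s * x j) \<partial>M1) = (\<integral>x. iexp (s * x j) \<partial>M2)" for s
      proof -
        have "(\<Sum>i\<in>I. (if i = j then s else 0) * x i) = s * x j" for x :: "'i \<Rightarrow> real"
        proof -
          have "(\<Sum>i\<in>I. (if i = j then s else 0) * x i) = (\<Sum>i\<in>I. if i = j then s * x i else 0)"
            by (intro sum.cong) auto
          then show ?thesis using I j by (simp add: sum.delta)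
        qed
        then show ?thesis using eq[of "\<lambda>i. if i = j then s else 0"] by simp
      qed
      show "(\<integral>x. Q x * iexp (s * x j) \<partial>M1) = (\<integral>x. Q x * iexp (s * x j) \<partial>M2)" for s
        unfolding F2[symmetric] by (rule insert.IH) (use j insert.prems in auto)
    qed (use comp[OF j(1)] Qm insert.prems in \<open>simp_all add: measurable_cong_sets[OF sets(1) refl] measurable_cong_sets[OF sets(2) refl]\<close>)
  qed
  show ?thesis
  proof (rule measure_eqI_PiM_finite[OF I sets])
    fix A assume A0: "\<And>i. i \<in> I \<Longrightarrow> A i \<in> sets (lborel :: real measure)"
    then have A: "(if i \<in> I then A i else {}) \<in> sets borel" for i by auto
    \<comment> \<open>A is unconstrained off I, while \<open>main\<close> asks for measurability at
      every index.\<close>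
    define B where "B i = (if i \<in> I then A i else {})" for i
    have AB: "Pi\<^sub>E I A = Pi\<^sub>E I B" by (auto simp: B_def PiE_def Pi_def)
    have PB: "Pi\<^sub>E I B \<in> sets (\<Pi>\<^sub>M i\<in>I. lborel :: real measure)"
      using A0 by (intro sets_PiM_I_finite I) (auto simp: B_def)
    have F: "F I B (\<lambda>_. 0) x = of_real (indicator (Pi\<^sub>E I B) x)" if "x \<in> (\<Pi>\<^sub>E i\<in>I. UNIV)" for x
      using that I unfolding F_def indicator_def
      by (auto simp: PiE_iff prod.If_cases intro!: prod_zero prod.neutral)
    have "of_real (measure M (Pi\<^sub>E I B)) = (\<integral>x. F I B (\<lambda>_. 0) x \<partial>M)" if "M \<in> {M1, M2}" for M
    proof -
      have "(\<integral>x. F I B (\<lambda>_. 0) x \<partial>M) = (\<integral>x. of_real (indicator (Pi\<^sub>E I B) x) \<partial>M)"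
        using that space by (intro Bochner_Integration.integral_cong refl F) auto
      then show ?thesis using PB sets that by auto
    qed
    moreover have "(\<integral>x. F I B (\<lambda>_. 0) x \<partial>M1) = (\<integral>x. F I B (\<lambda>_. 0) x \<partial>M2)"
      by (rule main) (use I A in \<open>auto simp: B_def\<close>)
    ultimately have "measure M1 (Pi\<^sub>E I B) = measure M2 (Pi\<^sub>E I B)"
      by (metis insertI1 insertI2 of_real_eq_iff)
    then show "emeasure M1 (Pi\<^sub>E I A) = emeasure M2 (Pi\<^sub>E I A)"
      unfolding AB by (simp add: M1.emeasure_eq_measure M2.emeasure_eq_measure)
  next
    show "range (\<lambda>_::nat. (\<Pi>\<^sub>E i\<in>I. UNIV)) \<subseteq> prod_algebra I (\<lambda>_. lborel :: real measure)"
      by (auto intro!: prod_algebraI_finite I)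
  qed (auto simp: space_PiM)
qed

section \<open>Gaussian densities\<close>

definition positive_definite_kernel :: "(nat \<Rightarrow> nat \<Rightarrow> real) \<Rightarrow> bool" where
  "positive_definite_kernel K \<longleftrightarrow> (\<forall>i j. K i j = K j i) \<and>
     (\<forall>n c. (\<exists>i<n. c i \<noteq> 0) \<longrightarrow> (\<Sum>i<n. \<Sum>j<n. c i * c j * K i j) > 0)"

text \<open>The form is evaluated at the prediction error, with coefficients -d and 1. By the choice
  of d the error pairs to 0 with all earlier variables, so what remains is the Schur
  complement.\<close>

lemma schur_complement_pos:
  assumes K: "positive_definite_kernel K" and d: "\<And>j. j < n \<Longrightarrow> (\<Sum>i<n. d i * K i j) = K n j"
  shows "(\<Sum>i<n. d i * K i n) < K n n"
proof -
  define e where "e i = (if i < n then - d i else 1)" for i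
  have e: "(\<Sum>i<Suc n. e i * K i j) = K n j - (\<Sum>i<n. d i * K i j)" for j
    by (simp add: e_def sum_negf)
  have "0 < (\<Sum>i<Suc n. \<Sum>j<Suc n. e i * e j * K i j)"
  proof -
    have "\<exists>i<Suc n. e i \<noteq> 0" by (intro exI[of _ n]) (simp add: e_def)
    then show ?thesis using K unfolding positive_definite_kernel_def by blast
  qed
  also have "\<dots> = (\<Sum>j<Suc n. e j * (\<Sum>i<Suc n. e i * K i j))"
    by (subst sum.swap) (simp add: sum_distrib_left mult_ac del: sum.lessThan_Suc)
  also have "\<dots> = (\<Sum>j<Suc n. e j * (K n j - (\<Sum>i<n. d i * K i j)))"
    unfolding e ..
  also have "\<dots> = K n n - (\<Sum>i<n. d i * K i n)"
    by (simp add: d e_def)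
  finally show ?thesis by simp
qed

text \<open>Elimination by induction on n. A solution c of the first n equations is corrected by t
  times (-d, 1): those equations do not notice this direction, and the last one moves by t times the
  Schur complement \<delta>, which is positive.\<close>

lemma positive_definite_solve:
  assumes K: "positive_definite_kernel K"
  shows "\<exists>c. \<forall>j<n. (\<Sum>i<n. c i * K i j) = v j"
proof (induction n arbitrary: v)
  case (Suc n)
  obtain d where d: "\<And>j. j < n \<Longrightarrow> (\<Sum>i<n. d i * K i j) = K n j" using Suc[of "K n"] by blast
  obtain c where c: "\<And>j. j < n \<Longrightarrow> (\<Sum>i<n. c i * K i j) = v j" using Suc[of v] by blast
  define \<delta> where "\<delta> = K n n - (\<Sum>i<n. d i * K i n)"
  have \<delta>: "\<delta> > 0" unfolding \<delta>_def using schur_complement_pos[OF K d] by simp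
  define t where "t = (v n - (\<Sum>i<n. c i * K i n)) / \<delta>"
  have t: "t * \<delta> = v n - (\<Sum>i<n. c i * K i n)" using \<delta> by (simp add: t_def)
  have sum: "(\<Sum>i<Suc n. (if i < n then c i - t * d i else t) * K i j) =
      (\<Sum>i<n. c i * K i j) - t * (\<Sum>i<n. d i * K i j) + t * K n j" for j
    by (simp add: left_diff_distrib sum_subtractf sum_distrib_left mult.assoc)
  show ?case
  proof (intro exI allI impI)
    fix j assume "j < Suc n"
    then consider "j < n" | "j = n" by linarith
    then show "(\<Sum>i<Suc n. (if i < n then c i - t * d i else t) * K i j) = v j"
    proof cases
      case 1
      then show ?thesis unfolding sum c[OF 1] d[OF 1] by simp
    next
      case 2
      then show ?thesis unfolding sum using t by (simp add: \<delta>_def algebra_simps)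
    qed
  qed
qed simp

text \<open>\<open>innovations K b s\<close>: the best linear prediction of the \<open>k\<close>-th variable by its predecessors has
  coefficients \<open>b k\<close> and mean square error \<open>s k\<close>.\<close>

definition innovations :: "(nat \<Rightarrow> nat \<Rightarrow> real) \<Rightarrow> (nat \<Rightarrow> nat \<Rightarrow> real) \<Rightarrow> (nat \<Rightarrow> real) \<Rightarrow> bool" where
  "innovations K b s \<longleftrightarrow>
     (\<forall>n. \<forall>j<n. (\<Sum>i<n. b n i * K i j) = K n j) \<and>
     (\<forall>n. s n = K n n - (\<Sum>i<n. b n i * K i n) \<and> s n > 0)"

lemma innovations_pos: "innovations K b s \<Longrightarrow> s k > 0"
  unfolding innovations_def by blast

lemma innovations_exist:
  assumes K: "positive_definite_kernel K"
  obtains b s where "innovations K b s"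
proof -
  have "\<forall>n. \<exists>c. \<forall>j<n. (\<Sum>i<n. c i * K i j) = K n j"
    using positive_definite_solve[OF K] by blast
  then obtain b where "\<forall>n. \<forall>j<n. (\<Sum>i<n. b n i * K i j) = K n j"
    by (rule choice[THEN exE])
  then have b: "\<And>n j. j < n \<Longrightarrow> (\<Sum>i<n. b n i * K i j) = K n j" by blast
  have "innovations K b (\<lambda>n. K n n - (\<Sum>i<n. b n i * K i n))"
    unfolding innovations_def using b schur_complement_pos[OF K b] by (simp only: diff_gt_0_iff_gt) blast
  then show ?thesis by (rule that)
qed

text \<open>Completing the square. The last variable is split into its prediction and an error
  orthogonal to the predecessors: the prediction shifts \<open>t i\<close> by
  \<open>t n * b n i\<close>, and the error contributes (t n)^2 times its variance.\<close>

lemma innovations_quadratic_form: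
  assumes K: "positive_definite_kernel K" and I: "innovations K b s"
  shows "(\<Sum>i<Suc n. \<Sum>j<Suc n. t i * t j * K i j) =
    (\<Sum>i<n. \<Sum>j<n. (t i + t n * b n i) * (t j + t n * b n j) * K i j) + (t n)\<^sup>2 * s n"
proof -
  have sym: "K i j = K j i" for i j using K by (auto simp: positive_definite_kernel_def)
  have b: "(\<Sum>i<n. b n i * K i j) = K n j" if "j < n" for j using I that by (simp add: innovations_def)
  have s: "s n = K n n - (\<Sum>i<n. b n i * K i n)" using I by (simp add: innovations_def)
  have b2: "(\<Sum>i<n. \<Sum>j<n. t i * b n j * K i j) = (\<Sum>i<n. t i * K i n)"
  proof (intro sum.cong refl)
    fix i assume "i \<in> {..<n}"
    then show "(\<Sum>j<n. t i * b n j * K i j) = t i * K i n"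
      using b[of i] by (simp add: sym[of i] mult.assoc flip: sum_distrib_left)
  qed
  have b1: "(\<Sum>i<n. \<Sum>j<n. b n i * t j * K i j) = (\<Sum>i<n. t i * K i n)"
    unfolding b2[symmetric] by (subst sum.swap) (intro sum.cong refl, simp add: sym[of i j for i j] mult_ac)
  have b3: "(\<Sum>i<n. \<Sum>j<n. b n i * b n j * K i j) = (\<Sum>i<n. b n i * K i n)"
  proof -
    have "(\<Sum>i<n. \<Sum>j<n. b n i * b n j * K i j) = (\<Sum>j<n. b n j * (\<Sum>i<n. b n i * K i j))"
      by (subst sum.swap) (simp add: sum_distrib_left mult_ac)
    also have "\<dots> = (\<Sum>j<n. b n j * K j n)"
      by (intro sum.cong refl) (simp add: b sym[of n])
    finally show ?thesis .
  qed
  have expand: "(t i + t n * b n i) * (t j + t n * b n j) * K i j = t i * t j * K i j + t n * (t i * b n j * K i j)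
      + t n * (b n i * t j * K i j) + (t n)\<^sup>2 * (b n i * b n j * K i j)" for i j
    by (simp add: algebra_simps power2_eq_square)
  have "(\<Sum>i<n. \<Sum>j<n. (t i + t n * b n i) * (t j + t n * b n j) * K i j) =
    (\<Sum>i<n. \<Sum>j<n. t i * t j * K i j) + t n * (\<Sum>i<n. \<Sum>j<n. t i * b n j * K i j)
    + t n * (\<Sum>i<n. \<Sum>j<n. b n i * t j * K i j) + (t n)\<^sup>2 * (\<Sum>i<n. \<Sum>j<n. b n i * b n j * K i j)"
    by (simp only: expand sum.distrib sum_distrib_left)
  also have "\<dots> = (\<Sum>i<n. \<Sum>j<n. t i * t j * K i j) + 2 * t n * (\<Sum>i<n. t i * K i n)
      + (t n)\<^sup>2 * (K n n - s n)"
    unfolding b1 b2 b3 s by simp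
  finally have 1: "(\<Sum>i<n. \<Sum>j<n. (t i + t n * b n i) * (t j + t n * b n j) * K i j) =
    (\<Sum>i<n. \<Sum>j<n. t i * t j * K i j) + 2 * t n * (\<Sum>i<n. t i * K i n) + (t n)\<^sup>2 * (K n n - s n)" .
  have row: "(\<Sum>j<n. t n * t j * K n j) = t n * (\<Sum>i<n. t i * K i n)"
    unfolding sum_distrib_left by (intro sum.cong refl) (simp add: sym[of n])
  have col: "(\<Sum>i<n. t i * t n * K i n) = t n * (\<Sum>i<n. t i * K i n)"
    unfolding sum_distrib_left by (intro sum.cong refl) simp
  have "(\<Sum>i<Suc n. \<Sum>j<Suc n. t i * t j * K i j) = (\<Sum>i<n. \<Sum>j<n. t i * t j * K i j) +
      (\<Sum>i<n. t i * t n * K i n) + (\<Sum>j<n. t n * t j * K n j) + t n * t n * K n n"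
    by (simp add: sum.distrib)
  then have 2: "(\<Sum>i<Suc n. \<Sum>j<Suc n. t i * t j * K i j) =
    (\<Sum>i<n. \<Sum>j<n. t i * t j * K i j) + 2 * t n * (\<Sum>i<n. t i * K i n) + (t n)\<^sup>2 * K n n"
    unfolding row col by (simp only: power2_eq_square mult_2 mult.assoc ring_distribs add_ac)
  show ?thesis unfolding 1 2 by (simp add: algebra_simps)
qed

text \<open>The \<open>k\<close>-th factor is the conditional density of the \<open>k\<close>-th variable given its predecessors.\<close>

definition gaussian_density :: "(nat \<Rightarrow> nat \<Rightarrow> real) \<Rightarrow> (nat \<Rightarrow> real) \<Rightarrow> nat \<Rightarrow> (nat \<Rightarrow> real) \<Rightarrow> real" where
  "gaussian_density b s n x = (\<Prod>k<n. normal_density (\<Sum>j<k. b k j * x j) (sqrt (s k)) (x k))"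

section \<open>Total mass, characteristic function and law of the Gaussian density\<close>

lemma lebesgue_pow_component:
  "i < n \<Longrightarrow> (\<lambda>x. x i) \<in> borel_measurable (lebesgue_pow n)"
  using measurable_component_singleton[of i "{..<n}" "\<lambda>_. lborel :: real measure"] by simp

lemma gaussian_density_measurable [measurable]:
  "gaussian_density b s n \<in> borel_measurable (lebesgue_pow n)"
  unfolding gaussian_density_def normal_density_def
proof (intro borel_measurable_prod borel_measurable_times borel_measurable_const)
  fix k assume "k \<in> {..<n}"
  then have [measurable]: "(\<lambda>x. x k) \<in> borel_measurable (lebesgue_pow n)"
    "(\<lambda>x. \<Sum>j<k. b k j * x j) \<in> borel_measurable (lebesgue_pow n)"
    by (auto intro!: lebesgue_pow_component borel_measurable_sum borel_measurable_times)
  show "(\<lambda>x. exp (- (x k - (\<Sum>j<k. b k j * x j))\<^sup>2 / (2 * (sqrt (s k))\<^sup>2))) \<in> borel_measurable (lebesgue_pow n)"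
    by measurable
qed

lemma gaussian_density_pos:
  assumes "\<And>k. s k > 0" shows "0 < gaussian_density b s n x"
  unfolding gaussian_density_def by (intro prod_pos ballI normal_density_pos) (use assms in simp)

lemma gaussian_density_Suc_upd:
  "gaussian_density b s (Suc n) (x(n := y)) =
     gaussian_density b s n x * normal_density (\<Sum>j<n. b n j * x j) (sqrt (s n)) y"
proof -
  have "(\<Sum>j<k. b k j * (x(n := y)) j) = (\<Sum>j<k. b k j * x j)" if "k \<le> n" for k
    using that by (intro sum.cong) auto
  then show ?thesis by (simp add: gaussian_density_def)
qed

interpretation lborel_pow: product_sigma_finite "\<lambda>_::nat. lborel :: real measure"
  by unfold_locales

lemma nn_integral_gaussian_density:
  assumes s: "\<And>k. s k > 0"
  shows "(\<integral>\<^sup>+x. ennreal (gaussian_density b s n x) \<partial>lebesgue_pow n) = 1"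
proof (induction n)
  case 0
  then show ?case by (simp add: gaussian_density_def PiM_empty)
next
  case (Suc n)
  have "(\<integral>\<^sup>+x. ennreal (gaussian_density b s (Suc n) x) \<partial>lebesgue_pow (Suc n)) =
    (\<integral>\<^sup>+x. (\<integral>\<^sup>+y. ennreal (gaussian_density b s (Suc n) (x(n := y))) \<partial>lborel) \<partial>lebesgue_pow n)"
    unfolding lessThan_Suc
    using gaussian_density_measurable[of b s "Suc n"]
    by (intro lborel_pow.product_nn_integral_insert) (auto simp: lessThan_Suc)
  also have "\<dots> = (\<integral>\<^sup>+x. ennreal (gaussian_density b s n x) \<partial>lebesgue_pow n)"
  proof (intro nn_integral_cong)
    fix x
    have "(\<integral>\<^sup>+y. ennreal (normal_density (\<Sum>j<n. b n j * x j) (sqrt (s n)) y) \<partial>lborel) = 1"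
      using s[of n] by (subst nn_integral_eq_integral) auto
    then show "(\<integral>\<^sup>+y. ennreal (gaussian_density b s (Suc n) (x(n := y))) \<partial>lborel) = ennreal (gaussian_density b s n x)"
      using gaussian_density_pos[of s b n x, OF s]
      by (simp add: gaussian_density_Suc_upd ennreal_mult nn_integral_cmult)
  qed
  finally show ?case using Suc by simp
qed

lemma prob_space_gaussian_density:
  assumes s: "\<And>k. s k > 0"
  shows "prob_space (density (lebesgue_pow n) (\<lambda>x. ennreal (gaussian_density b s n x)))"
  by (rule prob_spaceI) (subst emeasure_density, auto simp: nn_integral_gaussian_density[OF s] intro!: trans[OF nn_integral_cong nn_integral_gaussian_density[OF s]])

lemma normal_density_char:
  assumes "\<sigma> > 0"
  shows "(\<integral>x. of_real (normal_density \<mu> \<sigma> x) * iexp (t * x) \<partial>lborel) =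
    iexp (t * \<mu>) * of_real (exp (- (t\<^sup>2 * \<sigma>\<^sup>2) / 2))"
proof -
  have std: "(\<integral>x. of_real (std_normal_density x) * iexp (u * x) \<partial>lborel) = of_real (exp (- u\<^sup>2 / 2))" for u
  proof -
    have "of_real (exp (- u\<^sup>2 / 2)) = char std_normal_distribution u"
      by (simp add: char_std_normal_distribution)
    also have "\<dots> = (\<integral>x. std_normal_density x *\<^sub>R iexp (u * x) \<partial>lborel)"
      unfolding char_def by (subst integral_density) auto
    finally show ?thesis by (simp add: scaleR_conv_of_real)
  qed
  have "(\<integral>x. of_real (normal_density \<mu> \<sigma> x) * iexp (t * x) \<partial>lborel) =
     \<bar>\<sigma>\<bar> *\<^sub>R (\<integral>x. of_real (normal_density \<mu> \<sigma> (\<mu> + \<sigma> * x)) * iexp (t * (\<mu> + \<sigma> * x)) \<partial>lborel)"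
    using assms by (intro lborel_integral_real_affine) simp
  also have "\<dots> = (\<integral>x. iexp (t * \<mu>) * (of_real (std_normal_density x) * iexp (t * \<sigma> * x)) \<partial>lborel)"
  proof -
    have "\<sigma> * normal_density \<mu> \<sigma> (\<mu> + \<sigma> * x) = std_normal_density x" for x
      using assms by (simp add: normal_density_def real_sqrt_mult power_mult_distrib)
    then have "complex_of_real \<sigma> * complex_of_real (normal_density \<mu> \<sigma> (\<mu> + \<sigma> * x)) = of_real (std_normal_density x)" for x
      by (metis of_real_mult)
    then have "\<sigma> *\<^sub>R (of_real (normal_density \<mu> \<sigma> (\<mu> + \<sigma> * x)) * iexp (t * (\<mu> + \<sigma> * x))) =
      iexp (t * \<mu>) * (of_real (std_normal_density x) * iexp (t * \<sigma> * x))" for x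
      by (simp only: scaleR_conv_of_real ring_distribs exp_add of_real_add mult.assoc[symmetric])
        (simp only: mult_ac)
    then show ?thesis using assms by (simp flip: integral_scaleR_right)
  qed
  also have "\<dots> = iexp (t * \<mu>) * of_real (exp (- (t * \<sigma>)\<^sup>2 / 2))"
    using std[of "t * \<sigma>"] by simp
  finally show ?thesis by (simp add: power_mult_distrib)
qed

text \<open>The last coordinate is normal around its prediction. Integrating it out shifts the other
  frequencies by \<open>t n * b n i\<close> and leaves a factor with exponent -(t n)^2 s n / 2. This
  is the recursion of \<open>innovations_quadratic_form\<close>; as the frequencies change, t is
  kept arbitrary.\<close>

lemma gaussian_density_char:
  assumes K: "positive_definite_kernel K" and I: "innovations K b s"
  shows "(\<integral>x. of_real (gaussian_density b s n x) * iexp (\<Sum>i<n. t i * x i) \<partial>lebesgue_pow n) =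
    of_real (exp (- (\<Sum>i<n. \<Sum>j<n. t i * t j * K i j) / 2))"
proof (induction n arbitrary: t)
  case 0
  have "prob_space (lebesgue_pow 0)" by (rule prob_spaceI) (simp add: PiM_empty)
  then show ?case by (simp add: gaussian_density_def prob_space.prob_space)
next
  case (Suc n)
  have s: "s k > 0" for k by (rule innovations_pos[OF I])
  let ?f = "\<lambda>x. complex_of_real (gaussian_density b s (Suc n) x) * iexp (\<Sum>i<Suc n. t i * x i)"
  have tm: "(\<lambda>x. \<Sum>i<Suc n. t i * x i) \<in> borel_measurable (lebesgue_pow (Suc n))"
    by (intro borel_measurable_sum borel_measurable_times borel_measurable_const lebesgue_pow_component) auto
  have fm: "?f \<in> borel_measurable (lebesgue_pow (Suc n))"
    using tm gaussian_density_measurable[of b s "Suc n"] by measurable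
  have fi: "integrable (lebesgue_pow (Suc n)) ?f"
  proof (rule integrableI_bounded[OF fm])
    have "(\<integral>\<^sup>+x. ennreal (norm (?f x)) \<partial>lebesgue_pow (Suc n)) =
        (\<integral>\<^sup>+x. ennreal (gaussian_density b s (Suc n) x) \<partial>lebesgue_pow (Suc n))"
      using gaussian_density_pos[of s b "Suc n", OF s]
      by (intro nn_integral_cong) (simp add: norm_mult abs_of_pos del: sum.lessThan_Suc)
    then show "(\<integral>\<^sup>+x. ennreal (norm (?f x)) \<partial>lebesgue_pow (Suc n)) < \<infinity>"
      by (simp add: nn_integral_gaussian_density[OF s])
  qed
  have inner: "(\<integral>y. ?f (x(n := y)) \<partial>lborel) =
      of_real (exp (- ((t n)\<^sup>2 * s n) / 2)) *
      (of_real (gaussian_density b s n x) * iexp (\<Sum>i<n. (t i + t n * b n i) * x i))" for x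
  proof -
    define m where "m = (\<Sum>j<n. b n j * x j)"
    have "(\<Sum>i<Suc n. t i * (x(n := y)) i) = (\<Sum>i<n. t i * x i) + t n * y" for y
      by simp
    then have "?f (x(n := y)) = of_real (gaussian_density b s n x) * iexp (\<Sum>i<n. t i * x i) *
        (of_real (normal_density m (sqrt (s n)) y) * iexp (t n * y))" for y
      unfolding gaussian_density_Suc_upd m_def[symmetric]
      by (simp only: of_real_mult of_real_add ring_distribs exp_add mult_ac)
    then have "(\<integral>y. ?f (x(n := y)) \<partial>lborel) = of_real (gaussian_density b s n x) * iexp (\<Sum>i<n. t i * x i) *
        (\<integral>y. of_real (normal_density m (sqrt (s n)) y) * iexp (t n * y) \<partial>lborel)"
      by (simp only: integral_mult_right_zero)
    also have "(\<integral>y. of_real (normal_density m (sqrt (s n)) y) * iexp (t n * y) \<partial>lborel) =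
        iexp (t n * m) * of_real (exp (- ((t n)\<^sup>2 * s n) / 2))"
      using s[of n] by (subst normal_density_char) auto
    also have "of_real (gaussian_density b s n x) * iexp (\<Sum>i<n. t i * x i) * \<dots> =
        of_real (exp (- ((t n)\<^sup>2 * s n) / 2)) *
        (of_real (gaussian_density b s n x) * (iexp (\<Sum>i<n. t i * x i) * iexp (t n * m)))"
      by (simp only: mult_ac)
    also have "iexp (\<Sum>i<n. t i * x i) * iexp (t n * m) = iexp (\<Sum>i<n. (t i + t n * b n i) * x i)"
    proof -
      have "(\<Sum>i<n. (t i + t n * b n i) * x i) = (\<Sum>i<n. t i * x i) + t n * m"
        by (simp add: m_def sum_distrib_left ring_distribs sum.distrib mult_ac)
      then show ?thesis by (simp only: of_real_add ring_distribs exp_add)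
    qed
    finally show ?thesis .
  qed
  have "(\<integral>x. ?f x \<partial>lebesgue_pow (Suc n)) = (\<integral>x. (\<integral>y. ?f (x(n := y)) \<partial>lborel) \<partial>lebesgue_pow n)"
    using fi unfolding lessThan_Suc[of n] by (intro lborel_pow.product_integral_insert) auto
  also have "\<dots> = of_real (exp (- ((t n)\<^sup>2 * s n) / 2)) *
      (\<integral>x. of_real (gaussian_density b s n x) * iexp (\<Sum>i<n. (t i + t n * b n i) * x i) \<partial>lebesgue_pow n)"
    unfolding inner by (rule integral_mult_right_zero)
  also have "\<dots> = of_real (exp (- ((t n)\<^sup>2 * s n) / 2)) *
      of_real (exp (- (\<Sum>i<n. \<Sum>j<n. (t i + t n * b n i) * (t j + t n * b n j) * K i j) / 2))"
    unfolding Suc ..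
  also have "\<dots> = of_real (exp (- ((\<Sum>i<n. \<Sum>j<n. (t i + t n * b n i) * (t j + t n * b n j) * K i j) + (t n)\<^sup>2 * s n) / 2))"
    by (simp flip: of_real_mult exp_add add: add_divide_distrib)
  finally show ?case unfolding innovations_quadratic_form[OF K I] .
qed

lemma gaussian_law:
  fixes Z :: "nat \<Rightarrow> 'a \<Rightarrow> real"
  assumes K: "positive_definite_kernel K" and I: "innovations K b s"
    and M: "prob_space M" and Z: "\<And>i. Z i \<in> borel_measurable M"
    and char: "\<And>t. (\<integral>\<omega>. iexp (\<Sum>i<n. t i * Z i \<omega>) \<partial>M) = of_real (exp (- (\<Sum>i<n. \<Sum>j<n. t i * t j * K i j) / 2))"
  shows "distr M (lebesgue_pow n) (\<lambda>\<omega>. \<lambda>i\<in>{..<n}. Z i \<omega>) =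
    density (lebesgue_pow n) (\<lambda>x. ennreal (gaussian_density b s n x))"
proof -

  let ?L = "distr M (lebesgue_pow n) (\<lambda>\<omega>. \<lambda>i\<in>{..<n}. Z i \<omega>)" and ?D = "density (lebesgue_pow n) (\<lambda>x. ennreal (gaussian_density b s n x))"  have s: "s k > 0" for k by (rule innovations_pos[OF I])
  have Zm: "(\<lambda>\<omega>. \<lambda>i\<in>{..<n}. Z i \<omega>) \<in> measurable M (lebesgue_pow n)"
    by (rule measurable_restrict) (use Z in simp)
  have tm: "(\<lambda>x. \<Sum>i<n. t i * x i) \<in> borel_measurable (lebesgue_pow n)" for t
    by (intro borel_measurable_sum borel_measurable_times borel_measurable_const lebesgue_pow_component) auto
  then have im: "(\<lambda>x. iexp (\<Sum>i<n. t i * x i)) \<in> borel_measurable (lebesgue_pow n)" for t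
    by measurable
  show ?thesis
  proof (rule PiM_char_unique)
    show "prob_space ?L"
      by (rule prob_space.prob_space_distr[OF M Zm])
    show "prob_space ?D"
      by (rule prob_space_gaussian_density[OF s])
    fix t
    have "(\<integral>x. iexp (\<Sum>i<n. t i * x i) \<partial>?L) =
      (\<integral>\<omega>. iexp (\<Sum>i<n. t i * Z i \<omega>) \<partial>M)"
      by (subst integral_distr[OF Zm im]) simp
    also have "\<dots> = (\<integral>x. of_real (gaussian_density b s n x) * iexp (\<Sum>i<n. t i * x i) \<partial>lebesgue_pow n)"
      unfolding char gaussian_density_char[OF K I] ..
    also have "\<dots> = (\<integral>x. iexp (\<Sum>i<n. t i * x i) \<partial>?D)"
      using im gaussian_density_pos[of s, OF s]
      by (subst integral_density) (auto simp: scaleR_conv_of_real less_imp_le)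
    finally show "(\<integral>x. iexp (\<Sum>i<n. t i * x i) \<partial>?L) =
      (\<integral>x. iexp (\<Sum>i<n. t i * x i) \<partial>?D)" .
  qed auto
qed

section \<open>Entropy of a stationary Gaussian process\<close>

text \<open>An almost surely constant variable also counts as Gaussian; mean 0 makes it vanish, and
  the formula holds with variance 0. Otherwise the mean parameter of the density is 0.\<close>

lemma gaussian_rv_centered:
  assumes M: "prob_space M" and T: "gaussian_rv M T" and mean: "(\<integral>\<omega>. T \<omega> \<partial>M) = 0"
  shows "integrable M (\<lambda>\<omega>. (T \<omega>)\<^sup>2)"
    "(\<integral>\<omega>. iexp (t * T \<omega>) \<partial>M) = of_real (exp (- (t\<^sup>2 * (\<integral>\<omega>. (T \<omega>)\<^sup>2 \<partial>M)) / 2))"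
proof -
  interpret prob_space M by fact
  have Tm [measurable]: "T \<in> borel_measurable M" using T by (simp add: gaussian_rv_def)
  have "integrable M (\<lambda>\<omega>. (T \<omega>)\<^sup>2) \<and>
    (\<integral>\<omega>. iexp (t * T \<omega>) \<partial>M) = of_real (exp (- (t\<^sup>2 * (\<integral>\<omega>. (T \<omega>)\<^sup>2 \<partial>M)) / 2))"
    using T unfolding gaussian_rv_def
  proof (elim conjE disjE exE)
    fix m assume m: "AE \<omega> in M. T \<omega> = m"
    have "(\<integral>\<omega>. T \<omega> \<partial>M) = (\<integral>\<omega>. m \<partial>M)" using m by (intro integral_cong_AE) auto
    then have T0: "AE \<omega> in M. T \<omega> = 0" using m mean by (simp add: prob_space)
    have i: "integrable M (\<lambda>\<omega>. (T \<omega>)\<^sup>2) = integrable M (\<lambda>\<omega>. 0::real)"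
      using T0 by (intro integrable_cong_AE) auto
    have 1: "(\<integral>\<omega>. (T \<omega>)\<^sup>2 \<partial>M) = (\<integral>\<omega>. 0 \<partial>M)" using T0 by (intro integral_cong_AE) auto
    have 2: "(\<integral>\<omega>. iexp (t * T \<omega>) \<partial>M) = (\<integral>\<omega>. 1 \<partial>M)" using T0 by (intro integral_cong_AE) auto
    show ?thesis unfolding i 1 2 by (simp add: prob_space)
  next
    fix m s assume s: "0 < s" and D: "distributed M lborel T (\<lambda>x. ennreal (normal_density m s x))"
    have "m = 0" using normal_distributed_expectation[OF s D] mean by simp
    have "integrable lborel (\<lambda>x. normal_density m s x * x\<^sup>2)"
      using integrable_normal_moment[of s m 2] s \<open>m = 0\<close> by simp
    then have i: "integrable M (\<lambda>\<omega>. (T \<omega>)\<^sup>2)"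
      by (subst (asm) distributed_integrable[OF D]) auto
    have v: "(\<integral>\<omega>. (T \<omega>)\<^sup>2 \<partial>M) = s\<^sup>2"
      using normal_distributed_variance[OF s D] mean by simp
    have "(\<integral>\<omega>. iexp (t * T \<omega>) \<partial>M) = (\<integral>x. iexp (t * x) \<partial>distr M lborel T)"
      by (subst integral_distr) auto
    also have "distr M lborel T = density lborel (\<lambda>x. ennreal (normal_density m s x))"
      by (rule distributed_distr_eq_density[OF D])
    also have "(\<integral>x. iexp (t * x) \<partial>density lborel (\<lambda>x. ennreal (normal_density m s x))) =
        (\<integral>x. of_real (normal_density m s x) * iexp (t * x) \<partial>lborel)"
      by (subst integral_density) (auto simp: scaleR_conv_of_real)
    also have "\<dots> = of_real (exp (- (t\<^sup>2 * s\<^sup>2) / 2))"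
      using normal_density_char[OF s, of m t] \<open>m = 0\<close> by simp
    finally show ?thesis using i v by simp
  qed
  then show "integrable M (\<lambda>\<omega>. (T \<omega>)\<^sup>2)"
    "(\<integral>\<omega>. iexp (t * T \<omega>) \<partial>M) = of_real (exp (- (t\<^sup>2 * (\<integral>\<omega>. (T \<omega>)\<^sup>2 \<partial>M)) / 2))"
    by auto
qed

lemma integrable_mult_square:
  fixes f g :: "'a \<Rightarrow> real"
  assumes "f \<in> borel_measurable M" "g \<in> borel_measurable M"
    and "integrable M (\<lambda>x. (f x)\<^sup>2)" "integrable M (\<lambda>x. (g x)\<^sup>2)"
  shows "integrable M (\<lambda>x. f x * g x)"
proof (rule Bochner_Integration.integrable_bound)
  show "integrable M (\<lambda>x. (f x)\<^sup>2 + (g x)\<^sup>2)" using assms by simp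
  show "AE x in M. norm (f x * g x) \<le> norm ((f x)\<^sup>2 + (g x)\<^sup>2)"
  proof (intro AE_I2)
    fix x
    have "2 * (\<bar>f x\<bar> * \<bar>g x\<bar>) \<le> (f x)\<^sup>2 + (g x)\<^sup>2"
      using sum_squares_bound[of "\<bar>f x\<bar>" "\<bar>g x\<bar>"] by simp
    moreover have "0 \<le> \<bar>f x\<bar> * \<bar>g x\<bar>" by simp
    ultimately have "\<bar>f x\<bar> * \<bar>g x\<bar> \<le> (f x)\<^sup>2 + (g x)\<^sup>2" by linarith
    then show "norm (f x * g x) \<le> norm ((f x)\<^sup>2 + (g x)\<^sup>2)" by (simp add: abs_mult)
  qed
qed (use assms in auto)

locale stationary_gaussian_process = prob_space M for M :: "'a measure" +
  fixes Z :: "int \<Rightarrow> 'a \<Rightarrow> real"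
  assumes stationary_gaussian: "stationary_gaussian M Z"
begin

lemma Z_measurable [measurable]: "Z n \<in> borel_measurable M"
  using stationary_gaussian by (simp add: stationary_gaussian_def stationary_def)

lemma Z_integrable: "integrable M (Z n)" and Z_mean: "(\<integral>\<omega>. Z n \<omega> \<partial>M) = 0"
  using stationary_gaussian by (auto simp: stationary_gaussian_def centered_def)

lemma combination_gaussian: "finite J \<Longrightarrow> gaussian_rv M (\<lambda>\<omega>. \<Sum>j\<in>J. c j * Z j \<omega>)"
  using stationary_gaussian by (simp add: stationary_gaussian_def gaussian_process_def)

lemma combination_mean: "(\<integral>\<omega>. (\<Sum>j\<in>J. c j * Z j \<omega>) \<partial>M) = 0"
  using Z_integrable Z_mean by (simp add: Bochner_Integration.integral_sum)

lemma Z_square_integrable: "integrable M (\<lambda>\<omega>. (Z n \<omega>)\<^sup>2)"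
  using gaussian_rv_centered(1)[OF prob_space_axioms combination_gaussian combination_mean, of "{n}" "\<lambda>_. 1"]
  by simp

lemma Z_mult_integrable: "integrable M (\<lambda>\<omega>. Z i \<omega> * Z j \<omega>)"
  by (intro integrable_mult_square Z_measurable Z_square_integrable)

lemma covariance_eq: "(\<integral>\<omega>. Z i \<omega> * Z j \<omega> \<partial>M) = covariance M Z (i - j)"
proof -
  let ?P = "\<Pi>\<^sub>M n\<in>(UNIV :: int set). (borel :: real measure)"
  have shift: "distr M ?P (\<lambda>\<omega> n. Z (n + j) \<omega>) = distr M ?P (\<lambda>\<omega> n. Z n \<omega>)"
    using stationary_gaussian by (simp add: stationary_gaussian_def stationary_def)
  have f: "(\<lambda>x. x (i - j) * x 0) \<in> borel_measurable ?P"
    by (intro borel_measurable_times measurable_component_singleton) auto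
  have m: "(\<lambda>\<omega> n. Z (n + k) \<omega>) \<in> measurable M ?P" for k
    by (intro measurable_PiM_single') (auto simp: PiE_iff)
  have "(\<integral>\<omega>. Z i \<omega> * Z j \<omega> \<partial>M) = (\<integral>x. x (i - j) * x 0 \<partial>distr M ?P (\<lambda>\<omega> n. Z (n + j) \<omega>))"
    by (subst integral_distr[OF m f]) simp
  also have "\<dots> = (\<integral>\<omega>. Z (i - j) \<omega> * Z 0 \<omega> \<partial>M)"
    unfolding shift using m[of 0] by (subst integral_distr[OF _ f]) auto
  finally show ?thesis by (simp add: covariance_def)
qed

lemma covariance_minus: "covariance M Z (- n) = covariance M Z n"
proof -
  have "covariance M Z (0 - n) = (\<integral>\<omega>. Z 0 \<omega> * Z n \<omega> \<partial>M)" by (rule covariance_eq[symmetric])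
  also have "\<dots> = covariance M Z n" by (simp add: covariance_def mult.commute)
  finally show ?thesis by simp
qed

lemma covariance_commute: "covariance M Z (i - j) = covariance M Z (j - i)"
  using covariance_minus[of "i - j"] by simp

lemma combination_variance:
  "(\<integral>\<omega>. (\<Sum>i\<in>J. c i * Z (h i) \<omega>)\<^sup>2 \<partial>M) = (\<Sum>i\<in>J. \<Sum>j\<in>J. c i * c j * covariance M Z (h i - h j))"
proof -
  have "(\<Sum>i\<in>J. c i * Z (h i) \<omega>)\<^sup>2 = (\<Sum>i\<in>J. \<Sum>j\<in>J. c i * c j * (Z (h i) \<omega> * Z (h j) \<omega>))" for \<omega>
    by (simp add: power2_eq_square sum_product mult_ac)
  then show ?thesis
    using Z_mult_integrable by (simp add: covariance_eq Bochner_Integration.integral_sum)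
qed

definition kernel :: "nat \<Rightarrow> nat \<Rightarrow> real" where
  "kernel i j = covariance M Z (int i - int j)"

lemma kernel_positive_definite: "positive_definite_kernel kernel"
  unfolding positive_definite_kernel_def
proof (intro conjI allI impI)
  show "kernel i j = kernel j i" for i j
    by (simp add: kernel_def covariance_commute)
  fix n and c :: "nat \<Rightarrow> real" assume "\<exists>i<n. c i \<noteq> 0"
  then have "\<exists>j\<in>int ` {..<n}. c (nat j) \<noteq> 0" by auto
  then have "0 < (\<Sum>i\<in>int ` {..<n}. \<Sum>j\<in>int ` {..<n}. c (nat i) * c (nat j) * covariance M Z (i - j))"
    using stationary_gaussian unfolding stationary_gaussian_def strictly_positive_definite_def by simp
  then show "0 < (\<Sum>i<n. \<Sum>j<n. c i * c j * kernel i j)"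
    by (simp add: sum.reindex kernel_def)
qed

lemma combination_char:
  "(\<integral>\<omega>. iexp (\<Sum>i<n. t i * Z (int i) \<omega>) \<partial>M) = of_real (exp (- (\<Sum>i<n. \<Sum>j<n. t i * t j * kernel i j) / 2))"
proof -
  have eq: "(\<Sum>j\<in>int ` {..<n}. t (nat j) * Z j \<omega>) = (\<Sum>i<n. t i * Z (int i) \<omega>)" for \<omega>
    by (simp add: sum.reindex)
  have "gaussian_rv M (\<lambda>\<omega>. \<Sum>i<n. t i * Z (int i) \<omega>)" "(\<integral>\<omega>. (\<Sum>i<n. t i * Z (int i) \<omega>) \<partial>M) = 0"
    using combination_gaussian[of "int ` {..<n}" "\<lambda>j. t (nat j)"] combination_mean[of "\<lambda>j. t (nat j)" "int ` {..<n}"]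
    unfolding eq by auto
  from gaussian_rv_centered(2)[OF prob_space_axioms this, of 1] show ?thesis
    by (simp only: combination_variance kernel_def[symmetric] mult_1 power_one)
qed

definition b where "b = (SOME b. \<exists>s. innovations kernel b s)"
definition s where "s = (SOME s. innovations kernel b s)"

lemma innovations_b_s: "innovations kernel b s"
proof -
  have "\<exists>b s. innovations kernel b s"
    using innovations_exist[OF kernel_positive_definite] by metis
  then have "\<exists>s. innovations kernel b s" unfolding b_def by (rule someI_ex)
  then show ?thesis unfolding s_def by (rule someI_ex)
qed

lemma s_pos: "s k > 0"
  by (rule innovations_pos[OF innovations_b_s])

abbreviation path :: "nat \<Rightarrow> 'a \<Rightarrow> nat \<Rightarrow> real" where
  "path n \<omega> \<equiv> \<lambda>i\<in>{..<n}. Z (int i) \<omega>"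

lemma joint_law:
  "distr M (lebesgue_pow n) (path n) =
    density (lebesgue_pow n) (\<lambda>x. ennreal (gaussian_density b s n x))"
  by (rule gaussian_law[OF kernel_positive_definite innovations_b_s prob_space_axioms Z_measurable combination_char])

lemma innovation_variance:
  "(\<integral>\<omega>. (Z (int n) \<omega> - (\<Sum>j<n. b n j * Z (int j) \<omega>))\<^sup>2 \<partial>M) = s n"
proof -
  define t where "t i = (if i < n then - b n i else 1)" for i
  have "Z (int n) \<omega> - (\<Sum>j<n. b n j * Z (int j) \<omega>) = (\<Sum>i<Suc n. t i * Z (int i) \<omega>)" for \<omega>
    by (simp add: t_def sum_negf)
  then have "(\<integral>\<omega>. (Z (int n) \<omega> - (\<Sum>j<n. b n j * Z (int j) \<omega>))\<^sup>2 \<partial>M) = (\<Sum>i<Suc n. \<Sum>j<Suc n. t i * t j * kernel i j)"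
    by (simp only: combination_variance kernel_def)
  also have "\<dots> = (\<Sum>i<n. \<Sum>j<n. (t i + t n * b n i) * (t j + t n * b n j) * kernel i j) + (t n)\<^sup>2 * s n"
    by (rule innovations_quadratic_form[OF kernel_positive_definite innovations_b_s])
  \<comment> \<open>With these coefficients \<open>t i + t n * b n i\<close> is 0 for all i < n, so
    only the error variance survives.\<close>
  also have "\<dots> = s n" by (simp add: t_def)
  finally show ?thesis .
qed

lemma quadratic_form_nonneg: "0 \<le> (\<Sum>i<n. \<Sum>j<n. c i * c j * kernel i j)"
proof -
  have "0 \<le> (\<integral>\<omega>. (\<Sum>i<n. c i * Z (int i) \<omega>)\<^sup>2 \<partial>M)" by simp
  then show ?thesis by (simp only: combination_variance kernel_def)
qed

text \<open>The completed square is nonnegative here, and in \<open>s_eq_quadratic_form\<close> it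
  vanishes: \<open>s n\<close> is the minimum of the form over coefficients with last entry
  1.\<close>

lemma s_le_quadratic_form:
  assumes "t n = 1" shows "s n \<le> (\<Sum>i<Suc n. \<Sum>j<Suc n. t i * t j * kernel i j)"
  using quadratic_form_nonneg[of "\<lambda>i. t i + t n * b n i" n] assms
  unfolding innovations_quadratic_form[OF kernel_positive_definite innovations_b_s] by simp

lemma s_eq_quadratic_form:
  obtains t where "t n = 1" "s n = (\<Sum>i<Suc n. \<Sum>j<Suc n. t i * t j * kernel i j)"
proof -
  define t where "t i = (if i < n then - b n i else 1)" for i
  have 1: "t n = 1" by (simp add: t_def)
  have 2: "s n = (\<Sum>i<Suc n. \<Sum>j<Suc n. t i * t j * kernel i j)"
    unfolding innovations_quadratic_form[OF kernel_positive_definite innovations_b_s] by (simp add: t_def)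
  show ?thesis by (rule that[OF 1 2])
qed

section \<open>Differential entropy of the finite-dimensional laws\<close>

lemma ln_normal_density:
  assumes "v > 0"
  shows "ln (normal_density m (sqrt v) x) = - ln (2 * pi * v) / 2 - (x - m)\<^sup>2 / (2 * v)"
proof -
  have "sqrt (2 * pi * v) > 0" using assms by simp
  then have "ln (normal_density m (sqrt v) x) = ln (exp (- (x - m)\<^sup>2 / (2 * v))) - ln (sqrt (2 * pi * v))"
    using assms by (simp add: normal_density_def ln_div ln_mult_pos)
  also have "ln (sqrt (2 * pi * v)) = ln (2 * pi * v) / 2"
    using assms by (intro ln_sqrt) simp
  finally show ?thesis by simp
qed

text \<open>The differential entropy of a normal variable with variance \<open>s k\<close>, that is,
  of the k-th prediction error. Euler's number enters because (error)^2 / (2 s k) has mean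
  1/2.\<close>

definition innovation_entropy where "innovation_entropy k = ln (2 * pi * exp 1 * s k) / 2"

text \<open>The chain rule for entropy: along the path, the k-th summand of the logarithm of the
  density depends on the k-th prediction error alone, whose square has expectation
  \<open>s k\<close>.\<close>

lemma ln_gaussian_density_integral:
  "integrable M (\<lambda>\<omega>. ln (gaussian_density b s n (path n \<omega>)))"
  "(\<integral>\<omega>. ln (gaussian_density b s n (path n \<omega>)) \<partial>M) = - (\<Sum>k<n. innovation_entropy k)"
proof -
  define e where "e k \<omega> = Z (int k) \<omega> - (\<Sum>j<k. b k j * Z (int j) \<omega>)" for k \<omega>
  have ei: "integrable M (\<lambda>\<omega>. (e k \<omega>)\<^sup>2)" for k
  proof -
    define t where "t i = (if i < k then - b k i else 1)" for i
    have "e k \<omega> = (\<Sum>i<Suc k. t i * Z (int i) \<omega>)" for \<omega>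
      by (simp add: t_def e_def sum_negf)
    then have "(e k \<omega>)\<^sup>2 = (\<Sum>i<Suc k. \<Sum>j<Suc k. t i * t j * (Z (int i) \<omega> * Z (int j) \<omega>))" for \<omega>
      by (simp only: power2_eq_square sum_product mult_ac)
    then show ?thesis using Z_mult_integrable by (simp del: sum.lessThan_Suc)
  qed
  have eq: "ln (gaussian_density b s n (path n \<omega>)) =
      (\<Sum>k<n. - ln (2 * pi * s k) / 2 - (e k \<omega>)\<^sup>2 / (2 * s k))" for \<omega>
  proof -
    define x where "x = (path n \<omega>)"
    have "ln (gaussian_density b s n x) =
        (\<Sum>k<n. ln (normal_density (\<Sum>j<k. b k j * x j) (sqrt (s k)) (x k)))"
      unfolding gaussian_density_def
    proof (rule ln_prod)
      show "normal_density (\<Sum>j<k. b k j * x j) (sqrt (s k)) (x k) \<noteq> 0" for k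
        using s_pos[of k] by (intro less_imp_neq[symmetric] normal_density_pos) simp
    qed simp
    also have "\<dots> = (\<Sum>k<n. - ln (2 * pi * s k) / 2 - (e k \<omega>)\<^sup>2 / (2 * s k))"
    proof (intro sum.cong refl)
      fix k assume k: "k \<in> {..<n}"
      then have "(\<Sum>j<k. b k j * x j) = (\<Sum>j<k. b k j * Z (int j) \<omega>)"
        by (intro sum.cong) (auto simp: x_def)
      then show "ln (normal_density (\<Sum>j<k. b k j * x j) (sqrt (s k)) (x k)) =
          - ln (2 * pi * s k) / 2 - (e k \<omega>)\<^sup>2 / (2 * s k)"
        unfolding ln_normal_density[OF s_pos] using k by (simp add: e_def x_def)
    qed
    finally show ?thesis unfolding x_def .
  qed
  have int: "integrable M (\<lambda>\<omega>. - ln (2 * pi * s k) / 2 - (e k \<omega>)\<^sup>2 / (2 * s k))" for k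
    using ei[of k] by simp
  show "integrable M (\<lambda>\<omega>. ln (gaussian_density b s n (path n \<omega>)))"
    unfolding eq by (intro Bochner_Integration.integrable_sum int)
  have "(\<integral>\<omega>. (\<Sum>k<n. - ln (2 * pi * s k) / 2 - (e k \<omega>)\<^sup>2 / (2 * s k)) \<partial>M) = (\<Sum>k<n. - innovation_entropy k)"
  proof (subst Bochner_Integration.integral_sum[OF int], intro sum.cong refl)
    fix k
    have "(\<integral>\<omega>. - ln (2 * pi * s k) / 2 - (e k \<omega>)\<^sup>2 / (2 * s k) \<partial>M) =
        - ln (2 * pi * s k) / 2 - (\<integral>\<omega>. (e k \<omega>)\<^sup>2 \<partial>M) / (2 * s k)"
      using ei[of k] by (simp add: prob_space)
    also have "(\<integral>\<omega>. (e k \<omega>)\<^sup>2 \<partial>M) = s k" unfolding e_def by (rule innovation_variance)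
    also have "- ln (2 * pi * s k) / 2 - s k / (2 * s k) = - innovation_entropy k"
    proof -
      have "ln (2 * pi * exp 1 * s k) = ln (2 * pi * s k) + 1"
        using s_pos[of k] ln_mult_pos[of "2 * pi * s k" "exp 1"] by (simp add: mult_ac)
      then show ?thesis using s_pos[of k] by (simp add: innovation_entropy_def add_divide_distrib)
    qed
    finally show "(\<integral>\<omega>. - ln (2 * pi * s k) / 2 - (e k \<omega>)\<^sup>2 / (2 * s k) \<partial>M) = - innovation_entropy k" .
  qed
  then show "(\<integral>\<omega>. ln (gaussian_density b s n (path n \<omega>)) \<partial>M) = - (\<Sum>k<n. innovation_entropy k)"
    unfolding eq by (simp add: sum_negf)
qed

lemma joint_density_AE: "AE x in lebesgue_pow n. joint_density M Z n x = gaussian_density b s n x"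
proof -
  interpret sigma_finite_measure "lebesgue_pow n"
    by (rule lborel_pow.sigma_finite) simp
  have "AE x in lebesgue_pow n. ennreal (gaussian_density b s n x) =
      RN_deriv (lebesgue_pow n) (distr M (lebesgue_pow n) (path n)) x"
    by (rule RN_deriv_unique) (auto simp: joint_law)
  then show ?thesis
  proof eventually_elim
    case (elim x)
    then show ?case
      unfolding joint_density_def elim[symmetric]
      using gaussian_density_pos[of s b n x, OF s_pos] by simp
  qed
qed

text \<open>The integral of f ln f is the expectation of ln f along the path. It is finite, so both
  parts in \<open>ext_integral\<close> are finite. The Radon-Nikodym derivative is replaced by the
  explicit density almost everywhere.\<close>

lemma entropy_integral:
  "ext_integral (lebesgue_pow n) (\<lambda>x. ereal (joint_density M Z n x * ln (joint_density M Z n x))) =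
    ereal (- (\<Sum>k<n. innovation_entropy k))"
proof -
  let ?G = "gaussian_density b s n"
  have Zm: "(path n) \<in> measurable M (lebesgue_pow n)"
    by (rule measurable_restrict) simp
  have lm: "(\<lambda>x. ln (?G x)) \<in> borel_measurable (lebesgue_pow n)" by measurable
  have G0: "0 \<le> ?G x" for x using gaussian_density_pos[of s b n x, OF s_pos] by simp
  have "integrable (distr M (lebesgue_pow n) (path n)) (\<lambda>x. ln (?G x))"
    using ln_gaussian_density_integral(1) by (subst integrable_distr_eq[OF Zm lm])
  then have int: "integrable (lebesgue_pow n) (\<lambda>x. ?G x * ln (?G x))"
    unfolding joint_law using G0 by (subst (asm) integrable_density) auto
  have val: "(\<integral>x. ?G x * ln (?G x) \<partial>lebesgue_pow n) = - (\<Sum>k<n. innovation_entropy k)"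
  proof -
    have "(\<integral>x. ?G x * ln (?G x) \<partial>lebesgue_pow n) = (\<integral>x. ln (?G x) \<partial>density (lebesgue_pow n) (\<lambda>x. ennreal (?G x)))"
      using G0 by (subst integral_density) auto
    also have "\<dots> = (\<integral>\<omega>. ln (?G (path n \<omega>)) \<partial>M)"
      unfolding joint_law[symmetric] by (rule integral_distr[OF Zm lm])
    finally show ?thesis using ln_gaussian_density_integral(2) by simp
  qed
  let ?H = "\<lambda>x. ?G x * ln (?G x)"
  have "ext_integral (lebesgue_pow n) (\<lambda>x. ereal (joint_density M Z n x * ln (joint_density M Z n x))) =
    enn2ereal (\<integral>\<^sup>+x. ennreal (?H x) \<partial>lebesgue_pow n) - enn2ereal (\<integral>\<^sup>+x. ennreal (- ?H x) \<partial>lebesgue_pow n)"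
    unfolding ext_integral_def
    by (intro arg_cong2[of _ _ _ _ "(-)"] arg_cong[of _ _ enn2ereal] nn_integral_cong_AE)
       (use joint_density_AE[of n] in \<open>auto simp: e2ennreal_ereal elim!: eventually_mono\<close>)
  also have "\<dots> = ereal (\<integral>x. ?H x \<partial>lebesgue_pow n)"
  proof -
    have "(\<integral>\<^sup>+x. ennreal (?H x) \<partial>lebesgue_pow n) \<noteq> \<top>" "(\<integral>\<^sup>+x. ennreal (- ?H x) \<partial>lebesgue_pow n) \<noteq> \<top>"
      using integrableD(2,3)[OF int] by auto
    then show ?thesis
      unfolding real_lebesgue_integral_def[OF int]
      by (cases "\<integral>\<^sup>+x. ennreal (?H x) \<partial>lebesgue_pow n"; cases "\<integral>\<^sup>+x. ennreal (- ?H x) \<partial>lebesgue_pow n")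
         (auto simp: enn2ereal_ennreal)
  qed
  finally show ?thesis unfolding val .
qed

end

text \<open>From index m on the terms lie below c, and the earlier ones exceed c by at most A in
  total, so the mean is at most c + A / n. Two real levels c < d are put between L and a, which may
  be infinite; the gap d - c absorbs A / n.\<close>

lemma cesaro_eventually_less:
  assumes lim: "(\<lambda>k. ereal (v k)) \<longlonglongrightarrow> L" and a: "L < a"
  shows "\<forall>\<^sub>F n in sequentially. ereal ((\<Sum>k<n. v k) / real n) < a"
proof -
  obtain c where c: "L < ereal c" "ereal c < a" using ereal_dense2[OF a] by blast
  obtain d where d: "ereal c < ereal d" "ereal d < a" using ereal_dense2[OF c(2)] by blast
  have cd: "c < d" using d(1) by simp
  obtain m where m: "\<And>k. k \<ge> m \<Longrightarrow> v k < c"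
    using order_tendstoD(2)[OF lim c(1)] by (auto simp: eventually_sequentially)
  define A where "A = (\<Sum>k<m. \<bar>v k - c\<bar>)"
  have bound: "(\<Sum>k<n. v k) \<le> real n * c + A" for n
  proof -
    have "(\<Sum>k<n. v k - c) \<le> (\<Sum>k<n. if k < m then \<bar>v k - c\<bar> else 0)"
    proof (rule sum_mono)
      fix k show "v k - c \<le> (if k < m then \<bar>v k - c\<bar> else 0)" using m[of k] by auto
    qed
    also have "\<dots> = (\<Sum>k\<in>{..<n} \<inter> {..<m}. \<bar>v k - c\<bar>)"
      by (subst sum.inter_restrict) (auto intro!: sum.cong)
    also have "\<dots> \<le> A" unfolding A_def by (intro sum_mono2) auto
    finally show ?thesis by (simp add: sum_subtractf)
  qed
  have "(\<lambda>n. A / real n) \<longlonglongrightarrow> 0" by (rule lim_const_over_n)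
  then have "\<forall>\<^sub>F n in sequentially. A / real n < d - c"
    using cd by (intro order_tendstoD(2)) auto
  with eventually_gt_at_top[of 0] show ?thesis
  proof eventually_elim
    case (elim n)
    have "(\<Sum>k<n. v k) / real n \<le> (real n * c + A) / real n"
      using bound by (intro divide_right_mono) auto
    also have "\<dots> = c + A / real n" using elim(1) by (simp add: add_divide_distrib)
    also have "\<dots> < d" using elim(2) by simp
    finally show ?case using d(2) by (meson ereal_less_eq(3) less_imp_le order_le_less_trans)
  qed
qed

lemma cesaro_ereal:
  assumes lim: "(\<lambda>k. ereal (v k)) \<longlonglongrightarrow> L"
  shows "(\<lambda>n. ereal ((\<Sum>k<n. v k) / real n)) \<longlonglongrightarrow> L"
proof (rule order_tendstoI)
  fix a assume "a < L"
  then have "- L < - a" by simp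
  moreover have "(\<lambda>k. ereal (- v k)) \<longlonglongrightarrow> - L"
    using tendsto_uminus_ereal[OF lim] by simp
  ultimately have "\<forall>\<^sub>F n in sequentially. ereal ((\<Sum>k<n. - v k) / real n) < - a"
    by (intro cesaro_eventually_less)
  then show "\<forall>\<^sub>F n in sequentially. a < ereal ((\<Sum>k<n. v k) / real n)"
  proof eventually_elim
    case (elim n)
    then have "- ereal ((\<Sum>k<n. v k) / real n) < - a" by (simp add: sum_negf)
    then show ?case by (simp only: ereal_minus_less_minus)
  qed
qed (rule cesaro_eventually_less[OF lim])

text \<open>At 0 the formula is replaced by its limit: \<open>ln 0 = 0\<close> would assign entropy
  0 to a process whose prediction errors tend to 0.\<close>

definition entropy_rate :: "real \<Rightarrow> ereal" where
  "entropy_rate x = (if x = 0 then - \<infinity> else ereal (ln (2 * pi * exp 1 * x) / 2))"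

lemma entropy_rate_tendsto:
  assumes lim: "s \<longlonglongrightarrow> x" and s: "\<And>k. s k > 0"
  shows "(\<lambda>k. ereal (ln (2 * pi * exp 1 * s k) / 2)) \<longlonglongrightarrow> entropy_rate x"
proof (cases "x = 0")
  case True
  have "(\<lambda>k. 2 * pi * exp 1 * s k) \<longlonglongrightarrow> 2 * pi * exp 1 * 0"
    by (intro tendsto_mult tendsto_const) (use lim True in simp)
  then have "filterlim (\<lambda>k. 2 * pi * exp 1 * s k) (at_right 0) sequentially"
    unfolding filterlim_at using s by (auto simp: less_imp_neq[symmetric])
  then have "filterlim (\<lambda>k. ln (2 * pi * exp 1 * s k)) at_bot sequentially"
    by (rule filterlim_compose[OF ln_at_0])
  then have "filterlim (\<lambda>k. ln (2 * pi * exp 1 * s k) / 2) at_bot sequentially"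
    using filterlim_tendsto_pos_mult_at_bot[OF tendsto_const[of "1/2 :: real"]] by fastforce
  then show ?thesis using True by (simp add: entropy_rate_def tendsto_MInfty filterlim_at_bot_dense)
next
  case False
  then have "(\<lambda>k. ln (2 * pi * exp 1 * s k) / 2) \<longlonglongrightarrow> ln (2 * pi * exp 1 * x) / 2"
    by (intro tendsto_intros lim) auto
  then show ?thesis using False by (simp add: entropy_rate_def)
qed

section \<open>Prediction errors as norms of polynomials\<close>

lemma power_int_cnj_circle:
  assumes "z \<in> sphere 0 1" shows "z powi i * cnj (z powi j) = z powi (i - j)"
proof -
  have z: "z \<noteq> 0" using assms by auto
  have "z powi j * cnj (z powi j) = 1"
    using assms complex_norm_square[of "z powi j"] by (simp add: norm_power_int del: complex_cnj_power_int)
  then have "cnj (z powi j) = inverse (z powi j)"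
    by (metis inverse_unique)
  then show ?thesis using z by (simp add: power_int_diff divide_inverse)
qed

lemma continuous_power_int_circle: "continuous_on (sphere 0 1) (\<lambda>z::complex. z powi n)"
  by (intro continuous_intros) auto

context stationary_gaussian_process
begin

text \<open>Time reversal preserves the covariances of a stationary process. Prediction normalises
  the coefficient of the last variable, the Szego infimum the constant coefficient of a polynomial;
  reversal matches the two.\<close>

lemma reversed_quadratic_form:
  "(\<Sum>i<Suc n. \<Sum>j<Suc n. u (n - i) * u (n - j) * kernel i j) = (\<Sum>i<Suc n. \<Sum>j<Suc n. u i * u j * kernel i j)"
proof -
  have rev: "(\<Sum>i<Suc n. f i) = (\<Sum>i<Suc n. f (n - i))" for f :: "nat \<Rightarrow> real"
    using sum.nat_diff_reindex[of f "Suc n"] by (simp only: diff_Suc_Suc)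
  have "(\<Sum>i<Suc n. \<Sum>j<Suc n. u i * u j * kernel i j) = (\<Sum>i<Suc n. \<Sum>j<Suc n. u (n - i) * u j * kernel (n - i) j)"
    by (rule rev)
  also have "\<dots> = (\<Sum>i<Suc n. \<Sum>j<Suc n. u (n - i) * u (n - j) * kernel (n - i) (n - j))"
    by (intro sum.cong refl rev)
  also have "\<dots> = (\<Sum>i<Suc n. \<Sum>j<Suc n. u (n - i) * u (n - j) * kernel i j)"
  proof (intro sum.cong refl)
    fix i j assume "i \<in> {..<Suc n}" "j \<in> {..<Suc n}"
    then have "int (n - i) - int (n - j) = int j - int i" by auto
    then show "u (n - i) * u (n - j) * kernel (n - i) (n - j) = u (n - i) * u (n - j) * kernel i j"
      by (simp add: kernel_def covariance_minus[of "int i - int j", simplified])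
  qed
  finally show ?thesis ..
qed

context
  fixes \<nu> assumes spectral: "spectral_measure M Z \<nu>"
begin

lemma spectral_finite: "finite_measure \<nu>" and spectral_sets: "sets \<nu> = sets circle"
  using spectral by (auto simp: spectral_measure_def)

lemma spectral_integral: "(\<integral>z. z powi n \<partial>\<nu>) = of_real (covariance M Z n)"
proof -
  have "(\<integral>z. z powi (- (- n)) \<partial>\<nu>) = of_real (covariance M Z (- n))"
    using spectral unfolding spectral_measure_def by blast
  then show ?thesis by (simp add: covariance_minus)
qed

lemma spectral_integrable: "integrable \<nu> (\<lambda>z. z powi n)"
  by (rule finite_measure_continuous_integrable[OF spectral_finite spectral_sets continuous_power_int_circle])

text \<open>k = 0 gives norms in L2(\<nu>); general k is what the Fourier coefficients of the
  filtered spectral measure call for.\<close>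

lemma spectral_integral_mult:
  "(\<integral>z. z powi k * ((\<Sum>i\<in>J. c i * z powi (d i)) * cnj (\<Sum>j\<in>J. c j * z powi (d j))) \<partial>\<nu>) =
    (\<Sum>i\<in>J. \<Sum>j\<in>J. c i * cnj (c j) * of_real (covariance M Z (k + d i - d j)))"
proof -
  have sp: "space \<nu> = sphere 0 1" by (rule space_circle_measure[OF spectral_finite spectral_sets])
  have "(\<integral>z. z powi k * ((\<Sum>i\<in>J. c i * z powi (d i)) * cnj (\<Sum>j\<in>J. c j * z powi (d j))) \<partial>\<nu>) =
      (\<integral>z. (\<Sum>i\<in>J. \<Sum>j\<in>J. c i * cnj (c j) * z powi (k + d i - d j)) \<partial>\<nu>)"
  proof (intro Bochner_Integration.integral_cong refl)
    fix z assume "z \<in> space \<nu>"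
    then have z: "z \<in> sphere 0 1" "z \<noteq> 0" using sp by auto
    have *: "c i * cnj (c j) * z powi (k + d i - d j) = z powi k * (c i * z powi d i * cnj (c j * z powi d j))" for i j
      using power_int_cnj_circle[OF z(1), of "k + d i" "d j"] z(2)
      by (simp add: power_int_add mult_ac)
    show "z powi k * ((\<Sum>i\<in>J. c i * z powi (d i)) * cnj (\<Sum>j\<in>J. c j * z powi (d j))) =
      (\<Sum>i\<in>J. \<Sum>j\<in>J. c i * cnj (c j) * z powi (k + d i - d j))"
      unfolding * cnj_sum sum_product by (simp only: sum_distrib_left)
  qed
  also have "\<dots> = (\<Sum>i\<in>J. \<Sum>j\<in>J. c i * cnj (c j) * of_real (covariance M Z (k + d i - d j)))"
    using spectral_integrable by (simp add: Bochner_Integration.integral_sum spectral_integral)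
  finally show ?thesis .
qed

text \<open>The covariances are real, so the real and imaginary parts of the coefficients do not
  interact.\<close>

lemma spectral_integral_norm_square:
  "(\<integral>z. (cmod (\<Sum>i<n. c i * z ^ i))\<^sup>2 \<partial>\<nu>) =
    (\<Sum>i<n. \<Sum>j<n. Re (c i) * Re (c j) * kernel i j) + (\<Sum>i<n. \<Sum>j<n. Im (c i) * Im (c j) * kernel i j)"
proof -
  have "complex_of_real (\<integral>z. (cmod (\<Sum>i<n. c i * z ^ i))\<^sup>2 \<partial>\<nu>) = (\<integral>z. of_real ((cmod (\<Sum>i<n. c i * z ^ i))\<^sup>2) \<partial>\<nu>)"
    by (rule integral_complex_of_real[symmetric])
  also have "\<dots> = (\<integral>z. z powi 0 * ((\<Sum>i<n. c i * z powi (int i)) * cnj (\<Sum>j<n. c j * z powi (int j))) \<partial>\<nu>)"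
    by (intro Bochner_Integration.integral_cong refl) (simp only: complex_norm_square power_int_of_nat power_int_0_right mult_1)
  also have "\<dots> = (\<Sum>i<n. \<Sum>j<n. c i * cnj (c j) * of_real (covariance M Z (0 + int i - int j)))"
    by (rule spectral_integral_mult)
  finally have "(\<integral>z. (cmod (\<Sum>i<n. c i * z ^ i))\<^sup>2 \<partial>\<nu>) =
      Re (\<Sum>i<n. \<Sum>j<n. c i * cnj (c j) * of_real (covariance M Z (0 + int i - int j)))"
    by (metis Re_complex_of_real)
  then show ?thesis
    by (simp add: kernel_def ring_distribs sum.distrib)
qed

lemma szego_le_s: "szego \<nu> \<le> s n"
proof -
  obtain t where t: "t n = 1" "s n = (\<Sum>i<Suc n. \<Sum>j<Suc n. t i * t j * kernel i j)"
    by (rule s_eq_quadratic_form)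
  define p where "p = (\<Sum>i<Suc n. monom (complex_of_real (t (n - i))) i)"
  have p: "poly p z = (\<Sum>i<Suc n. of_real (t (n - i)) * z ^ i)" for z
    by (simp add: p_def poly_sum poly_monom)
  have "poly p 0 = (\<Sum>i<Suc n. if i = 0 then 1 else 0)"
    unfolding p using t(1) by (intro sum.cong) auto
  then have p0: "poly p 0 = 1" by (simp del: sum.lessThan_Suc add: sum.delta)
  have "szego \<nu> \<le> (\<integral>z. (cmod (poly p z))\<^sup>2 \<partial>\<nu>)" by (rule szego_le[OF p0])
  also have "\<dots> = (\<Sum>i<Suc n. \<Sum>j<Suc n. t (n - i) * t (n - j) * kernel i j)"
    unfolding p spectral_integral_norm_square by (simp del: sum.lessThan_Suc)
  also have "\<dots> = s n" unfolding reversed_quadratic_form t(2) ..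
  finally show ?thesis .
qed

text \<open>Complex coefficients gain nothing over real ones: the real parts still have constant
  coefficient 1, and the imaginary parts add a nonnegative form. Coefficients between the degree and
  n are 0.\<close>

lemma s_le_poly:
  assumes p: "poly p 0 = 1" and n: "degree p \<le> n"
  shows "s n \<le> (\<integral>z. (cmod (poly p z))\<^sup>2 \<partial>\<nu>)"
proof -
  have poly: "poly p z = (\<Sum>i<Suc n. coeff p i * z ^ i)" for z
    unfolding poly_altdef lessThan_Suc_atMost
    by (rule sum.mono_neutral_left) (use n in \<open>auto simp: coeff_eq_0\<close>)
  define t where "t i = Re (coeff p (n - i))" for i
  have "t n = 1" using p by (simp add: t_def poly_0_coeff_0)
  then have "s n \<le> (\<Sum>i<Suc n. \<Sum>j<Suc n. t i * t j * kernel i j)" by (rule s_le_quadratic_form)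
  also have "\<dots> = (\<Sum>i<Suc n. \<Sum>j<Suc n. t (n - i) * t (n - j) * kernel i j)"
    by (rule reversed_quadratic_form[symmetric])
  also have "\<dots> = (\<Sum>i<Suc n. \<Sum>j<Suc n. Re (coeff p i) * Re (coeff p j) * kernel i j)"
    by (intro sum.cong refl) (auto simp: t_def)
  also have "\<dots> \<le> (\<integral>z. (cmod (poly p z))\<^sup>2 \<partial>\<nu>)"
    unfolding poly spectral_integral_norm_square
    using quadratic_form_nonneg[of "\<lambda>i. Im (coeff p i)" "Suc n"] by simp
  finally show ?thesis .
qed

text \<open>All \<open>s n\<close> lie above the infimum, and a single nearly optimal polynomial
  bounds \<open>s n\<close> for every n from its degree on.\<close>

lemma s_tendsto_szego: "s \<longlonglongrightarrow> szego \<nu>"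
proof (rule order_tendstoI)
  fix a assume "a < szego \<nu>"
  then have "a < s n" for n using szego_le_s[of n] by linarith
  then show "\<forall>\<^sub>F n in sequentially. a < s n" by simp
next
  fix a assume "szego \<nu> < a"
  then obtain p where p: "poly p 0 = 1" "(\<integral>z. (cmod (poly p z))\<^sup>2 \<partial>\<nu>) < a"
    by (rule szego_less_obtain)
  show "\<forall>\<^sub>F n in sequentially. s n < a"
    using eventually_ge_at_top[of "degree p"]
    by eventually_elim (use s_le_poly[OF p(1)] p(2) in \<open>force intro: order_le_less_trans\<close>)
qed

lemma shannon_entropy_eq: "shannon_entropy M Z = entropy_rate (szego \<nu>)"
proof -
  have "(\<lambda>k. ereal (innovation_entropy k)) \<longlonglongrightarrow> entropy_rate (szego \<nu>)"
    unfolding innovation_entropy_def by (rule entropy_rate_tendsto[OF s_tendsto_szego s_pos])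
  then have "(\<lambda>n. ereal ((\<Sum>k<n. innovation_entropy k) / real n)) \<longlonglongrightarrow> entropy_rate (szego \<nu>)"
    by (rule cesaro_ereal)
  moreover have "ereal (1 / real n) * (- ext_integral (lebesgue_pow n)
      (\<lambda>x. ereal (joint_density M Z n x * ln (joint_density M Z n x)))) = ereal ((\<Sum>k<n. innovation_entropy k) / real n)" for n
    unfolding entropy_integral by simp
  ultimately show ?thesis unfolding shannon_entropy_def by (simp add: limI)
qed

end

end

section \<open>Filtered processes\<close>

lemma integral_norm_square_add:
  fixes u v :: "'a \<Rightarrow> 'b::{banach, second_countable_topology}"
  assumes [measurable]: "u \<in> borel_measurable \<mu>" "v \<in> borel_measurable \<mu>"
    and int: "integrable \<mu> (\<lambda>x. (norm (u x))\<^sup>2)" "integrable \<mu> (\<lambda>x. (norm (v x))\<^sup>2)"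
  shows "integrable \<mu> (\<lambda>x. (norm (u x + v x))\<^sup>2)"
    "(\<integral>x. (norm (u x + v x))\<^sup>2 \<partial>\<mu>) \<le> 2 * (\<integral>x. (norm (u x))\<^sup>2 \<partial>\<mu>) + 2 * (\<integral>x. (norm (v x))\<^sup>2 \<partial>\<mu>)"
proof -
  have le: "(norm (u x + v x))\<^sup>2 \<le> 2 * (norm (u x))\<^sup>2 + 2 * (norm (v x))\<^sup>2" for x
  proof -
    have "(norm (u x + v x))\<^sup>2 \<le> (norm (u x) + norm (v x))\<^sup>2"
      by (intro power_mono norm_triangle_ineq) simp
    then show ?thesis
      using sum_squares_bound[of "norm (u x)" "norm (v x)"] by (simp add: power2_sum)
  qed
  have i: "integrable \<mu> (\<lambda>x. 2 * (norm (u x))\<^sup>2 + 2 * (norm (v x))\<^sup>2)" using int by simp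
  show "integrable \<mu> (\<lambda>x. (norm (u x + v x))\<^sup>2)"
    by (rule Bochner_Integration.integrable_bound[OF i]) (use le in auto)
  then have "(\<integral>x. (norm (u x + v x))\<^sup>2 \<partial>\<mu>) \<le> (\<integral>x. 2 * (norm (u x))\<^sup>2 + 2 * (norm (v x))\<^sup>2 \<partial>\<mu>)"
    by (intro integral_mono i le)
  then show "(\<integral>x. (norm (u x + v x))\<^sup>2 \<partial>\<mu>) \<le> 2 * (\<integral>x. (norm (u x))\<^sup>2 \<partial>\<mu>) + 2 * (\<integral>x. (norm (v x))\<^sup>2 \<partial>\<mu>)"
    using int by simp
qed

text \<open>With p = |s N|, q = |f| and d = |s N - f|, the difference |p^2 - q^2| is at most 2 q d +
  d^2, and 2 q d \<le> \<delta> q^2 + d^2 / \<delta>. For small \<delta> the part with q is small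
  uniformly in N, and the rest tends to 0.\<close>

lemma L2_limit_norm_square:
  fixes f :: "'a \<Rightarrow> 'b::{banach, second_countable_topology}"
  assumes "L2_limit \<mu> s f"
  shows "(\<lambda>N. \<integral>x. \<bar>(norm (s N x))\<^sup>2 - (norm (f x))\<^sup>2\<bar> \<partial>\<mu>) \<longlonglongrightarrow> 0"
proof -
  have sm [measurable]: "s N \<in> borel_measurable \<mu>" and si: "integrable \<mu> (\<lambda>x. (norm (s N x))\<^sup>2)" for N
    using assms by (auto simp: L2_limit_def)
  have fm [measurable]: "f \<in> borel_measurable \<mu>" and fi: "integrable \<mu> (\<lambda>x. (norm (f x))\<^sup>2)"
    and lim: "(\<lambda>N. \<integral>x. (norm (s N x - f x))\<^sup>2 \<partial>\<mu>) \<longlonglongrightarrow> 0"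
    using assms by (auto simp: L2_limit_def)
  define F where "F = (\<integral>x. (norm (f x))\<^sup>2 \<partial>\<mu>)"
  define D where "D N = (\<integral>x. (norm (s N x - f x))\<^sup>2 \<partial>\<mu>)" for N
  define A where "A N = (\<integral>x. \<bar>(norm (s N x))\<^sup>2 - (norm (f x))\<^sup>2\<bar> \<partial>\<mu>)" for N
  have F0: "F \<ge> 0" unfolding F_def by simp
  have di: "integrable \<mu> (\<lambda>x. (norm (s N x - f x))\<^sup>2)" for N
    using integral_norm_square_add(1)[of "s N" \<mu> "\<lambda>x. - f x"] si fi by simp
  have bound: "A N \<le> \<delta> * F + (1 + 1 / \<delta>) * D N" if "\<delta> > 0" for \<delta> N
  proof -
    have "A N \<le> (\<integral>x. \<delta> * (norm (f x))\<^sup>2 + (1 + 1 / \<delta>) * (norm (s N x - f x))\<^sup>2 \<partial>\<mu>)"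
      unfolding A_def
    proof (rule integral_mono)
      fix x
      define p q d where "p = norm (s N x)" and "q = norm (f x)" and "d = norm (s N x - f x)"
      have pq: "p \<ge> 0" "q \<ge> 0" "d \<ge> 0" "\<bar>p - q\<bar> \<le> d"
        unfolding p_def q_def d_def by (auto simp: norm_triangle_ineq3)
      have "\<bar>p\<^sup>2 - q\<^sup>2\<bar> = \<bar>p - q\<bar> * (p + q)"
        using pq by (simp add: power2_eq_square square_diff_square_factored abs_mult)
      also have "\<dots> \<le> d * (2 * q + d)" using pq by (intro mult_mono) auto
      also have "\<dots> \<le> \<delta> * q\<^sup>2 + (1 + 1 / \<delta>) * d\<^sup>2"
      proof -
        have "0 \<le> (\<delta> * q - d)\<^sup>2 / \<delta>" using that by simp
        also have "\<dots> = \<delta> * q\<^sup>2 + d\<^sup>2 / \<delta> - 2 * q * d"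
          using that by (simp add: power2_eq_square field_simps)
        finally show ?thesis by (simp add: power2_eq_square ring_distribs mult_ac)
      qed
      finally show "\<bar>(norm (s N x))\<^sup>2 - (norm (f x))\<^sup>2\<bar> \<le> \<delta> * (norm (f x))\<^sup>2 + (1 + 1 / \<delta>) * (norm (s N x - f x))\<^sup>2"
        by (simp only: p_def q_def d_def)
    qed (use si fi di in auto)
    also have "\<dots> = \<delta> * F + (1 + 1 / \<delta>) * D N"
      using fi di[of N] by (simp add: F_def D_def)
    finally show ?thesis .
  qed
  have "A \<longlonglongrightarrow> 0"
  proof (rule order_tendstoI)
    fix a :: real assume "a < 0"
    moreover have "0 \<le> A N" for N unfolding A_def by simp
    ultimately show "\<forall>\<^sub>F N in sequentially. a < A N" by (simp add: less_le_trans)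
  next
    fix e :: real assume e: "0 < e"
    \<comment> \<open>Chosen so that \<delta> F \<le> e/2; the summand 1 covers F = 0.\<close>
    define \<delta> where "\<delta> = e / 2 / (F + 1)"
    have \<delta>: "\<delta> > 0" using e F0 by (simp add: \<delta>_def)
    have "\<delta> * F \<le> \<delta> * (F + 1)" using \<delta> by simp
    also have "\<dots> = e / 2"
      using nonzero_eq_divide_eq[of "F + 1" \<delta> "e / 2"] F0 \<delta>_def by linarith
    finally have 1: "\<delta> * F \<le> e / 2" .
    have "(\<lambda>N. (1 + 1 / \<delta>) * D N) \<longlonglongrightarrow> (1 + 1 / \<delta>) * 0"
      using lim unfolding D_def by (intro tendsto_intros)
    then have "\<forall>\<^sub>F N in sequentially. (1 + 1 / \<delta>) * D N < e / 2"
      using e by (intro order_tendstoD(2)) auto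
    then show "\<forall>\<^sub>F N in sequentially. A N < e"
    proof eventually_elim
      case (elim N)
      then show ?case using bound[OF \<delta>, of N] 1 by linarith
    qed
  qed
  then show ?thesis unfolding A_def .
qed

lemma L2_limit_integral_square:
  fixes f :: "'a \<Rightarrow> real"
  assumes "L2_limit \<mu> s f"
  shows "(\<lambda>N. \<integral>x. (s N x)\<^sup>2 \<partial>\<mu>) \<longlonglongrightarrow> (\<integral>x. (f x)\<^sup>2 \<partial>\<mu>)"
proof -
  have i: "integrable \<mu> (\<lambda>x. (s N x)\<^sup>2)" "integrable \<mu> (\<lambda>x. (f x)\<^sup>2)" for N
    using assms by (auto simp: L2_limit_def)
  have "(\<lambda>N. (\<integral>x. (s N x)\<^sup>2 \<partial>\<mu>) - (\<integral>x. (f x)\<^sup>2 \<partial>\<mu>)) \<longlonglongrightarrow> 0"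
  proof (rule tendsto_rabs_zero_cancel, rule tendsto_sandwich[OF _ _ tendsto_const L2_limit_norm_square[OF assms]])
    show "\<forall>\<^sub>F N in sequentially. \<bar>(\<integral>x. (s N x)\<^sup>2 \<partial>\<mu>) - (\<integral>x. (f x)\<^sup>2 \<partial>\<mu>)\<bar> \<le>
        (\<integral>x. \<bar>(norm (s N x))\<^sup>2 - (norm (f x))\<^sup>2\<bar> \<partial>\<mu>)"
    proof (intro always_eventually allI)
      fix N
      have "(\<integral>x. (s N x)\<^sup>2 \<partial>\<mu>) - (\<integral>x. (f x)\<^sup>2 \<partial>\<mu>) = (\<integral>x. (s N x)\<^sup>2 - (f x)\<^sup>2 \<partial>\<mu>)"
        using i by simp
      then show "\<bar>(\<integral>x. (s N x)\<^sup>2 \<partial>\<mu>) - (\<integral>x. (f x)\<^sup>2 \<partial>\<mu>)\<bar> \<le>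
        (\<integral>x. \<bar>(norm (s N x))\<^sup>2 - (norm (f x))\<^sup>2\<bar> \<partial>\<mu>)"
        using integral_abs_bound[of \<mu> "\<lambda>x. (s N x)\<^sup>2 - (f x)\<^sup>2"] by simp
    qed
  qed simp
  then show ?thesis by (rule LIM_zero_cancel)
qed

lemma L2_limit_add:
  assumes f: "L2_limit \<mu> s f" and g: "L2_limit \<mu> t g"
  shows "L2_limit \<mu> (\<lambda>N x. s N x + t N x) (\<lambda>x. f x + g x)"
proof -
  let ?e = "\<lambda>u v N. \<integral>x. (norm (u N x - v x))\<^sup>2 \<partial>\<mu>"
  have m [measurable]: "s N \<in> borel_measurable \<mu>" "t N \<in> borel_measurable \<mu>"
    "f \<in> borel_measurable \<mu>" "g \<in> borel_measurable \<mu>" for N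
    using f g by (auto simp: L2_limit_def)
  have i: "integrable \<mu> (\<lambda>x. (norm (s N x))\<^sup>2)" "integrable \<mu> (\<lambda>x. (norm (t N x))\<^sup>2)"
    "integrable \<mu> (\<lambda>x. (norm (f x))\<^sup>2)" "integrable \<mu> (\<lambda>x. (norm (g x))\<^sup>2)" for N
    using f g by (auto simp: L2_limit_def)
  have d: "integrable \<mu> (\<lambda>x. (norm (s N x - f x))\<^sup>2)" "integrable \<mu> (\<lambda>x. (norm (t N x - g x))\<^sup>2)" for N
    using integral_norm_square_add(1)[of "s N" \<mu> "\<lambda>x. - f x"]
      integral_norm_square_add(1)[of "t N" \<mu> "\<lambda>x. - g x"] i by simp_all
  have "(\<lambda>N. \<integral>x. (norm (s N x + t N x - (f x + g x)))\<^sup>2 \<partial>\<mu>) \<longlonglongrightarrow> 0"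
  proof (rule tendsto_sandwich[OF _ _ tendsto_const])
    show "\<forall>\<^sub>F N in sequentially. (\<integral>x. (norm (s N x + t N x - (f x + g x)))\<^sup>2 \<partial>\<mu>) \<le> 2 * ?e s f N + 2 * ?e t g N"
      using integral_norm_square_add(2)[OF _ _ d] by (simp add: add_diff_add)
    have "(\<lambda>N. 2 * ?e s f N + 2 * ?e t g N) \<longlonglongrightarrow> 2 * 0 + 2 * 0"
      using f g by (intro tendsto_intros) (auto simp: L2_limit_def)
    then show "(\<lambda>N. 2 * ?e s f N + 2 * ?e t g N) \<longlonglongrightarrow> 0" by simp
  qed simp
  then show ?thesis
    unfolding L2_limit_def using integral_norm_square_add(1)[OF m(1,2) i(1,2)] integral_norm_square_add(1)[OF m(3,4) i(3,4)] by simp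
qed

text \<open>Polarisation reduces the product to squares of f, g and f + g.\<close>

lemma L2_limit_integral_mult:
  fixes f g :: "'a \<Rightarrow> real"
  assumes f: "L2_limit \<mu> s f" and g: "L2_limit \<mu> t g"
  shows "(\<lambda>N. \<integral>x. s N x * t N x \<partial>\<mu>) \<longlonglongrightarrow> (\<integral>x. f x * g x \<partial>\<mu>)"
proof -
  have fg: "L2_limit \<mu> (\<lambda>N x. s N x + t N x) (\<lambda>x. f x + g x)" by (rule L2_limit_add[OF f g])
  have pol: "(\<integral>x. u x * v x \<partial>\<mu>) = ((\<integral>x. (u x + v x)\<^sup>2 \<partial>\<mu>) - (\<integral>x. (u x)\<^sup>2 \<partial>\<mu>) - (\<integral>x. (v x)\<^sup>2 \<partial>\<mu>)) / 2"
    if "integrable \<mu> (\<lambda>x. (u x + v x)\<^sup>2)" "integrable \<mu> (\<lambda>x. (u x)\<^sup>2)" "integrable \<mu> (\<lambda>x. (v x)\<^sup>2)"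
    for u v :: "'a \<Rightarrow> real"
  proof -
    have "(\<integral>x. u x * v x \<partial>\<mu>) = (\<integral>x. ((u x + v x)\<^sup>2 - (u x)\<^sup>2 - (v x)\<^sup>2) / 2 \<partial>\<mu>)"
      by (simp add: power2_sum)
    then show ?thesis using that by simp
  qed
  have i: "integrable \<mu> (\<lambda>x. (s N x + t N x)\<^sup>2)" "integrable \<mu> (\<lambda>x. (s N x)\<^sup>2)" "integrable \<mu> (\<lambda>x. (t N x)\<^sup>2)"
    "integrable \<mu> (\<lambda>x. (f x + g x)\<^sup>2)" "integrable \<mu> (\<lambda>x. (f x)\<^sup>2)" "integrable \<mu> (\<lambda>x. (g x)\<^sup>2)" for N
    using f g fg by (auto simp: L2_limit_def)
  show ?thesis
    unfolding pol[OF i(1,2,3)] pol[OF i(4,5,6)]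
    by (intro tendsto_intros L2_limit_integral_square f g fg) simp
qed

text \<open>For the symmetric partial sums, the covariance of \<open>S n N\<close> with
  \<open>S 0 N\<close> and the Fourier coefficient of |G N|^2 \<nu> are the same finite double sum.
  Both pass to the limit, the latter because |G N|^2 tends to |g|^2 in L1(\<nu>) and characters have
  modulus 1.\<close>

lemma spectral_measure_filtered:
  assumes X: "stationary_gaussian_process M X" and Y: "stationary_gaussian_process M Y"
    and \<nu>: "spectral_measure M X \<nu>"
    and g: "L2_series \<nu> (\<lambda>n z. of_real (a n) * z powi n) g"
    and Ya: "\<And>k. L2_series M (\<lambda>n \<omega>. a n * X (n + k) \<omega>) (Y k)"
  shows "spectral_measure M Y (density \<nu> (\<lambda>z. ennreal ((cmod (g z))\<^sup>2)))"
proof -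
  interpret X: stationary_gaussian_process M X by (rule X)
  define J where "J N = {- int N..int N}" for N
  define G where "G N z = (\<Sum>n\<in>J N. of_real (a n) * z powi n)" for N and z :: complex
  define S where "S k N \<omega> = (\<Sum>n\<in>J N. a n * X (n + k) \<omega>)" for k N \<omega>
  have fin: "finite_measure \<nu>" and sets: "sets \<nu> = sets circle"
    by (rule X.spectral_finite[OF \<nu>], rule X.spectral_sets[OF \<nu>])
  have space: "space \<nu> = sphere 0 1" by (rule space_circle_measure[OF fin sets])
  have Glim: "L2_limit \<nu> G g" using g unfolding L2_series_def G_def[abs_def] J_def .
  have Slim: "L2_limit M (S k) (Y k)" for k using Ya[of k] unfolding L2_series_def S_def[abs_def] J_def .
  have gm [measurable]: "g \<in> borel_measurable \<nu>" and Gm [measurable]: "\<And>N. G N \<in> borel_measurable \<nu>"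
    and gi: "integrable \<nu> (\<lambda>z. (cmod (g z))\<^sup>2)" and Gi: "\<And>N. integrable \<nu> (\<lambda>z. (cmod (G N z))\<^sup>2)"
    using Glim by (auto simp: L2_limit_def)
  have cov: "covariance M Y n = (\<integral>\<omega>. Y n \<omega> * Y 0 \<omega> \<partial>M)" for n
    by (simp add: covariance_def)
  have pm [measurable]: "(\<lambda>z. z powi n) \<in> borel_measurable \<nu>" for n
    using X.spectral_integrable[OF \<nu>] by (rule borel_measurable_integrable)
  have int: "integrable \<nu> (\<lambda>z. z powi n * of_real ((cmod (u z))\<^sup>2))"
    if [measurable]: "u \<in> borel_measurable \<nu>" and "integrable \<nu> (\<lambda>z. (cmod (u z))\<^sup>2)" for n and u :: "complex \<Rightarrow> complex"
  proof (rule Bochner_Integration.integrable_bound[OF that(2)])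
    show "AE z in \<nu>. norm (z powi n * of_real ((cmod (u z))\<^sup>2)) \<le> norm ((cmod (u z))\<^sup>2)"
      by (intro AE_I2) (auto simp: space norm_mult norm_power_int norm_power)
  qed measurable
  have "(\<integral>z. z powi (- n) \<partial>density \<nu> (\<lambda>z. ennreal ((cmod (g z))\<^sup>2))) = of_real (covariance M Y n)" for n
  proof -
    let ?A = "\<lambda>u. \<integral>z. z powi (- n) * of_real ((cmod (u z))\<^sup>2) \<partial>\<nu>"
    have lim1: "(\<lambda>N. ?A (G N)) \<longlonglongrightarrow>
        ?A g"
    proof (rule LIM_zero_cancel, rule Lim_null_comparison[OF _ L2_limit_norm_square[OF Glim]])
      show "\<forall>\<^sub>F N in sequentially. norm (?A (G N) -
          ?A g) \<le> (\<integral>z. \<bar>(cmod (G N z))\<^sup>2 - (cmod (g z))\<^sup>2\<bar> \<partial>\<nu>)"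
      proof (intro always_eventually allI)
        fix N
        have "?A (G N) - ?A g =
          (\<integral>z. z powi (- n) * of_real ((cmod (G N z))\<^sup>2) - z powi (- n) * of_real ((cmod (g z))\<^sup>2) \<partial>\<nu>)"
          by (intro Bochner_Integration.integral_diff[symmetric] int gm Gm gi Gi)
        also have "norm \<dots> \<le> (\<integral>z. norm (z powi (- n) * of_real ((cmod (G N z))\<^sup>2) - z powi (- n) * of_real ((cmod (g z))\<^sup>2)) \<partial>\<nu>)"
          by (rule integral_norm_bound)
        also have "\<dots> = (\<integral>z. \<bar>(cmod (G N z))\<^sup>2 - (cmod (g z))\<^sup>2\<bar> \<partial>\<nu>)"
        proof (intro Bochner_Integration.integral_cong refl)
          fix z assume "z \<in> space \<nu>"
          then have "cmod (z powi (- n)) = 1" by (simp add: space norm_power_int)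
          then show "norm (z powi (- n) * of_real ((cmod (G N z))\<^sup>2) - z powi (- n) * of_real ((cmod (g z))\<^sup>2)) = \<bar>(cmod (G N z))\<^sup>2 - (cmod (g z))\<^sup>2\<bar>"
            by (simp only: right_diff_distrib[symmetric] norm_mult mult_1 of_real_diff[symmetric] norm_of_real)
        qed
        finally show "norm (?A (G N) -
          ?A g) \<le> (\<integral>z. \<bar>(cmod (G N z))\<^sup>2 - (cmod (g z))\<^sup>2\<bar> \<partial>\<nu>)" .
      qed
    qed
    have eq: "?A (G N) = of_real (\<integral>\<omega>. S n N \<omega> * S 0 N \<omega> \<partial>M)" for N
    proof -
      have "?A (G N) =
        (\<Sum>i\<in>J N. \<Sum>j\<in>J N. of_real (a i) * cnj (of_real (a j)) * of_real (covariance M X (- n + i - j)))"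
        unfolding G_def complex_norm_square by (rule X.spectral_integral_mult[OF \<nu>, where c = "\<lambda>i. of_real (a i)" and d = "\<lambda>i. i"])
      also have "\<dots> = of_real (\<Sum>j\<in>J N. \<Sum>i\<in>J N. a j * a i * covariance M X (j + n - (i + 0)))"
      proof -
        \<comment> \<open>Evenness of the covariance absorbs the minus sign of the Fourier
          coefficient; the summand 0 keeps the shape coming from \<open>S 0 N\<close>.\<close>
        have "covariance M X (- n + i - j) = covariance M X (j + n - (i + 0))" for i j
          using X.covariance_minus[of "j + n - i"] by (simp add: algebra_simps)
        then show ?thesis by (subst sum.swap) (simp add: mult_ac)
      qed
      also have "(\<Sum>j\<in>J N. \<Sum>i\<in>J N. a j * a i * covariance M X (j + n - (i + 0))) = (\<integral>\<omega>. S n N \<omega> * S 0 N \<omega> \<partial>M)"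
      proof -
        have "S n N \<omega> * S 0 N \<omega> = (\<Sum>j\<in>J N. \<Sum>i\<in>J N. a j * a i * (X (j + n) \<omega> * X (i + 0) \<omega>))" for \<omega>
          unfolding S_def sum_product by (intro sum.cong refl) (simp only: mult_ac)
        then have "(\<integral>\<omega>. S n N \<omega> * S 0 N \<omega> \<partial>M) = (\<integral>\<omega>. (\<Sum>j\<in>J N. \<Sum>i\<in>J N. a j * a i * (X (j + n) \<omega> * X (i + 0) \<omega>)) \<partial>M)"
          by presburger
        also have "\<dots> = (\<Sum>j\<in>J N. \<Sum>i\<in>J N. a j * a i * (\<integral>\<omega>. X (j + n) \<omega> * X (i + 0) \<omega> \<partial>M))"
          using X.Z_mult_integrable by (simp add: Bochner_Integration.integral_sum del: add_0_right)
        finally show ?thesis by (simp only: X.covariance_eq)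
      qed
      finally show ?thesis .
    qed
    have lim2: "(\<lambda>N. complex_of_real (\<integral>\<omega>. S n N \<omega> * S 0 N \<omega> \<partial>M)) \<longlonglongrightarrow> of_real (covariance M Y n)"
      unfolding cov by (intro tendsto_of_real L2_limit_integral_mult Slim)
    have "?A g = of_real (covariance M Y n)"
      by (rule LIMSEQ_unique[OF lim1[unfolded eq] lim2])
    moreover have "(\<integral>z. z powi (- n) \<partial>density \<nu> (\<lambda>z. ennreal ((cmod (g z))\<^sup>2))) = ?A g"
      by (subst integral_density) (auto simp: scaleR_conv_of_real mult.commute)
    ultimately show ?thesis by simp
  qed
  then show ?thesis
    unfolding spectral_measure_def
    using finite_measure_density_norm2[OF fin sets gm gi] sets by simp
qed

lemma entropy_rate_mult_exp:
  assumes "0 \<le> x" shows "entropy_rate (x * exp (2 * i)) = entropy_rate x + ereal i"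
proof (cases "x = 0")
  case False
  then have "ln (2 * pi * exp 1 * (x * exp (2 * i))) = ln (2 * pi * exp 1 * x) + 2 * i"
    using assms ln_mult_pos[of "2 * pi * exp 1 * x" "exp (2 * i)"] by (simp add: mult_ac)
  then show ?thesis using False by (simp add: entropy_rate_def add_divide_distrib)
qed (simp add: entropy_rate_def)

text \<open>The sum on the right is meaningless if X has entropy -\<infinity> while the integral of
  ln |g| is \<infinity> or does not exist. The second part excludes exactly this, since by the first
  part the integral exists whenever the entropy of X is not -\<infinity>. In \<open>ereal\<close>
  the sum -\<infinity> + \<infinity> evaluates to \<infinity>, a value that the entropy of Y never
  takes.\<close>

theorem corollary6p5:
  fixes M :: "'a measure"
    and X Y :: "int \<Rightarrow> 'a \<Rightarrow> real"
    and \<nu> :: "complex measure"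
    and a :: "int \<Rightarrow> real"
    and g :: "complex \<Rightarrow> complex"
  assumes "prob_space M"
    and "stationary_gaussian M X"
    and "spectral_measure M X \<nu>"
    and "L2_series \<nu> (\<lambda>n z. of_real (a n) * z powi n) g"
    and "stationary_gaussian M Y"
    and "\<And>k. L2_series M (\<lambda>n \<omega>. a n * X (n + k) \<omega>) (Y k)"
  defines "I \<equiv> ext_integral circle_lebesgue (\<lambda>z. ext_log (cmod (g z)))"
    and "I_exists \<equiv> has_ext_integral circle_lebesgue (\<lambda>z. ext_log (cmod (g z)))"
  shows "(shannon_entropy M X \<noteq> - \<infinity> \<longrightarrow> I_exists) \<and>
         (I_exists \<and> \<not> (shannon_entropy M X = - \<infinity> \<and> I = \<infinity>) \<longrightarrow>
           shannon_entropy M Y = shannon_entropy M X + I)"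
proof -
  interpret X: stationary_gaussian_process M X
    using assms(1,2) by (intro stationary_gaussian_process.intro stationary_gaussian_process_axioms.intro)
  interpret Y: stationary_gaussian_process M Y
    using assms(1,5) by (intro stationary_gaussian_process.intro stationary_gaussian_process_axioms.intro)
  note XY = X.stationary_gaussian_process_axioms Y.stationary_gaussian_process_axioms
  let ?\<nu>g = "density \<nu> (\<lambda>z. ennreal ((cmod (g z))\<^sup>2))"
  define P where "P = (\<integral>\<^sup>+z. e2ennreal (ext_log (cmod (g z))) \<partial>circle_lebesgue)"
  define N where "N = (\<integral>\<^sup>+z. e2ennreal (- ext_log (cmod (g z))) \<partial>circle_lebesgue)"
  have g: "g \<in> borel_measurable \<nu>" "integrable \<nu> (\<lambda>z. (cmod (g z))\<^sup>2)"
    using assms(4) by (auto simp: L2_series_def L2_limit_def)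
  note ctx = X.spectral_finite[OF assms(3)] X.spectral_sets[OF assms(3)] g
  have HX: "shannon_entropy M X = entropy_rate (szego \<nu>)"
    by (rule X.shannon_entropy_eq[OF assms(3)])
  have HY: "shannon_entropy M Y = entropy_rate (szego ?\<nu>g)"
    by (rule Y.shannon_entropy_eq[OF spectral_measure_filtered[OF XY assms(3,4,6)]])
  have Pfin: "P < \<infinity>" if "szego \<nu> \<noteq> 0"
    using nn_integral_log_finite[OF ctx] szego_nonneg[of \<nu>] that by (simp add: P_def)
  have I: "I = enn2ereal P - enn2ereal N" and I_exists: "I_exists \<longleftrightarrow> P < \<infinity> \<or> N < \<infinity>"
    by (simp_all add: I_def I_exists_def ext_integral_def has_ext_integral_def P_def N_def)
  have "shannon_entropy M X \<noteq> - \<infinity> \<longrightarrow> I_exists"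
    using Pfin by (auto simp: HX I_exists entropy_rate_def)
  moreover have "shannon_entropy M Y = shannon_entropy M X + I"
    if ex: "I_exists" and nd: "\<not> (shannon_entropy M X = - \<infinity> \<and> I = \<infinity>)"
  proof -
    consider (inf) "P = \<infinity>" "N < \<infinity>" | (minf) "P < \<infinity>" "N = \<infinity>" | (fin) "P < \<infinity>" "N < \<infinity>"
      using ex I_exists by (metis infinity_ennreal_def less_top)
    then show ?thesis
    proof cases
      case inf
      then have "I = \<infinity>" unfolding I by (cases N) (auto simp: enn2ereal_ennreal)
      \<comment> \<open>An infinite positive part forces the infimum for \<nu> to be 0. Then X has
        entropy -\<infinity>, which is the excluded combination.\<close>
      moreover have "szego \<nu> = 0" using Pfin inf by auto
      ultimately show ?thesis using nd by (simp add: HX entropy_rate_def)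
    next
      case minf
      then have "I = - \<infinity>" unfolding I by (cases P) (auto simp: enn2ereal_ennreal)
      moreover have "szego ?\<nu>g = 0"
        using minf unfolding P_def N_def by (rule szego_density_eq_0[OF ctx])
      ultimately show ?thesis by (simp add: HX HY entropy_rate_def)
    next
      case fin
      have "I = ereal (enn2real P - enn2real N)"
        unfolding I using fin by (cases P; cases N) (auto simp: enn2ereal_ennreal)
      moreover have "szego ?\<nu>g = szego \<nu> * exp (2 * (enn2real P - enn2real N))"
        using fin unfolding P_def N_def by (rule szego_density[OF ctx])
      ultimately show ?thesis
        by (simp only: HX HY entropy_rate_mult_exp[OF szego_nonneg])
    qed
  qed
  ultimately show ?thesis by blast
qed

end
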